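(* Let $v:\mathbb R^3\to\mathbb R^3$ and $p:\mathbb R^3\to\mathbb R$ be smooth functions satisfying the stationary Navier--Stokes equations $$-\Delta v+(v\cdot\nabla)v+\nabla p=0,\qquad \operatorname{div} v=0\quad\text{in }\mathbb R^3,$$ and suppose that $v(x)\to 0$ as $|x|\to\infty$. If $$E_\omega:=\limsup_{|x|\to\infty}|x|^{5/3}\,|\operatorname{curl} v(x)|<\infty,$$ then $v\equiv 0$. *)

theory Defs
  imports "HOL-Analysis.Analysis"
begin

definition partial_derivative ::
    "'n::finite \<Rightarrow> (real^'n \<Rightarrow> 'b::real_normed_vector) \<Rightarrow> real^'n \<Rightarrow> 'b" where
  "partial_derivative i f x = vector_derivative (\<lambda>t. f (x + t *\<^sub>R axis i 1)) (at 0)"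

text \<open>
  Class $C^k$ on the whole space. Total differentiability is required at each step so that
  every partial derivative occurring in the recursion is genuine: \<^const>\<open>vector_derivative\<close>
  is an arbitrary value where no derivative exists.
\<close>

primrec Ck :: "nat \<Rightarrow> (real^'n::finite \<Rightarrow> 'b::real_normed_vector) \<Rightarrow> bool" where
  "Ck 0 f \<longleftrightarrow> continuous_on UNIV f"
| "Ck (Suc k) f \<longleftrightarrow> f differentiable_on UNIV \<and> (\<forall>i. Ck k (partial_derivative i f))"

definition smooth :: "(real^'n::finite \<Rightarrow> 'b::real_normed_vector) \<Rightarrow> bool" where
  "smooth f \<longleftrightarrow> (\<forall>k. Ck k f)"

definition gradient :: "(real^'n::finite \<Rightarrow> real) \<Rightarrow> real^'n \<Rightarrow> real^'n" where
  "gradient p x = (\<chi> i. partial_derivative i p x)"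

definition divergence :: "(real^'n::finite \<Rightarrow> real^'n) \<Rightarrow> real^'n \<Rightarrow> real" where
  "divergence v x = (\<Sum>i\<in>UNIV. partial_derivative i (\<lambda>y. v y $ i) x)"

definition laplacian ::
    "(real^'n::finite \<Rightarrow> 'b::real_normed_vector) \<Rightarrow> real^'n \<Rightarrow> 'b" where
  "laplacian f x = (\<Sum>i\<in>UNIV. partial_derivative i (partial_derivative i f) x)"

text \<open>The derivative $(u \cdot \nabla) w$ of \<open>w\<close> along the vector field \<open>u\<close>.\<close>

definition advection ::
    "(real^'n::finite \<Rightarrow> real^'n) \<Rightarrow> (real^'n \<Rightarrow> 'b::real_normed_vector) \<Rightarrow> real^'n \<Rightarrow> 'b" where
  "advection u w x = (\<Sum>i\<in>UNIV. (u x $ i) *\<^sub>R partial_derivative i w x)"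

definition curl :: "(real^3 \<Rightarrow> real^3) \<Rightarrow> real^3 \<Rightarrow> real^3" where
  "curl v x = vector
    [partial_derivative 2 (\<lambda>y. v y $ 3) x - partial_derivative 3 (\<lambda>y. v y $ 2) x,
     partial_derivative 3 (\<lambda>y. v y $ 1) x - partial_derivative 1 (\<lambda>y. v y $ 3) x,
     partial_derivative 1 (\<lambda>y. v y $ 2) x - partial_derivative 2 (\<lambda>y. v y $ 1) x]"

end

theory Submission
  imports Defs
begin

text \<open>
  Write \<open>\<omega> = curl v\<close>, \<open>H = |v|\<^sup>2/2 + p\<close> for the total head and \<open>J = 1 + |x|\<^sup>2\<close>. The equations become
  \<open>\<nabla>H = v \<times> \<omega> - curl \<omega>\<close>, whence \<open>\<Delta>H = div (v \<times> \<omega>)\<close> and \<open>\<Delta>H - v \<cdot> \<nabla>H = |\<omega>|\<^sup>2\<close>.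
  The decay of \<open>\<omega>\<close> passes to \<open>v\<close> and (after subtracting a constant from \<open>p\<close>) to \<open>H\<close>: the averages
  of \<open>v\<close> and \<open>H\<close> over a ball of radius \<open>r\<close> with a radial weight have \<open>r\<close>-derivatives that are
  averages of \<open>\<omega>\<close> and \<open>v \<times> \<omega>\<close>. An arbitrarily small loss in the exponents is harmless; we lose \<open>1/120\<close>.

  The maximum principle gives \<open>Q = - H \<ge> 0\<close>. Since \<open>div v = 0\<close>, every renormalization \<open>F\<close> satisfies
  \<open>\<integral> F'(Q) |\<omega>|\<^sup>2 = \<integral> F''(Q) |\<nabla>Q|\<^sup>2\<close> if \<open>F\<close> vanishes near \<open>0\<close>, because then \<open>F(Q)\<close> has compact support. Let
  \<open>F = F\<^sub>\<epsilon>\<close> with \<open>F\<^sub>\<epsilon>' \<rightarrow> 1\<close> and \<open>F\<^sub>\<epsilon>''(Q) \<le> 6 \<epsilon>\<^sup>2/Q\<^sup>3\<close>. The right-hand side tends to \<open>0\<close> by interpolation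
  between two bounds: \<open>\<integral> J\<^sup>a |\<nabla>Q|\<^sup>2 < \<infinity>\<close>, from the divergence form of \<open>\<Delta>H\<close>, and
  \<open>\<integral> J\<^sup>-\<^sup>b Q\<^sup>-\<^sup>3\<^sup>/\<^sup>2 |\<nabla>Q|\<^sup>2 < \<infinity>\<close>, from \<open>Q\<close> being a nonnegative supersolution. So \<open>\<omega> = 0\<close> where \<open>Q > 0\<close>,
  hence everywhere, and the decay estimate for \<open>v\<close> with vanishing \<open>\<omega>\<close> yields \<open>v = 0\<close>.
\<close>

text \<open>Write J for \<open>bracket\<close>, so powers of J are half powers of |x|. Without loss,
  curl of size J^(-5/6) gives v of size J^(-1/3), v x curl v of size J^(-7/6) and H of size
  J^(-2/3); the loss turns these three exponents into 13/40, 139/120 and 13/20. The obstacle: near Q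
  = \<epsilon> the weight \<epsilon>^2/Q^3 has size 1/Q, so a little more than finiteness of the
  integral of |grad Q|^2/Q is required. The first gradient bound has no negative power of Q, the
  second has a weight that decays in space. Where J^a >= 1/Q the first one suffices. Elsewhere J <
  Q^(-1/a), hence for small Q the second weight J^(-b) Q^(-3/2) is at least Q^(b/a - 3/2), which
  beats 1/Q as soon as b/a < 1/2. Error terms in R^3 must decay faster than J^(-3/2). In the first
  bound the worst is H^2 times the Laplacian of J^a, so a < 13/10 + 1 - 3/2 = 4/5. In the second it
  is sqrt(Q) v . grad J^(-b), so b > 1 - 13/40 - 13/40 = 7/20. The choice a = 3/4, b = 9/25 has
  ratio 12/25; the margin below 1/2 pays for the gain \<epsilon>^(1/100).\<close>

section \<open>Partial derivatives\<close>

text \<open>A relation between two functions rather than an operator: it asserts that the derivative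
  exists everywhere, which an equation for \<open>partial_derivative\<close> does not, and it lets
  product, chain and sum rules be composed against an explicitly given derivative.\<close>

definition has_partial :: "'n::finite \<Rightarrow> (real^'n \<Rightarrow> real) \<Rightarrow> (real^'n \<Rightarrow> real) \<Rightarrow> bool" where
  "has_partial i f f' \<longleftrightarrow>
    (\<forall>x. ((\<lambda>t. f (x + t *\<^sub>R axis i 1)) has_real_derivative f' x) (at 0))"

lemma has_partialD:
  assumes "has_partial i f f'"
  shows "((\<lambda>t. f (x + t *\<^sub>R axis i 1)) has_real_derivative f' (x + s *\<^sub>R axis i 1)) (at s)"
proof -
  have "((\<lambda>t. f ((x + s *\<^sub>R axis i 1) + t *\<^sub>R axis i 1)) has_real_derivative
      f' (x + s *\<^sub>R axis i 1)) (at 0)"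
    using assms unfolding has_partial_def by blast
  then have "((\<lambda>t. f (x + (t + s) *\<^sub>R axis i 1)) has_real_derivative
      f' (x + s *\<^sub>R axis i 1)) (at 0)"
    by (simp add: scaleR_add_left add_ac)
  then show ?thesis
    using DERIV_shift[of "\<lambda>t. f (x + t *\<^sub>R axis i 1)" "f' (x + s *\<^sub>R axis i 1)" 0 s] by simp
qed

lemma has_partial_eqI: "has_partial i f f' \<Longrightarrow> partial_derivative i f = f'"
  by (auto simp: has_partial_def partial_derivative_def fun_eq_iff
      has_real_derivative_iff_has_vector_derivative intro!: vector_derivative_at)

lemma has_partial_const: "has_partial i (\<lambda>x. c) (\<lambda>x. 0)"
  by (simp add: has_partial_def)

lemma has_partial_add:
  "has_partial i f f' \<Longrightarrow> has_partial i g g' \<Longrightarrow> has_partial i (\<lambda>x. f x + g x) (\<lambda>x. f' x + g' x)"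
  by (auto simp: has_partial_def intro!: derivative_intros)

lemma has_partial_diff:
  "has_partial i f f' \<Longrightarrow> has_partial i g g' \<Longrightarrow> has_partial i (\<lambda>x. f x - g x) (\<lambda>x. f' x - g' x)"
  by (auto simp: has_partial_def intro!: derivative_intros)

lemma has_partial_mult:
  assumes "has_partial i f f'" "has_partial i g g'"
  shows "has_partial i (\<lambda>x. f x * g x) (\<lambda>x. f' x * g x + f x * g' x)"
  unfolding has_partial_def
proof
  fix x
  have "((\<lambda>t. f (x + t *\<^sub>R axis i 1)) has_real_derivative f' x) (at 0)"
    "((\<lambda>t. g (x + t *\<^sub>R axis i 1)) has_real_derivative g' x) (at 0)"
    using assms by (auto simp: has_partial_def)
  from DERIV_mult[OF this]
  show "((\<lambda>t. f (x + t *\<^sub>R axis i 1) * g (x + t *\<^sub>R axis i 1)) has_real_derivative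
      f' x * g x + f x * g' x) (at 0)" by (simp add: algebra_simps)
qed

lemma has_partial_sum:
  "(\<And>j. j \<in> S \<Longrightarrow> has_partial i (f j) (f' j)) \<Longrightarrow>
    has_partial i (\<lambda>x. \<Sum>j\<in>S. f j x) (\<lambda>x. \<Sum>j\<in>S. f' j x)"
  by (auto simp: has_partial_def intro!: DERIV_sum)

lemma has_partial_chain:
  assumes "has_partial i f f'" "\<And>x. (\<phi> has_real_derivative \<phi>' (f x)) (at (f x))"
  shows "has_partial i (\<lambda>x. \<phi> (f x)) (\<lambda>x. \<phi>' (f x) * f' x)"
  unfolding has_partial_def
proof
  fix x
  have 1: "((\<lambda>t. f (x + t *\<^sub>R axis i 1)) has_real_derivative f' x) (at 0)"
    using assms by (auto simp: has_partial_def)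
  show "((\<lambda>t. \<phi> (f (x + t *\<^sub>R axis i 1))) has_real_derivative \<phi>' (f x) * f' x) (at 0)"
    using DERIV_chain2[OF _ 1, of \<phi> "\<phi>' (f x)"] assms(2)[of x] by simp
qed

lemma has_partial_coord: "has_partial i (\<lambda>x. x $ j) (\<lambda>x. if i = j then 1 else 0)"
  unfolding has_partial_def by (auto simp: axis_def intro!: derivative_eq_intros)

lemma has_partial_shift_scale:
  assumes "has_partial i f f'"
  shows "has_partial i (\<lambda>y. f (c + r *\<^sub>R y)) (\<lambda>y. r * f' (c + r *\<^sub>R y))"
  unfolding has_partial_def
proof
  fix y
  have 1: "((\<lambda>t. f ((c + r *\<^sub>R y) + t *\<^sub>R axis i 1)) has_real_derivative f' (c + r *\<^sub>R y)) (at (r * 0))"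
    using assms by (auto simp: has_partial_def)
  have "((\<lambda>t. f ((c + r *\<^sub>R y) + (r * t) *\<^sub>R axis i 1)) has_real_derivative
      f' (c + r *\<^sub>R y) * r) (at 0)"
    by (rule DERIV_chain2[where f = "\<lambda>t. f ((c + r *\<^sub>R y) + t *\<^sub>R axis i 1)"
          and g = "\<lambda>t. r * t", OF 1]) (auto intro!: derivative_eq_intros)
  then show "((\<lambda>t. f (c + r *\<^sub>R (y + t *\<^sub>R axis i 1))) has_real_derivative
      r * f' (c + r *\<^sub>R y)) (at 0)"
    by (simp add: algebra_simps)
qed

lemma has_partial_zero_on_open:
  assumes "has_partial i f f'" "open U" "x \<in> U" and zero: "\<And>y. y \<in> U \<Longrightarrow> f y = 0"
  shows "f' x = 0"
proof -
  have "((\<lambda>t. x + t *\<^sub>R axis i 1) \<longlongrightarrow> x + 0 *\<^sub>R axis i 1) (at (0::real))"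
    by (intro tendsto_intros)
  then have "\<forall>\<^sub>F t in at 0. x + t *\<^sub>R axis i 1 \<in> U"
    using assms(2,3) by (auto dest: topological_tendstoD)
  then have "\<forall>\<^sub>F t in at 0. f (x + t *\<^sub>R axis i 1) = 0"
    by eventually_elim (rule zero)
  then have "((\<lambda>t. f (x + t *\<^sub>R axis i 1)) has_real_derivative 0) (at 0) \<longleftrightarrow>
      ((\<lambda>t. 0) has_real_derivative (0::real)) (at (0::real))"
    using zero[OF assms(3)] by (intro has_field_derivative_cong_eventually) auto
  moreover have "((\<lambda>t. f (x + t *\<^sub>R axis i 1)) has_real_derivative f' x) (at 0)"
    using assms(1) by (simp add: has_partial_def)
  ultimately show ?thesis by (auto dest: DERIV_unique)
qed

lemma has_derivative_partials:
  fixes f :: "real^'n::finite \<Rightarrow> 'b::real_normed_vector" and x :: "real^'n"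
  assumes "f differentiable at x"
  shows "(f has_derivative (\<lambda>h. \<Sum>i\<in>UNIV. h $ i *\<^sub>R partial_derivative i f x)) (at x)"
proof -
  obtain D where D: "(f has_derivative D) (at x)"
    using assms by (auto simp: differentiable_def)
  then have lin: "linear D" by (rule has_derivative_linear)
  have pd: "partial_derivative i f x = D (axis i 1)" for i
  proof -
    have g: "((\<lambda>t::real. x + t *\<^sub>R axis i 1) has_derivative (\<lambda>t. t *\<^sub>R axis i 1)) (at 0)"
      by (auto intro!: derivative_eq_intros)
    have "((\<lambda>t. f (x + t *\<^sub>R axis i 1)) has_derivative (\<lambda>t. D (t *\<^sub>R axis i 1))) (at 0)"
      using has_derivative_compose[OF g, of f D] D by simp
    then have "((\<lambda>t. f (x + t *\<^sub>R axis i 1)) has_vector_derivative D (axis i 1)) (at 0)"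
      by (simp add: has_vector_derivative_def linear_cmul[OF lin])
    then show ?thesis
      by (simp add: partial_derivative_def vector_derivative_at)
  qed
  have "D h = (\<Sum>i\<in>UNIV. h $ i *\<^sub>R partial_derivative i f x)" for h
  proof -
    have "D h = D (\<Sum>i\<in>UNIV. h $ i *\<^sub>R axis i 1)"
      by (simp add: basis_expansion flip: scalar_mult_eq_scaleR)
    also have "\<dots> = (\<Sum>i\<in>UNIV. h $ i *\<^sub>R D (axis i 1))"
      by (simp add: linear_sum[OF lin] linear_cmul[OF lin])
    finally show ?thesis by (simp add: pd)
  qed
  then have "D = (\<lambda>h. \<Sum>i\<in>UNIV. h $ i *\<^sub>R partial_derivative i f x)" by blast
  with D show ?thesis by simp
qed

lemma differentiable_has_partial:
  fixes f :: "real^'n::finite \<Rightarrow> real"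
  assumes "f differentiable_on UNIV"
  shows "has_partial i f (partial_derivative i f)"
  unfolding has_partial_def
proof
  fix x :: "real^'n"
  have g: "((\<lambda>t::real. x + t *\<^sub>R axis i 1) has_derivative (\<lambda>t. t *\<^sub>R axis i 1)) (at 0)"
    by (auto intro!: derivative_eq_intros)
  have "f differentiable (at x)" using assms by (simp add: differentiable_on_def)
  from has_derivative_partials[OF this]
  have "((\<lambda>t. f (x + t *\<^sub>R axis i 1)) has_derivative
      (\<lambda>t. \<Sum>j\<in>UNIV. (t *\<^sub>R axis i 1) $ j *\<^sub>R partial_derivative j f x)) (at 0)"
    by (rule has_derivative_compose[OF g, of f, simplified])
  moreover have "(\<Sum>j\<in>UNIV. (t *\<^sub>R axis i 1) $ j *\<^sub>R partial_derivative j f x)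
      = t * partial_derivative i f x" for t
    by (simp add: axis_def if_distrib[of "\<lambda>z. _ * z"] if_distrib[of "\<lambda>z. z * _"] cong: if_cong)
  ultimately show "((\<lambda>t. f (x + t *\<^sub>R axis i 1)) has_real_derivative partial_derivative i f x) (at 0)"
    by (simp add: has_field_derivative_def mult.commute[of _ "partial_derivative i f x"])
qed

section \<open>Closure properties of smooth functions and symmetry of second partials\<close>

lemma Ck_Suc_imp_Ck: "Ck (Suc k) f \<Longrightarrow> Ck k f"
  by (induction k arbitrary: f) (auto intro: differentiable_imp_continuous_on)

lemma smooth_continuous_on: "smooth f \<Longrightarrow> continuous_on UNIV f"
  unfolding smooth_def by (metis Ck.simps(1))

lemma smooth_differentiable_on: "smooth f \<Longrightarrow> f differentiable_on UNIV"
  unfolding smooth_def by (metis Ck.simps(2))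

lemma smooth_partial_derivative: "smooth f \<Longrightarrow> smooth (partial_derivative i f)"
  unfolding smooth_def by (metis Ck.simps(2))

lemma smooth_has_partial:
  fixes f :: "real^'n::finite \<Rightarrow> real"
  shows "smooth f \<Longrightarrow> has_partial i f (partial_derivative i f)"
  by (simp add: smooth_differentiable_on differentiable_has_partial)

lemma Ck_const: "Ck k (\<lambda>x::real^'n::finite. c::real)"
proof (induction k arbitrary: c)
  case (Suc k)
  have "partial_derivative i (\<lambda>x::real^'n. c) = (\<lambda>x. 0)" for i
    by (intro has_partial_eqI has_partial_const)
  with Suc show ?case by simp
qed simp

lemma Ck_add:
  fixes f g :: "real^'n::finite \<Rightarrow> real"
  shows "Ck k f \<Longrightarrow> Ck k g \<Longrightarrow> Ck k (\<lambda>x. f x + g x)"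
proof (induction k arbitrary: f g)
  case (Suc k)
  have "partial_derivative i (\<lambda>x. f x + g x) =
      (\<lambda>x. partial_derivative i f x + partial_derivative i g x)" for i
    using Suc.prems by (intro has_partial_eqI has_partial_add differentiable_has_partial) auto
  with Suc show ?case by auto
qed (simp_all add: continuous_on_add continuous_on_mult continuous_on_component)

lemma Ck_mult:
  fixes f g :: "real^'n::finite \<Rightarrow> real"
  shows "Ck k f \<Longrightarrow> Ck k g \<Longrightarrow> Ck k (\<lambda>x. f x * g x)"
proof (induction k arbitrary: f g)
  case (Suc k)
  have "partial_derivative i (\<lambda>x. f x * g x) =
      (\<lambda>x. partial_derivative i f x * g x + f x * partial_derivative i g x)" for i
    using Suc.prems by (intro has_partial_eqI has_partial_mult differentiable_has_partial) auto
  moreover have "Ck k f" "Ck k g" using Suc.prems by (auto intro: Ck_Suc_imp_Ck)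
  ultimately show ?case using Suc by (auto intro!: Ck_add)
qed (simp_all add: continuous_on_add continuous_on_mult continuous_on_component)

lemma smooth_const: "smooth (\<lambda>x::real^'n::finite. c::real)"
  by (simp add: smooth_def Ck_const)

lemma smooth_add:
  fixes f g :: "real^'n::finite \<Rightarrow> real"
  shows "smooth f \<Longrightarrow> smooth g \<Longrightarrow> smooth (\<lambda>x. f x + g x)"
  by (simp add: smooth_def Ck_add)

lemma smooth_mult:
  fixes f g :: "real^'n::finite \<Rightarrow> real"
  shows "smooth f \<Longrightarrow> smooth g \<Longrightarrow> smooth (\<lambda>x. f x * g x)"
  by (simp add: smooth_def Ck_mult)

lemma smooth_diff:
  fixes f g :: "real^'n::finite \<Rightarrow> real"
  assumes "smooth f" "smooth g"
  shows "smooth (\<lambda>x. f x - g x)"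
  using smooth_add[OF assms(1) smooth_mult[OF smooth_const[of "-1"] assms(2)]] by simp

lemma smooth_sum:
  fixes f :: "'i \<Rightarrow> real^'n::finite \<Rightarrow> real"
  shows "(\<And>j. j \<in> S \<Longrightarrow> smooth (f j)) \<Longrightarrow> smooth (\<lambda>x. \<Sum>j\<in>S. f j x)"
  by (induction S rule: infinite_finite_induct) (auto simp: smooth_const smooth_add)

lemma partial_derivative_component:
  fixes f :: "real^'n::finite \<Rightarrow> real^'m::finite"
  assumes "f differentiable_on UNIV"
  shows "partial_derivative i (\<lambda>x. f x $ j) = (\<lambda>x. partial_derivative i f x $ j)"
proof
  fix x
  have "f differentiable at x" using assms by (simp add: differentiable_on_def)
  then have 1: "((\<lambda>x. f x $ j) has_derivative
      (\<lambda>h. (\<Sum>i\<in>UNIV. h $ i *\<^sub>R partial_derivative i f x) $ j)) (at x)"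
    by (intro bounded_linear.has_derivative[OF bounded_linear_vec_nth] has_derivative_partials)
  then have "(\<lambda>x. f x $ j) differentiable (at x)" by (auto simp: differentiable_def)
  from has_derivative_unique[OF has_derivative_partials[OF this] 1]
  have "(\<Sum>k\<in>UNIV. axis i 1 $ k *\<^sub>R partial_derivative k (\<lambda>x. f x $ j) x) =
      (\<Sum>k\<in>UNIV. axis i 1 $ k *\<^sub>R partial_derivative k f x) $ j"
    by (rule fun_cong)
  then show "partial_derivative i (\<lambda>x. f x $ j) x = partial_derivative i f x $ j"
    by (simp add: axis_def if_distrib[of "\<lambda>z. z * _"] if_distrib[of "\<lambda>z. z *\<^sub>R _"] cong: if_cong)
qed

lemma Ck_component:
  fixes f :: "real^'n::finite \<Rightarrow> real^'m::finite"
  shows "Ck k f \<Longrightarrow> Ck k (\<lambda>x. f x $ j)"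
proof (induction k arbitrary: f)
  case (Suc k)
  then have "f differentiable_on UNIV" by simp
  then have "(\<lambda>x. f x $ j) differentiable_on UNIV"
    unfolding differentiable_on_def differentiable_def
    using bounded_linear.has_derivative[OF bounded_linear_vec_nth] by blast
  then show ?case
    using Suc partial_derivative_component[OF \<open>f differentiable_on UNIV\<close>] by simp
qed (simp_all add: continuous_on_add continuous_on_mult continuous_on_component)

lemma smooth_component:
  fixes f :: "real^'n::finite \<Rightarrow> real^'m::finite"
  shows "smooth f \<Longrightarrow> smooth (\<lambda>x. f x $ j)"
  by (simp add: smooth_def Ck_component)

text \<open>By the fundamental theorem, an increment of f in direction i is an integral of its i-th
  partial. Differentiating under that integral in direction j expresses increments of the j-th
  partial through one mixed partial; differentiating in the upper limit at 0 identifies it with the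
  other.\<close>

lemma partial_derivative_commute:
  fixes f :: "real^'n::finite \<Rightarrow> real"
  assumes "smooth f"
  shows "partial_derivative i (partial_derivative j f) = partial_derivative j (partial_derivative i f)"
proof
  fix x
  let ?i = "axis i 1 :: real^'n" and ?j = "axis j 1 :: real^'n"
  note hp = smooth_has_partial[OF assms]
    smooth_has_partial[OF smooth_partial_derivative[OF assms]]
  note co = smooth_continuous_on[OF assms]
    smooth_continuous_on[OF smooth_partial_derivative[OF assms]]
    smooth_continuous_on[OF smooth_partial_derivative[OF smooth_partial_derivative[OF assms]]]
  note co' [continuous_intros] = co[THEN continuous_on_compose2, OF _ subset_UNIV]
  have FTC: "f (x + t *\<^sub>R ?j + s *\<^sub>R ?i) - f (x + t *\<^sub>R ?j) =
      integral {0..s} (\<lambda>\<sigma>. partial_derivative i f (x + t *\<^sub>R ?j + \<sigma> *\<^sub>R ?i))"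
    if "0 \<le> s" for s t
  proof -
    have "((\<lambda>\<sigma>. partial_derivative i f (x + t *\<^sub>R ?j + \<sigma> *\<^sub>R ?i)) has_integral
      (f (x + t *\<^sub>R ?j + s *\<^sub>R ?i) - f (x + t *\<^sub>R ?j + 0 *\<^sub>R ?i))) {0..s}"
      using that has_partialD[OF hp(1)[of i]]
      by (intro fundamental_theorem_of_calculus)
        (auto simp: has_real_derivative_iff_has_vector_derivative intro: has_vector_derivative_at_within)
    then show ?thesis by (simp add: integral_unique)
  qed
  have D: "partial_derivative j f (x + s *\<^sub>R ?i) - partial_derivative j f x =
      integral {0..s} (\<lambda>\<sigma>. partial_derivative j (partial_derivative i f) (x + \<sigma> *\<^sub>R ?i))"
    if "0 \<le> s" for s
  proof -
    have "((\<lambda>t. integral (cbox 0 s) (\<lambda>\<sigma>. partial_derivative i f ((x + \<sigma> *\<^sub>R ?i) + t *\<^sub>R ?j)))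
      has_real_derivative integral (cbox 0 s)
        (\<lambda>\<sigma>. partial_derivative j (partial_derivative i f) ((x + \<sigma> *\<^sub>R ?i) + 0 *\<^sub>R ?j))) (at 0 within UNIV)"
      by (rule leibniz_rule_field_derivative[where U = UNIV and ?x0.0 = 0 and
            fx = "\<lambda>t \<sigma>. partial_derivative j (partial_derivative i f) ((x + \<sigma> *\<^sub>R ?i) + t *\<^sub>R ?j)"])
        (auto intro!: has_partialD hp integrable_continuous_real continuous_intros simp: split_beta)
    moreover have "(\<lambda>t. integral (cbox 0 s) (\<lambda>\<sigma>. partial_derivative i f ((x + \<sigma> *\<^sub>R ?i) + t *\<^sub>R ?j)))
      = (\<lambda>t. f ((x + s *\<^sub>R ?i) + t *\<^sub>R ?j) - f (x + t *\<^sub>R ?j))"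
      using FTC[OF that] by (auto simp: fun_eq_iff add_ac)
    moreover have "((\<lambda>t. f ((x + s *\<^sub>R ?i) + t *\<^sub>R ?j) - f (x + t *\<^sub>R ?j)) has_real_derivative
       partial_derivative j f (x + s *\<^sub>R ?i) - partial_derivative j f x) (at 0)"
      using hp(1)[of j] by (auto simp: has_partial_def intro!: derivative_intros)
    ultimately show ?thesis
      by (auto dest: DERIV_unique)
  qed
  \<comment> \<open>The formula \<open>D\<close> is available only for s >= 0, so the two
    derivatives at 0 are compared one-sidedly on {0..1}.\<close>
  have "((\<lambda>s. partial_derivative j f (x + s *\<^sub>R ?i) - partial_derivative j f x)
      has_vector_derivative partial_derivative i (partial_derivative j f) x) (at 0 within {0..1})"
  proof -
    have "((\<lambda>s. partial_derivative j f (x + s *\<^sub>R ?i) - partial_derivative j f x)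
      has_real_derivative partial_derivative i (partial_derivative j f) x - 0) (at 0)"
      using hp(2)[of i j] unfolding has_partial_def by (intro DERIV_diff DERIV_const) blast
    then show ?thesis
      by (simp add: has_real_derivative_iff_has_vector_derivative has_vector_derivative_at_within)
  qed
  moreover have "((\<lambda>s. partial_derivative j f (x + s *\<^sub>R ?i) - partial_derivative j f x)
      has_vector_derivative partial_derivative j (partial_derivative i f) x) (at 0 within {0..1})"
  proof -
    have "((\<lambda>s. integral {0..s} (\<lambda>\<sigma>. partial_derivative j (partial_derivative i f) (x + \<sigma> *\<^sub>R ?i)))
      has_vector_derivative partial_derivative j (partial_derivative i f) (x + 0 *\<^sub>R ?i)) (at 0 within {0..1})"
      by (rule integral_has_vector_derivative) (auto intro!: continuous_intros)
    then have "((\<lambda>s. integral {0..s} (\<lambda>\<sigma>. partial_derivative j (partial_derivative i f) (x + \<sigma> *\<^sub>R ?i)))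
      has_vector_derivative partial_derivative j (partial_derivative i f) x) (at 0 within {0..1})"
      by simp
    then show ?thesis
      by (rule has_vector_derivative_transform[of 0 "{0..1}", rotated 2]) (simp_all add: D)
  qed
  ultimately show "partial_derivative i (partial_derivative j f) x =
      partial_derivative j (partial_derivative i f) x"
    by (intro vector_derivative_unique_within_closed_interval[of 0 1]) auto
qed

section \<open>Integrals over the whole space\<close>

lemma compact_support_integral:
  fixes f :: "'a::euclidean_space \<Rightarrow> real"
  assumes cont: "continuous_on UNIV f" and supp: "\<And>x. x \<notin> cbox a b \<Longrightarrow> f x = 0"
  shows "integrable lborel f" and "(LINT x|lborel. f x) = integral (cbox a b) f"
proof -
  have eq: "(\<lambda>x. indicator (cbox a b) x *\<^sub>R f x) = f"
    using supp by (auto simp: indicator_def fun_eq_iff)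
  show int: "integrable lborel f"
    using borel_integrable_compact[of "cbox a b" f] continuous_on_subset[OF cont]
    by (simp only: eq compact_cbox subset_UNIV)
  have "(LINT x|lborel. f x) = integral UNIV f"
    using integral_unique[OF has_integral_integral_lborel[OF int]] by simp
  also have "\<dots> = integral UNIV (\<lambda>x. if x \<in> cbox a b then f x else 0)"
    using supp by (intro arg_cong[of _ _ "integral UNIV"]) auto
  also have "\<dots> = integral (cbox a b) f"
    by (rule integral_restrict_UNIV)
  finally show "(LINT x|lborel. f x) = integral (cbox a b) f" .
qed

lemma norm_le_imp_mem_cbox:
  fixes x :: "'a::euclidean_space"
  shows "norm x \<le> R \<Longrightarrow> x \<in> cbox (- R *\<^sub>R One) (R *\<^sub>R One)"
  using Basis_le_norm[of _ x] by (force simp: mem_box abs_le_iff)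

lemma bounded_support_integrable:
  fixes f :: "'a::euclidean_space \<Rightarrow> real"
  assumes "continuous_on UNIV f" "\<And>x. R < norm x \<Longrightarrow> f x = 0"
  shows "integrable lborel f"
proof (rule compact_support_integral(1))
  fix x :: 'a assume "x \<notin> cbox (- R *\<^sub>R One) (R *\<^sub>R One)"
  then show "f x = 0" using norm_le_imp_mem_cbox[of x R] assms(2)[of x] by force
qed fact

lemma integral_translate:
  fixes f :: "'a::euclidean_space \<Rightarrow> real"
  assumes [measurable]: "f \<in> borel_measurable borel"
  shows "(LINT x|lborel. f (x + c)) = (LINT x|lborel. f x)"
proof -
  have "(LINT x|lborel. f x) = (LINT x|distr lborel borel ((+) c). f x)"
    by (simp add: lborel_distr_plus)
  also have "\<dots> = (LINT x|lborel. f (c + x))"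
    by (rule integral_distr) auto
  finally show ?thesis by (simp add: add.commute)
qed

text \<open>The integral of f(x + t e_i) does not depend on t by translation invariance, and its
  t-derivative at 0 is the integral of f'.\<close>

lemma integral_partial_eq_0:
  fixes f :: "real^'n::finite \<Rightarrow> real"
  assumes d: "has_partial i f f'" and cf: "continuous_on UNIV f" and cf': "continuous_on UNIV f'"
    and supp: "\<And>x. R < norm x \<Longrightarrow> f x = 0"
  shows "(LINT x|lborel. f' x) = 0"
proof -
  let ?e = "axis i 1 :: real^'n"
  \<comment> \<open>The unit margin keeps the supports of all translates with |t| <= 1 in one box,
    so the derivative is taken under an integral over a fixed compact set.\<close>
  let ?a = "- (R + 1) *\<^sub>R One :: real^'n" and ?b = "(R + 1) *\<^sub>R One :: real^'n"
  have supp': "f' x = 0" if "R < norm x" for x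
  proof (rule has_partial_zero_on_open[OF d])
    show "open {x::real^'n. R < norm x}"
      by (intro open_Collect_less continuous_intros)
  qed (use supp that in auto)
  have out: "norm x > R + 1" if "x \<notin> cbox ?a ?b" for x :: "real^'n"
    using norm_le_imp_mem_cbox[of x "R + 1"] that by force
  have const: "integral (cbox ?a ?b) (\<lambda>x. f (x + t *\<^sub>R ?e)) = (LINT x|lborel. f x)"
    if "\<bar>t\<bar> \<le> 1" for t
  proof -
    have "(LINT x|lborel. f (x + t *\<^sub>R ?e)) = integral (cbox ?a ?b) (\<lambda>x. f (x + t *\<^sub>R ?e))"
    proof (rule compact_support_integral(2))
      show "continuous_on UNIV (\<lambda>x. f (x + t *\<^sub>R ?e))"
        by (intro continuous_on_compose2[OF cf] continuous_intros) auto
      fix x assume "x \<notin> cbox ?a ?b"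
      from out[OF this] have "R + 1 < norm x" .
      also have "norm x \<le> norm (x + t *\<^sub>R ?e) + norm (t *\<^sub>R ?e)"
        using norm_triangle_ineq4[of "x + t *\<^sub>R ?e" "t *\<^sub>R ?e"] by simp
      finally have "R < norm (x + t *\<^sub>R ?e)" using that by simp
      then show "f (x + t *\<^sub>R ?e) = 0" by (rule supp)
    qed
    moreover have "f \<in> borel_measurable borel" using cf by (rule borel_measurable_continuous_onI)
    ultimately show ?thesis by (simp add: integral_translate)
  qed
  have "((\<lambda>t. integral (cbox ?a ?b) (\<lambda>x. f (x + t *\<^sub>R ?e))) has_real_derivative
      integral (cbox ?a ?b) (\<lambda>x. f' (x + 0 *\<^sub>R ?e))) (at 0 within UNIV)"
    by (rule leibniz_rule_field_derivative[where U = UNIV and ?x0.0 = 0 and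
          fx = "\<lambda>t x. f' (x + t *\<^sub>R ?e)"])
      (auto intro!: has_partialD[OF d] integrable_continuous continuous_intros
        continuous_on_compose2[OF cf] continuous_on_compose2[OF cf'] simp: split_beta)
  moreover have "((\<lambda>t. integral (cbox ?a ?b) (\<lambda>x. f (x + t *\<^sub>R ?e))) has_real_derivative 0) (at 0)
     \<longleftrightarrow> ((\<lambda>t. LINT x|lborel. f x) has_real_derivative 0) (at (0::real))"
  proof (rule has_field_derivative_cong_eventually)
    have "\<forall>\<^sub>F t in at (0::real). \<bar>t\<bar> \<le> 1"
      by (rule eventually_at_le[THEN iffD2]) (auto intro!: exI[of _ 1] simp: dist_norm)
    then show "\<forall>\<^sub>F t in at 0. integral (cbox ?a ?b) (\<lambda>x. f (x + t *\<^sub>R ?e)) = (LINT x|lborel. f x)"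
      by eventually_elim (rule const)
    show "integral (cbox ?a ?b) (\<lambda>x. f (x + 0 *\<^sub>R ?e)) = (LINT x|lborel. f x)"
      by (rule const) simp
  qed
  ultimately have "integral (cbox ?a ?b) f' = 0"
    by (auto dest: DERIV_unique)
  moreover have "(LINT x|lborel. f' x) = integral (cbox ?a ?b) f'"
    by (rule compact_support_integral(2)[OF cf']) (use out supp' in force)
  ultimately show ?thesis by simp
qed

text \<open>Powers of the positive part from the square on are C^1 across 0. The cubes used below
  for cutoffs and truncations are therefore C^2, which is what second-order identities ask
  for.\<close>

lemma DERIV_pos_part_power:
  "((\<lambda>t::real. (max 0 t) ^ (n + 2)) has_real_derivative real (n + 2) * (max 0 t) ^ (n + 1)) (at t)"
proof -
  consider "t > 0" | "t < 0" | "t = 0" by linarith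
  then show ?thesis
  proof cases
    case 1
    then have "\<forall>\<^sub>F s in nhds t. max 0 s ^ (n + 2) = s ^ (n + 2)"
      by (intro eventually_nhds_in_open[of "{0<..}", THEN eventually_mono]) auto
    moreover have "((\<lambda>s. s ^ (n + 2)) has_real_derivative real (n + 2) * t ^ (n + 1)) (at t)"
      using DERIV_pow[of "n + 2" t] by simp
    ultimately show ?thesis using 1 by (simp add: DERIV_cong_ev[OF refl])
  next
    case 2
    then have "\<forall>\<^sub>F s in nhds t. max 0 s ^ (n + 2) = 0"
      by (intro eventually_nhds_in_open[of "{..<0}", THEN eventually_mono]) auto
    then have "((\<lambda>s. max 0 s ^ (n + 2)) has_real_derivative 0) (at t) \<longleftrightarrow>
        ((\<lambda>s. 0) has_real_derivative 0) (at t)"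
      by (intro DERIV_cong_ev refl)
    then show ?thesis using 2 by simp
  next
    case 3
    have "((\<lambda>h::real. (max 0 h ^ (n + 2)) / h) \<longlongrightarrow> 0) (at 0)"
    proof (rule tendsto_rabs_zero_cancel, rule tendsto_sandwich[of "\<lambda>_. 0" _ _ "\<lambda>h. \<bar>h\<bar> ^ (n + 1)"])
      show "((\<lambda>h. \<bar>h\<bar> ^ (n + 1)) \<longlongrightarrow> 0) (at (0::real))"
        by (rule tendsto_eq_intros | simp)+
      show "\<forall>\<^sub>F h in at (0::real). \<bar>max 0 h ^ (n + 2) / h\<bar> \<le> \<bar>h\<bar> ^ (n + 1)"
      proof (rule always_eventually, rule allI)
        fix h :: real
        show "\<bar>max 0 h ^ (n + 2) / h\<bar> \<le> \<bar>h\<bar> ^ (n + 1)"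
          by (cases "h > 0") (simp_all add: max_absorb1 max_absorb2 abs_mult mult_nonpos_nonneg)
      qed
    qed auto
    then show ?thesis using 3 by (simp add: DERIV_def)
  qed
qed

text \<open>The square of the usual Japanese bracket: smooth, at least 1, and comparable to |x|^2 at
  infinity. Exponents of it are half the exponents of |x|, and 3/2 is the threshold of integrability
  in R^3.\<close>

definition bracket :: "'a::euclidean_space \<Rightarrow> real" where
  "bracket x = 1 + (norm x)\<^sup>2"

lemma bracket_ge_1: "1 \<le> bracket x"
  by (simp add: bracket_def)

lemma bracket_pos: "0 < bracket x"
  using bracket_ge_1[of x] by linarith

lemma continuous_on_bracket [continuous_intros]:
  "continuous_on S f \<Longrightarrow> continuous_on S (\<lambda>x. bracket (f x))"
  unfolding bracket_def by (intro continuous_intros)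

lemma bracket_measurable [measurable]: "bracket \<in> borel_measurable borel"
  unfolding bracket_def[abs_def] by measurable

text \<open>\<open>sqrt (bracket x)\<close> is the norm of the pair (1, x), so this is the triangle
  inequality in a product space.\<close>

lemma sqrt_bracket_triangle: "sqrt (bracket (x + y)) \<le> sqrt (bracket x) + norm y"
proof -
  have "norm ((1::real, x) + (0, y)) \<le> norm (1::real, x) + norm (0::real, y)"
    by (rule norm_triangle_ineq)
  then show ?thesis by (simp add: norm_Pair bracket_def)
qed

lemma has_partial_bracket: "has_partial i (bracket :: real^'n::finite \<Rightarrow> real) (\<lambda>x. 2 * x $ i)"
proof -
  have "has_partial i (\<lambda>x::real^'n. 1 + (\<Sum>j\<in>UNIV. x $ j * x $ j))
     (\<lambda>x. 0 + (\<Sum>j\<in>UNIV. (if i = j then 1 else 0) * x $ j + x $ j * (if i = j then 1 else 0)))"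
    by (intro has_partial_add has_partial_const has_partial_sum has_partial_mult has_partial_coord)
  moreover have "(\<lambda>x::real^'n. 1 + (\<Sum>j\<in>UNIV. x $ j * x $ j)) = bracket"
    by (simp add: bracket_def fun_eq_iff power2_norm_eq_inner inner_vec_def)
  moreover have "(\<Sum>j\<in>UNIV. (if i = j then 1 else 0) * x $ j + x $ j * (if i = j then 1 else 0)) = 2 * x $ i"
    for x :: "real^'n"
    by (simp add: sum.distrib if_distrib[of "\<lambda>z. _ * z"] if_distrib[of "\<lambda>z. z * _"] cong: if_cong)
  ultimately show ?thesis by simp
qed

lemma nn_integral_bracket_real_finite:
  fixes p :: real
  assumes "p > 1/2"
  shows "(\<integral>\<^sup>+t. ennreal ((1 + t\<^sup>2) powr (-p)) \<partial>lborel) < \<infinity>"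
proof -
  let ?f = "\<lambda>t::real. ennreal ((1 + t\<^sup>2) powr (-p))"
  have half: "(\<integral>\<^sup>+t. ?f t * indicator {0..} t \<partial>lborel) < \<infinity>"
  proof -
    have "((\<lambda>x::real. x powr (-2*p)) has_integral -(1 powr (-2*p+1)) / (-2*p+1)) {1..}"
      using assms by (intro has_integral_powr_to_inf) auto
    from nn_integral_has_integral_lebesgue[OF _ this]
    have "(\<integral>\<^sup>+x. ennreal (indicator {1..} x * x powr (-2*p)) \<partial>lborel) < \<infinity>"
      by (simp add: nn_integral_completion)
    moreover have "(\<lambda>x. ennreal (indicator {1..} x * x powr (-2*p))) =
        (\<lambda>x. indicator {1..} x * ennreal (x powr (-2*p)))"
      by (auto simp: indicator_def)
    ultimately have fin: "(\<integral>\<^sup>+x. indicator {1..} x * ennreal (x powr (-2*p)) \<partial>lborel) < \<infinity>"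
      by simp
    have "(\<integral>\<^sup>+t. ?f t * indicator {0..} t \<partial>lborel) \<le>
        (\<integral>\<^sup>+t. indicator {0..<1} t + indicator {1..} t * ennreal (t powr (-2*p)) \<partial>lborel)"
    proof (rule nn_integral_mono)
      fix t :: real
      have "(1 + t\<^sup>2) powr (-p) \<le> t powr (-2*p)" if "t \<ge> 1"
      proof -
        have "(1 + t\<^sup>2) powr (-p) \<le> (t\<^sup>2) powr (-p)"
          using that assms by (intro powr_mono2') auto
        also have "\<dots> = t powr (-2*p)"
          using that by (simp add: powr_powr flip: powr_numeral)
        finally show ?thesis .
      qed
      moreover have "(1 + t\<^sup>2) powr (-p) \<le> 1"
        using assms powr_mono2'[of "-p" 1 "1 + t\<^sup>2"] by simp
      ultimately show "?f t * indicator {0..} t \<le> indicator {0..<1} t + indicator {1..} t * ennreal (t powr (-2*p))"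
        by (cases "t < 1") (auto simp: indicator_def ennreal_leI)
    qed
    also have "\<dots> = (\<integral>\<^sup>+t. indicator {0..<1::real} t \<partial>lborel) + (\<integral>\<^sup>+t. indicator {1..} t * ennreal (t powr (-2*p)) \<partial>lborel)"
      by (intro nn_integral_add) auto
    also have "\<dots> < \<infinity>" using fin by simp
    finally show ?thesis .
  qed
  have refl: "(\<integral>\<^sup>+t. ?f t * indicator {..0} t \<partial>lborel) = (\<integral>\<^sup>+t. ?f t * indicator {0..} t \<partial>lborel)"
    by (subst nn_integral_real_affine[where c = "-1" and t = 0])
      (auto simp: indicator_def intro!: nn_integral_cong)
  have "(\<integral>\<^sup>+t. ?f t \<partial>lborel) \<le> (\<integral>\<^sup>+t. ?f t * indicator {0..} t + ?f t * indicator {..0} t \<partial>lborel)"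
    by (intro nn_integral_mono) (auto simp: indicator_def)
  also have "\<dots> = (\<integral>\<^sup>+t. ?f t * indicator {0..} t \<partial>lborel) + (\<integral>\<^sup>+t. ?f t * indicator {..0} t \<partial>lborel)"
    by (intro nn_integral_add) auto
  also have "\<dots> < \<infinity>" using half by (simp add: refl)
  finally show ?thesis .
qed

text \<open>The power splits into one equal factor per coordinate, and in the factor of b the
  bracket is at least 1 + (x . b)^2. This leaves a product of one-dimensional integrals with
  exponent s / DIM > 1/2.\<close>

lemma integrable_bracket_powr:
  fixes s :: real
  assumes "s > DIM('a::euclidean_space) / 2"
  shows "integrable lborel (\<lambda>x::'a. bracket x powr (-s))"
proof (rule integrableI_nonneg)
  let ?p = "s / DIM('a)"
  have "?p > 1/2" using assms by (simp add: field_simps)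
  have "(\<integral>\<^sup>+x. ennreal (bracket (x::'a) powr (-s)) \<partial>lborel) \<le>
      (\<integral>\<^sup>+x. (\<Prod>b\<in>Basis. ennreal ((1 + (x \<bullet> b)\<^sup>2) powr (-?p))) \<partial>(lborel :: 'a measure))"
  proof (rule nn_integral_mono)
    fix x :: 'a
    have "bracket x powr (-s) = (\<Prod>b\<in>(Basis::'a set). bracket x powr (-?p))"
      using bracket_pos[of x] by (simp add: powr_powr flip: powr_realpow)
    also have "\<dots> \<le> (\<Prod>b\<in>Basis. (1 + (x \<bullet> b)\<^sup>2) powr (-?p))"
    proof (intro prod_mono conjI)
      fix b :: 'a assume "b \<in> Basis"
      then have "\<bar>x \<bullet> b\<bar> \<le> norm x" by (rule Basis_le_norm)
      then have "(x \<bullet> b)\<^sup>2 \<le> (norm x)\<^sup>2" using power_mono[of "\<bar>x \<bullet> b\<bar>" "norm x" 2] by simp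
      then show "bracket x powr (-?p) \<le> (1 + (x \<bullet> b)\<^sup>2) powr (-?p)"
        using \<open>?p > 1/2\<close> by (intro powr_mono2') (auto simp: bracket_def add_pos_nonneg)
    qed auto
    finally show "ennreal (bracket x powr (-s)) \<le> (\<Prod>b\<in>Basis. ennreal ((1 + (x \<bullet> b)\<^sup>2) powr (-?p)))"
      by (simp add: prod_ennreal ennreal_leI)
  qed
  also have "\<dots> = (\<Prod>b\<in>(Basis::'a set). (\<integral>\<^sup>+t. ennreal ((1 + t\<^sup>2) powr (-?p)) \<partial>lborel))"
    by (rule nn_integral_lborel_prod) auto
  also have "\<dots> < \<infinity>"
    using nn_integral_bracket_real_finite[OF \<open>?p > 1/2\<close>] by (simp add: power_less_top_ennreal)
  finally show "(\<integral>\<^sup>+x. ennreal (bracket (x::'a) powr (-s)) \<partial>lborel) < \<infinity>" .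
qed auto


lemma integral_affine:
  fixes f :: "'a::euclidean_space \<Rightarrow> real"
  assumes [measurable]: "f \<in> borel_measurable borel" and "0 < r"
    and int: "integrable lborel f"
  shows "integrable lborel (\<lambda>y. f (c + r *\<^sub>R y))"
    and "(LINT y|lborel. f (c + r *\<^sub>R y)) = r powr (- real DIM('a)) * (LINT x|lborel. f x)"
proof -
  let ?T = "\<lambda>y. c + r *\<^sub>R y"
  have lb: "lborel = density (distr lborel borel ?T) (\<lambda>_. ennreal (r ^ DIM('a)))"
    using lborel_affine[of r c] \<open>0 < r\<close> by (simp add: ennreal_power)
  have "integrable (distr lborel borel ?T) (\<lambda>x. r ^ DIM('a) *\<^sub>R f x)"
    using int \<open>0 < r\<close> by (subst (asm) lb) (simp add: integrable_density)
  then have "integrable lborel (\<lambda>y. r ^ DIM('a) *\<^sub>R f (?T y))"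
    by (subst (asm) integrable_distr_eq) auto
  then show "integrable lborel (\<lambda>y. f (?T y))"
    using \<open>0 < r\<close> by simp
  have "(LINT x|lborel. f x) = (LINT x|distr lborel borel ?T. r ^ DIM('a) *\<^sub>R f x)"
    using \<open>0 < r\<close> by (subst lb) (simp add: integral_density)
  also have "\<dots> = r ^ DIM('a) * (LINT y|lborel. f (?T y))"
    by (subst integral_distr) auto
  finally show "(LINT y|lborel. f (?T y)) = r powr (- real DIM('a)) * (LINT x|lborel. f x)"
    using \<open>0 < r\<close> by (simp add: powr_minus powr_realpow)
qed

text \<open>The loss of \<^term>\<open>2 * e\<close> in the exponent makes the global integrability of
  \<^term>\<open>bracket x powr (- (3/2 + e))\<close> suffice.\<close>

lemma average_bracket_bound:
  fixes a e :: real
  assumes "0 < a" "0 < e" "a \<le> 3/2 + e"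
  shows "\<exists>K\<ge>0. \<forall>(x::real^3) r f M C. 0 < r \<longrightarrow> 0 \<le> M \<longrightarrow> 0 \<le> C \<longrightarrow>
    continuous_on UNIV f \<longrightarrow> (\<forall>y. \<bar>f y\<bar> \<le> M * C * indicator (cball 0 1) y * bracket (x + r *\<^sub>R y) powr (-a)) \<longrightarrow>
    \<bar>LINT y|lborel. f y\<bar> \<le> M * C * K * (sqrt (bracket x) + r) powr (2 * e - 2 * a)"
proof -
  \<comment> \<open>A barely integrable exponent: rescaling a ball of radius r to the unit ball
    costs r^(-3), and 2 * b - 3 = 2 * e is exactly the loss in the claim.\<close>
  define b where "b = 3/2 + e"
  define I where "I = (LINT x|lborel. bracket (x::real^3) powr (-b))"
  define V where "V = measure lborel (cball (0::real^3) 1)"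
  have b: "b > 3/2" using assms by (simp add: b_def)
  have intb: "integrable lborel (\<lambda>x::real^3. bracket x powr (-b))"
    using b by (intro integrable_bracket_powr) simp
  have "I \<ge> 0" "V \<ge> 0" by (auto simp: I_def V_def intro: integral_nonneg_AE)
  define K where "K = V * 3 powr (2 * a) + 27 * I"
  have "K \<ge> 0" using \<open>I \<ge> 0\<close> \<open>V \<ge> 0\<close> by (simp add: K_def)
  have ind: "integrable lborel (indicator (cball (0::real^3) 1) :: real^3 \<Rightarrow> real)"
    by (intro integrable_real_indicator) (auto intro: emeasure_compact_finite[OF compact_cball, unfolded infinity_ennreal_def])
  have main: "\<exists>g. integrable lborel g \<and>
      (\<forall>y. indicator (cball 0 1) y * bracket (x + r *\<^sub>R y) powr (-a) \<le> g y) \<and>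
      (LINT y|lborel. g y) \<le> K * (sqrt (bracket x) + r) powr (2 * e - 2 * a)"
    if "0 < r" for r and x :: "real^3"
  proof -
    define \<rho> where "\<rho> = sqrt (bracket x)"
    have "\<rho> \<ge> 1" using bracket_ge_1[of x] by (simp add: \<rho>_def)
    let ?L = "\<rho> + r"
    have bp: "bracket z powr t = sqrt (bracket z) powr (2 * t)" for z :: "real^3" and t
      using bracket_pos[of z] by (simp add: powr_half_sqrt[symmetric] powr_powr)
    show ?thesis
    proof (cases "r \<le> \<rho> / 2")
      \<comment> \<open>Small balls: \<rho> - r >= \<rho> / 2 >= (\<rho> + r) / 3, so every point of
        the ball is comparable to its centre and a pointwise bound suffices.\<close>
      case True
      let ?B = "3 powr (2 * a) * ?L powr (2 * e - 2 * a)"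
      let ?g = "\<lambda>y::real^3. indicator (cball 0 1) y * ?B"
      have "bracket (x + r *\<^sub>R y) powr (-a) \<le> ?B" if "y \<in> cball 0 1" for y
      proof -
        have "norm (r *\<^sub>R y) \<le> r" using that \<open>0 < r\<close> by simp
        moreover have "\<rho> \<le> sqrt (bracket (x + r *\<^sub>R y)) + norm (r *\<^sub>R y)"
          using sqrt_bracket_triangle[of "x + r *\<^sub>R y" "- (r *\<^sub>R y)"] by (simp add: \<rho>_def)
        ultimately have "\<rho> \<le> sqrt (bracket (x + r *\<^sub>R y)) + r" by simp
        then have "?L / 3 \<le> sqrt (bracket (x + r *\<^sub>R y))"
          using True by simp
        then have "bracket (x + r *\<^sub>R y) powr (-a) \<le> (?L / 3) powr (2 * (-a))"
          unfolding bp using assms \<open>0 < r\<close> \<open>\<rho> \<ge> 1\<close> by (intro powr_mono2') auto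
        also have "\<dots> = 3 powr (2 * a) * ?L powr (- 2 * a)"
          using \<open>0 < r\<close> \<open>\<rho> \<ge> 1\<close> by (simp add: powr_divide powr_minus field_simps)
        also have "\<dots> \<le> ?B"
          using assms \<open>0 < r\<close> \<open>\<rho> \<ge> 1\<close> by (intro mult_left_mono powr_mono) auto
        finally show ?thesis .
      qed
      moreover have "(LINT y|lborel. ?g y) \<le> K * ?L powr (2 * e - 2 * a)"
      proof -
        have "(LINT y|lborel. ?g y) = V * ?B" by (simp add: V_def)
        also have "\<dots> \<le> K * ?L powr (2 * e - 2 * a)"
          using \<open>I \<ge> 0\<close> by (simp add: K_def algebra_simps)
        finally show ?thesis .
      qed
      ultimately show ?thesis
        using integrable_mult_left[OF ind, of ?B]
        by (intro exI[of _ ?g] conjI allI) (simp_all add: \<rho>_def split: split_indicator)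
    next
      \<comment> \<open>Large balls may contain the origin. The exponent a is raised to b at the
        price (\<rho> + r)^(2 b - 2 a), after which the integral extends to the whole space; r >
        (\<rho> + r) / 3 controls the factor r^(-3).\<close>
      case False
      let ?g = "\<lambda>y. ?L powr (2 * b - 2 * a) * bracket (x + r *\<^sub>R y) powr (-b)"
      have "bracket (x + r *\<^sub>R y) powr (-a) \<le> ?g y" if "y \<in> cball 0 1" for y
      proof -
        have "sqrt (bracket (x + r *\<^sub>R y)) \<le> \<rho> + norm (r *\<^sub>R y)"
          using sqrt_bracket_triangle[of x "r *\<^sub>R y"] by (simp add: \<rho>_def)
        moreover have "norm (r *\<^sub>R y) \<le> r" using that \<open>0 < r\<close> by simp
        ultimately have le: "sqrt (bracket (x + r *\<^sub>R y)) \<le> ?L" by linarith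
        have "bracket (x + r *\<^sub>R y) powr (-a) =
            bracket (x + r *\<^sub>R y) powr (b - a) * bracket (x + r *\<^sub>R y) powr (-b)"
          by (simp flip: powr_add)
        also have "bracket (x + r *\<^sub>R y) powr (b - a) \<le> ?L powr (2 * (b - a))"
          unfolding bp using le assms bracket_pos[of "x + r *\<^sub>R y"]
          by (intro powr_mono2) (auto simp: b_def)
        finally show ?thesis by (simp add: algebra_simps mult_right_mono)
      qed
      moreover have "integrable lborel ?g"
        using integral_affine(1)[OF _ \<open>0 < r\<close> intb, of x] by simp
      moreover have "(LINT y|lborel. ?g y) \<le> K * ?L powr (2 * e - 2 * a)"
      proof -
        have "(LINT y|lborel. ?g y) = ?L powr (2 * b - 2 * a) * (r powr (-3) * I)"
          using integral_affine(2)[OF _ \<open>0 < r\<close> intb, of x] by (simp add: I_def)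
        also have "\<dots> \<le> ?L powr (2 * b - 2 * a) * ((?L / 3) powr (-3) * I)"
          using False \<open>0 < r\<close> \<open>\<rho> \<ge> 1\<close> \<open>I \<ge> 0\<close>
          by (intro mult_left_mono mult_right_mono powr_mono2') auto
        also have "(?L / 3) powr (-3) = 27 * ?L powr (-3)"
        proof -
          have "(3::real) powr 3 = 27" by (simp add: powr_numeral)
          then show ?thesis
            using \<open>0 < r\<close> \<open>\<rho> \<ge> 1\<close> by (simp add: powr_divide powr_minus field_simps)
        qed
        also have "?L powr (2 * b - 2 * a) * (27 * ?L powr (-3) * I) =
            27 * I * ?L powr ((2 * b - 2 * a) + (-3))"
          by (simp only: powr_add mult_ac)
        also have "(2 * b - 2 * a) + (-3) = 2 * e - 2 * a" by (simp add: b_def)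
        also have "27 * I * ?L powr (2 * e - 2 * a) \<le> K * ?L powr (2 * e - 2 * a)"
          using \<open>V \<ge> 0\<close> by (intro mult_right_mono) (simp_all add: K_def)
        finally show ?thesis .
      qed
      ultimately show ?thesis
        by (intro exI[of _ ?g] conjI allI) (simp_all add: \<rho>_def split: split_indicator)
    qed
  qed
  show ?thesis
  proof (intro exI[of _ K] conjI allI impI \<open>K \<ge> 0\<close>)
    fix x :: "real^3" and r M C :: real and f :: "real^3 \<Rightarrow> real"
    assume r: "0 < r" and MC: "0 \<le> M" "0 \<le> C" and cf: "continuous_on UNIV f"
      and le: "\<forall>y. \<bar>f y\<bar> \<le> M * C * indicator (cball 0 1) y * bracket (x + r *\<^sub>R y) powr (-a)"
    from main[OF r, of x] obtain g where g: "integrable lborel g"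
      "\<And>y. indicator (cball 0 1) y * bracket (x + r *\<^sub>R y) powr (-a) \<le> g y"
      "(LINT y|lborel. g y) \<le> K * (sqrt (bracket x) + r) powr (2 * e - 2 * a)"
      by blast
    have "norm (LINT y|lborel. f y) \<le> (LINT y|lborel. M * C * g y)"
    proof (rule Bochner_Integration.integral_norm_bound_integral)
      have "f y = 0" if "1 < norm y" for y
        using le[rule_format, of y] that by simp
      then show "integrable lborel f"
        by (rule bounded_support_integrable[OF cf])
      show "norm (f y) \<le> M * C * g y" for y
        using le[rule_format, of y] mult_left_mono[OF g(2)[of y], of "M * C"] MC by (simp add: mult_ac)
    qed (use g in simp)
    also have "\<dots> = M * C * (LINT y|lborel. g y)" by simp
    also have "\<dots> \<le> M * C * (K * (sqrt (bracket x) + r) powr (2 * e - 2 * a))"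
      using g(3) MC by (intro mult_left_mono) auto
    finally have "\<bar>LINT y|lborel. f y\<bar> \<le> M * C * (K * (sqrt (bracket x) + r) powr (2 * e - 2 * a))"
      by simp
    then show "\<bar>LINT y|lborel. f y\<bar> \<le> M * C * K * (sqrt (bracket x) + r) powr (2 * e - 2 * a)"
      by (simp add: mult_ac)
  qed
qed

section \<open>Averages and decay\<close>

text \<open>As \<open>2 - bracket y\<close> is 1 - |y|^2, this is the cube of the positive part of 1
  - |y|^2: a radial C^2 weight supported in the unit ball. It is not normalized; its integral is
  divided out as \<open>B\<close> below.\<close>

definition bump :: "'a::euclidean_space \<Rightarrow> real" where
  "bump y = (max 0 (2 - bracket y)) ^ 3"

lemma bump_nonneg: "0 \<le> bump y"
  by (simp add: bump_def)

lemma bump_le_1: "bump y \<le> 1"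
proof -
  have "max 0 (2 - bracket y) \<le> 1" using bracket_ge_1[of y] by simp
  then have "max 0 (2 - bracket y) ^ 3 \<le> 1 ^ 3" by (intro power_mono) auto
  then show ?thesis by (simp add: bump_def)
qed

lemma two_less_bracket: "1 < norm y \<Longrightarrow> 2 < bracket y"
  by (simp add: bracket_def)

lemma bump_eq_0: "1 < norm y \<Longrightarrow> bump y = 0"
  using two_less_bracket[of y] by (simp add: bump_def max_absorb1)

lemma continuous_on_bump: "continuous_on S bump"
  unfolding bump_def[abs_def] by (intro continuous_intros)

lemma has_partial_bump:
  "has_partial i (bump :: real^'n::finite \<Rightarrow> real) (\<lambda>y. - 6 * y $ i * (max 0 (2 - bracket y))\<^sup>2)"
proof -
  have "has_partial i (\<lambda>y::real^'n. 2 - bracket y) (\<lambda>y. 0 - 2 * y $ i)"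
    by (intro has_partial_diff has_partial_const has_partial_bracket)
  from has_partial_chain[OF this, of "\<lambda>t. (max 0 t) ^ 3" "\<lambda>t. 3 * (max 0 t) ^ 2"]
  have "has_partial i (\<lambda>y::real^'n. (max 0 (2 - bracket y)) ^ 3)
      (\<lambda>y. 3 * (max 0 (2 - bracket y)) ^ 2 * (0 - 2 * y $ i))"
    using DERIV_pos_part_power[of 1] by (simp add: numeral_eq_Suc)
  then show ?thesis by (simp add: bump_def[abs_def] mult_ac)
qed

lemma continuous_integral_eq_0:
  fixes f :: "'a::euclidean_space \<Rightarrow> real"
  assumes cont: "continuous_on UNIV f" and supp: "\<And>x. R < norm x \<Longrightarrow> f x = 0"
    and nn: "\<And>x. 0 \<le> f x" and 0: "(LINT x|lborel. f x) = 0"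
  shows "f x = 0"
proof -
  define S where "S = max R (norm x) + 1"
  have "R < S" "norm x < S" by (auto simp: S_def)
  have "0 < S" using norm_ge_zero[of x] \<open>norm x < S\<close> by linarith
  let ?l = "- S *\<^sub>R One :: 'a" and ?u = "S *\<^sub>R One :: 'a"
  have "(LINT x|lborel. f x) = integral (cbox ?l ?u) f"
  proof (rule compact_support_integral(2)[OF cont])
    fix y assume "y \<notin> cbox ?l ?u"
    then show "f y = 0" using norm_le_imp_mem_cbox[of y S] supp[of y] \<open>R < S\<close> by force
  qed
  moreover have "f integrable_on cbox ?l ?u"
    by (intro integrable_continuous continuous_on_subset[OF cont]) simp
  ultimately have "(f has_integral 0) (cbox ?l ?u)"
    using 0 by (metis integrable_integral)
  then show ?thesis
  proof (rule has_integral_0_cbox_imp_0[rotated 2])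
    show "continuous_on (cbox ?l ?u) f" by (intro continuous_on_subset[OF cont]) simp
    show "box ?l ?u \<noteq> {}" using \<open>0 < S\<close> by (simp add: box_ne_empty)
    show "x \<in> cbox ?l ?u" using \<open>norm x < S\<close> by (intro norm_le_imp_mem_cbox) simp
  qed (rule nn)
qed

lemma bump_integral_pos: "0 < (LINT y|lborel. bump (y::'a::euclidean_space))"
proof -
  have "(LINT y|lborel. bump (y::'a)) \<noteq> 0"
    using continuous_integral_eq_0[OF continuous_on_bump bump_eq_0 bump_nonneg, where x = "0::'a"]
    by (auto simp: bump_def bracket_def)
  moreover have "0 \<le> (LINT y|lborel. bump (y::'a))"
    by (intro integral_nonneg_AE) (simp add: bump_nonneg)
  ultimately show ?thesis by linarith
qed

text \<open>One affine path covers both ways of moving a ball: dilation about x (a constant, b the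
  identity) and translation at radius r (a y = r y, b constant).\<close>

lemma average_has_derivative:
  fixes f :: "real^'n::finite \<Rightarrow> real" and a b :: "real^'n \<Rightarrow> real^'n" and k :: "real^'n \<Rightarrow> real"
  assumes f: "smooth f" and ck: "continuous_on UNIV k" and k0: "\<And>y. 1 < norm y \<Longrightarrow> k y = 0"
    and ca: "continuous_on UNIV a" and cb: "continuous_on UNIV b"
  shows "((\<lambda>t. LINT y|lborel. k y * f (a y + t *\<^sub>R b y)) has_real_derivative
    (LINT y|lborel. k y * (\<Sum>i\<in>UNIV. b y $ i * partial_derivative i f (a y + t *\<^sub>R b y)))) (at t)"
proof -
  let ?l = "- 1 *\<^sub>R One :: real^'n" and ?u = "1 *\<^sub>R One :: real^'n"
  have out: "k y = 0" if "y \<notin> cbox ?l ?u" for y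
    using norm_le_imp_mem_cbox[of y 1] k0[of y] that by force
  note cf = smooth_continuous_on[OF f] and cp = smooth_continuous_on[OF smooth_partial_derivative[OF f]]
  note ci = continuous_on_compose2[OF cf _ subset_UNIV] continuous_on_compose2[OF cp _ subset_UNIV]
    continuous_on_compose2[OF ck _ subset_UNIV] continuous_on_compose2[OF ca _ subset_UNIV]
    continuous_on_compose2[OF cb _ subset_UNIV]
  have d: "((\<lambda>t. k y * f (a y + t *\<^sub>R b y)) has_real_derivative
      k y * (\<Sum>i\<in>UNIV. b y $ i * partial_derivative i f (a y + t *\<^sub>R b y))) (at t within UNIV)" for y t
  proof -
    let ?g = "\<lambda>t. a y + t *\<^sub>R b y"
    have g: "(?g has_derivative (\<lambda>s. s *\<^sub>R b y)) (at t)"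
      by (auto intro!: derivative_eq_intros)
    have "f differentiable (at (?g t))"
      using smooth_differentiable_on[OF f] by (simp add: differentiable_on_def)
    from has_derivative_compose[OF g has_derivative_partials[OF this]]
    have "((\<lambda>t. f (?g t)) has_derivative
        (\<lambda>s. \<Sum>i\<in>UNIV. (s *\<^sub>R b y) $ i *\<^sub>R partial_derivative i f (?g t))) (at t)" .
    moreover have "(\<lambda>s. \<Sum>i\<in>UNIV. (s *\<^sub>R b y) $ i *\<^sub>R partial_derivative i f (?g t)) =
        (*) (\<Sum>i\<in>UNIV. b y $ i * partial_derivative i f (?g t))"
      by (simp add: fun_eq_iff sum_distrib_left sum_distrib_right mult_ac)
    ultimately have "((\<lambda>t. f (?g t)) has_real_derivative
        (\<Sum>i\<in>UNIV. b y $ i * partial_derivative i f (?g t))) (at t)"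
      by (simp add: has_field_derivative_def)
    then show ?thesis by (rule DERIV_cmult)
  qed
  have "((\<lambda>t. integral (cbox ?l ?u) (\<lambda>y. k y * f (a y + t *\<^sub>R b y))) has_real_derivative
    integral (cbox ?l ?u) (\<lambda>y. k y * (\<Sum>i\<in>UNIV. b y $ i * partial_derivative i f (a y + t *\<^sub>R b y))))
    (at t within UNIV)"
  proof (rule leibniz_rule_field_derivative[OF d])
    show "(\<lambda>y. k y * f (a y + t *\<^sub>R b y)) integrable_on cbox ?l ?u" for t
      by (intro integrable_continuous continuous_intros ci)
    show "continuous_on (UNIV \<times> cbox ?l ?u) (\<lambda>(t, y).
        k y * (\<Sum>i\<in>UNIV. b y $ i * partial_derivative i f (a y + t *\<^sub>R b y)))"
      unfolding split_beta by (intro continuous_intros ci)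
  qed auto
  moreover have "(LINT y|lborel. k y * f (a y + t *\<^sub>R b y)) =
      integral (cbox ?l ?u) (\<lambda>y. k y * f (a y + t *\<^sub>R b y))" for t
    by (rule compact_support_integral(2)) (auto simp: out intro!: continuous_intros ci)
  moreover have "(LINT y|lborel. k y * (\<Sum>i\<in>UNIV. b y $ i * partial_derivative i f (a y + t *\<^sub>R b y))) =
      integral (cbox ?l ?u) (\<lambda>y. k y * (\<Sum>i\<in>UNIV. b y $ i * partial_derivative i f (a y + t *\<^sub>R b y)))"
    by (rule compact_support_integral(2)) (auto simp: out intro!: continuous_intros ci)
  ultimately show ?thesis by simp
qed

lemma average_integrable:
  fixes f :: "real^'n::finite \<Rightarrow> real" and k :: "real^'n \<Rightarrow> real"
  assumes "continuous_on UNIV f" "continuous_on UNIV k" "\<And>y. 1 < norm y \<Longrightarrow> k y = 0"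
  shows "integrable lborel (\<lambda>y. k y * f (c + r *\<^sub>R y))"
  using assms
  by (intro bounded_support_integrable[where R = 1] continuous_intros continuous_on_compose2[OF assms(1)]) auto

text \<open>The weight \<^term>\<open>y $ j * bump y\<close> is the gradient of a radial function, hence the symmetry
  of its partial derivatives.\<close>

lemma average_partial_symmetric:
  fixes f :: "real^'n::finite \<Rightarrow> real"
  assumes f: "smooth f" and "r \<noteq> 0"
  shows "(LINT y|lborel. (y $ j * bump y) * partial_derivative i f (c + r *\<^sub>R y)) =
    (LINT y|lborel. (y $ i * bump y) * partial_derivative j f (c + r *\<^sub>R y))"
proof -
  define q where "q y = (max 0 (2 - bracket (y::real^'n)))\<^sup>2" for y
  \<comment> \<open>This is the i-th partial of y_j bump(y) f(c + r y), so it has integral zero. Its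
    first summand is symmetric in i and j and cancels in D i j - D j i.\<close>
  define D where "D i j y = ((if i = j then 1 else 0) * bump y + y $ j * (- 6 * y $ i * q y)) * f (c + r *\<^sub>R y)
      + (y $ j * bump y) * (r * partial_derivative i f (c + r *\<^sub>R y))" for i j y
  have cq: "continuous_on UNIV q"
    unfolding q_def[abs_def] by (intro continuous_intros)
  have q0: "q y = 0" if "1 < norm y" for y
    using two_less_bracket[OF that] by (simp add: q_def max_absorb1)
  note cf = continuous_on_compose2[OF smooth_continuous_on[OF f] _ subset_UNIV]
    continuous_on_compose2[OF smooth_continuous_on[OF smooth_partial_derivative[OF f]] _ subset_UNIV]
  have cD: "continuous_on UNIV (D i j)" for i j
    unfolding D_def[abs_def] by (intro continuous_intros cf cq continuous_on_bump)
  have D0: "D i j y = 0" if "1 < norm y" for i j y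
    using that by (simp add: D_def bump_eq_0 q0)
  have zero: "(LINT y|lborel. D i j y) = 0" for i j
  proof (rule integral_partial_eq_0[where R = 1, OF _ _ cD])
    show "has_partial i (\<lambda>y. (y $ j * bump y) * f (c + r *\<^sub>R y)) (D i j)"
      unfolding D_def[abs_def] q_def
      by (intro has_partial_mult has_partial_coord has_partial_bump has_partial_shift_scale smooth_has_partial f)
    show "continuous_on UNIV (\<lambda>y. (y $ j * bump y) * f (c + r *\<^sub>R y))"
      by (intro continuous_intros cf continuous_on_bump)
  qed (simp add: bump_eq_0)
  have int: "integrable lborel (D i j)" for i j
    by (rule bounded_support_integrable[OF cD D0])
  have int': "integrable lborel (\<lambda>y. (y $ j * bump y) * partial_derivative i f (c + r *\<^sub>R y))" for i j
    by (intro average_integrable smooth_continuous_on smooth_partial_derivative f continuous_intros continuous_on_bump)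
      (simp add: bump_eq_0)
  have "0 = (LINT y|lborel. D i j y - D j i y)"
    by (simp add: int zero)
  also have "\<dots> = (LINT y|lborel. r * ((y $ j * bump y) * partial_derivative i f (c + r *\<^sub>R y) -
      (y $ i * bump y) * partial_derivative j f (c + r *\<^sub>R y)))"
    by (intro Bochner_Integration.integral_cong) (auto simp: D_def algebra_simps)
  also have "\<dots> = r * ((LINT y|lborel. (y $ j * bump y) * partial_derivative i f (c + r *\<^sub>R y)) -
      (LINT y|lborel. (y $ i * bump y) * partial_derivative j f (c + r *\<^sub>R y)))"
    by (simp add: int')
  finally show ?thesis using \<open>r \<noteq> 0\<close> by simp
qed

text \<open>Integration by parts onto the bump gains a factor 1/r when only the undifferentiated f
  is known to decay.\<close>

lemma average_partial:
  fixes f :: "real^'n::finite \<Rightarrow> real"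
  assumes f: "smooth f"
  shows "r * (LINT y|lborel. bump y * partial_derivative i f (c + r *\<^sub>R y)) =
    (LINT y|lborel. (6 * y $ i * (max 0 (2 - bracket y))\<^sup>2) * f (c + r *\<^sub>R y))"
proof -
  define q where "q y = 6 * y $ i * (max 0 (2 - bracket (y::real^'n)))\<^sup>2" for y
  have cq: "continuous_on UNIV q"
    unfolding q_def[abs_def] by (intro continuous_intros)
  have q0: "q y = 0" if "1 < norm y" for y
    using two_less_bracket[OF that] by (simp add: q_def max_absorb1)
  note cf = continuous_on_compose2[OF smooth_continuous_on[OF f] _ subset_UNIV]
    continuous_on_compose2[OF smooth_continuous_on[OF smooth_partial_derivative[OF f]] _ subset_UNIV]
  have "(LINT y|lborel. (- q y) * f (c + r *\<^sub>R y) + bump y * (r * partial_derivative i f (c + r *\<^sub>R y))) = 0"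
  proof (rule integral_partial_eq_0[where R = 1])
    show "has_partial i (\<lambda>y. bump y * f (c + r *\<^sub>R y))
      (\<lambda>y. (- q y) * f (c + r *\<^sub>R y) + bump y * (r * partial_derivative i f (c + r *\<^sub>R y)))"
      using has_partial_mult[OF has_partial_bump has_partial_shift_scale[OF smooth_has_partial[OF f]]]
      by (simp add: q_def)
    show "continuous_on UNIV (\<lambda>y. bump y * f (c + r *\<^sub>R y))"
      by (intro continuous_intros cf continuous_on_bump)
    show "continuous_on UNIV (\<lambda>y. (- q y) * f (c + r *\<^sub>R y) + bump y * (r * partial_derivative i f (c + r *\<^sub>R y)))"
      by (intro continuous_intros cf cq continuous_on_bump)
  qed (simp add: bump_eq_0)
  moreover have "integrable lborel (\<lambda>y. q y * f (c + r *\<^sub>R y))"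
    "integrable lborel (\<lambda>y. bump y * partial_derivative i f (c + r *\<^sub>R y))"
    by (intro average_integrable smooth_continuous_on smooth_partial_derivative f cq q0 continuous_on_bump bump_eq_0; assumption)+
  ultimately show ?thesis
    by (simp add: q_def mult.left_commute[of _ r])
qed

text \<open>Both U and -U are compared with the explicit antiderivative \<open>?P\<close> of the
  bound, so U' is never integrated. The result is uniform in R, which permits letting the radius
  tend to infinity.\<close>

lemma radial_increment_bound:
  fixes U :: "real \<Rightarrow> real"
  assumes d: "\<And>r. (U has_real_derivative U' r) (at r)"
    and le: "\<And>r. 0 < r \<Longrightarrow> \<bar>U' r\<bar> \<le> B * (\<rho> + r) powr (- g - 1)"
    and "0 < \<rho>" "0 < g" "0 \<le> S" "S \<le> R" "0 \<le> B"
  shows "\<bar>U R - U S\<bar> \<le> B / g * (\<rho> + S) powr (- g)"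
proof -
  let ?P = "\<lambda>r. - B / g * (\<rho> + r) powr (- g)"
  have dP: "(?P has_real_derivative B * (\<rho> + r) powr (- g - 1)) (at r)" if "0 \<le> r" for r
    using that assms(3,4) by (auto intro!: derivative_eq_intros)
  have "s * U R - ?P R \<le> s * U S - ?P S" if "s \<in> {1, -1}" for s
  proof (rule DERIV_nonpos_imp_decreasing_open[OF \<open>S \<le> R\<close>])
    fix r assume "S < r" "r < R"
    then have "0 < r" using \<open>0 \<le> S\<close> by simp
    have "((\<lambda>r. s * U r - ?P r) has_real_derivative s * U' r - B * (\<rho> + r) powr (- g - 1)) (at r)"
      using \<open>0 < r\<close> by (intro DERIV_diff DERIV_cmult d dP) simp
    moreover have "s * U' r \<le> B * (\<rho> + r) powr (- g - 1)"
      using le[OF \<open>0 < r\<close>] that by auto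
    ultimately show "\<exists>y. ((\<lambda>r. s * U r - ?P r) has_real_derivative y) (at r) \<and> y \<le> 0"
      by (metis diff_le_0_iff_le)
  next
    show "continuous_on {S..R} (\<lambda>r. s * U r - ?P r)"
    proof (intro continuous_on_diff continuous_on_mult continuous_on_const)
      show "continuous_on {S..R} U"
        using d by (auto intro: continuous_at_imp_continuous_on DERIV_isCont)
      show "continuous_on {S..R} (\<lambda>r. (\<rho> + r) powr (- g))"
        using \<open>0 < \<rho>\<close> \<open>0 \<le> S\<close> by (intro continuous_intros) auto
    qed
  qed
  from this[of 1] this[of "-1"] have "\<bar>U R - U S\<bar> \<le> ?P R - ?P S" by auto
  also have "\<dots> \<le> - ?P S" using assms by simp
  finally show ?thesis by simp
qed


section \<open>Pointwise decay of the velocity and of the head\<close>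

lemma powr_bracket_eq: "sqrt (bracket x) powr t = bracket x powr (t / 2)"
  using bracket_pos[of x] by (simp add: powr_half_sqrt[symmetric] powr_powr)

text \<open>The average of u_i about x is a multiple of u_i x at radius 0 and tends to 0 as the
  radius grows, so u_i x is controlled by the radial derivative. There each partial_j u_i is the
  skew part plus partial_i u_j, and \<open>average_partial_symmetric\<close> turns the latter
  contributions into a multiple of the divergence. \<open>K\<close> is fixed before u and C. In
  particular C = 0 is allowed, which is how a vanishing curl yields a vanishing velocity.\<close>

lemma velocity_decay:
  fixes a e :: real
  assumes "0 < e" "a \<le> 3/2 + e" "1/2 + e < a"
  shows "\<exists>K\<ge>0. \<forall>(u :: 3 \<Rightarrow> real^3 \<Rightarrow> real) C x i. 0 \<le> C \<longrightarrow> (\<forall>i. smooth (u i)) \<longrightarrow>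
    (\<forall>x. (\<Sum>j\<in>UNIV. partial_derivative j (u j) x) = 0) \<longrightarrow>
    (\<forall>i. (u i \<longlongrightarrow> 0) at_infinity) \<longrightarrow>
    (\<forall>i j x. \<bar>partial_derivative j (u i) x - partial_derivative i (u j) x\<bar> \<le> C * bracket x powr (-a)) \<longrightarrow>
    \<bar>u i x\<bar> \<le> K * C * bracket x powr (1/2 + e - a)"
proof -
  obtain K where "K \<ge> 0" and K: "\<And>(x::real^3) r f M C. 0 < r \<Longrightarrow> 0 \<le> M \<Longrightarrow> 0 \<le> C \<Longrightarrow>
    continuous_on UNIV f \<Longrightarrow> (\<And>y. \<bar>f y\<bar> \<le> M * C * indicator (cball 0 1) y * bracket (x + r *\<^sub>R y) powr (-a)) \<Longrightarrow>
    \<bar>LINT y|lborel. f y\<bar> \<le> M * C * K * (sqrt (bracket x) + r) powr (2 * e - 2 * a)"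
    using average_bracket_bound[of a e] assms by auto
  \<comment> \<open>The decay rate after radial integration: 2 * e - 2 * a = - g - 1, and
    \<open>sqrt (bracket x) powr (- g)\<close> is the claimed power of the bracket.\<close>
  define g where "g = 2 * a - 2 * e - 1"
  have "0 < g" using assms by (simp add: g_def)
  define B where "B = (LINT y|lborel. bump (y::real^3))"
  have "0 < B" unfolding B_def by (rule bump_integral_pos)
  show ?thesis
  proof (intro exI[of _ "3 * K / g / B"] conjI allI impI)
    show "0 \<le> 3 * K / g / B" using \<open>0 < g\<close> \<open>0 < B\<close> \<open>K \<ge> 0\<close> by simp
    fix u :: "3 \<Rightarrow> real^3 \<Rightarrow> real" and C x i
    assume "0 \<le> C" and sm: "\<forall>i. smooth (u i)"
      and div: "\<forall>x. (\<Sum>j\<in>UNIV. partial_derivative j (u j) x) = 0"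
      and lim: "\<forall>i. (u i \<longlongrightarrow> 0) at_infinity"
      and w: "\<forall>i j x. \<bar>partial_derivative j (u i) x - partial_derivative i (u j) x\<bar> \<le> C * bracket x powr (-a)"
    note sm = sm[rule_format]
    note cp = smooth_continuous_on[OF smooth_partial_derivative[OF sm]]
    note ci = continuous_on_compose2[OF cp _ subset_UNIV]
    define w where "w j y = partial_derivative j (u i) y - partial_derivative i (u j) y" for j y
    have cw: "continuous_on UNIV (w j)" for j
      unfolding w_def[abs_def] by (intro continuous_intros cp)
    define U where "U r = (LINT y|lborel. bump y * u i (x + r *\<^sub>R y))" for r
    define U' where "U' r = (LINT y|lborel. bump y * (\<Sum>j\<in>UNIV. y $ j * partial_derivative j (u i) (x + r *\<^sub>R y)))" for r
    have d: "(U has_real_derivative U' r) (at r)" for r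
      unfolding U_def[abs_def] U'_def
      by (rule average_has_derivative) (auto simp: sm bump_eq_0 intro: continuous_intros continuous_on_bump)
    have int: "integrable lborel (\<lambda>y. (y $ k * bump y) * h (x + r *\<^sub>R y))"
      if "continuous_on UNIV h" for k r and h :: "real^3 \<Rightarrow> real"
      by (intro average_integrable that continuous_intros continuous_on_bump) (simp add: bump_eq_0)
    have U': "U' r = (\<Sum>j\<in>UNIV. LINT y|lborel. (y $ j * bump y) * w j (x + r *\<^sub>R y))" if "0 < r" for r
    proof -
      have "U' r = (LINT y|lborel. (\<Sum>j\<in>UNIV. (y $ j * bump y) * w j (x + r *\<^sub>R y)) +
          (\<Sum>j\<in>UNIV. (y $ j * bump y) * partial_derivative i (u j) (x + r *\<^sub>R y)))"
        unfolding U'_def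
        by (intro Bochner_Integration.integral_cong)
          (auto simp: w_def sum_distrib_left algebra_simps simp flip: sum.distrib intro!: sum.cong)
      also have "\<dots> = (\<Sum>j\<in>UNIV. LINT y|lborel. (y $ j * bump y) * w j (x + r *\<^sub>R y)) +
          (\<Sum>j\<in>UNIV. LINT y|lborel. (y $ j * bump y) * partial_derivative i (u j) (x + r *\<^sub>R y))"
        by (simp add: int cw cp)
      also have "(\<Sum>j\<in>UNIV. LINT y|lborel. (y $ j * bump y) * partial_derivative i (u j) (x + r *\<^sub>R y)) =
          (\<Sum>j\<in>UNIV. LINT y|lborel. (y $ i * bump y) * partial_derivative j (u j) (x + r *\<^sub>R y))"
        using that by (intro sum.cong refl average_partial_symmetric sm) simp
      also have "\<dots> = (LINT y|lborel. (\<Sum>j\<in>UNIV. (y $ i * bump y) * partial_derivative j (u j) (x + r *\<^sub>R y)))"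
        by (simp add: int cp)
      also have "\<dots> = 0"
        using div by (simp flip: sum_distrib_left)
      finally show ?thesis by simp
    qed
    have le: "\<bar>U' r\<bar> \<le> 3 * C * K * (sqrt (bracket x) + r) powr (- g - 1)" if "0 < r" for r
    proof -
      have "\<bar>LINT y|lborel. (y $ j * bump y) * w j (x + r *\<^sub>R y)\<bar> \<le>
          1 * C * K * (sqrt (bracket x) + r) powr (2 * e - 2 * a)" for j
      proof (rule K[OF that _ \<open>0 \<le> C\<close>])
        show "continuous_on UNIV (\<lambda>y. (y $ j * bump y) * w j (x + r *\<^sub>R y))"
          by (intro continuous_intros continuous_on_bump continuous_on_compose2[OF cw]) auto
        fix y :: "real^3"
        show "\<bar>y $ j * bump y * w j (x + r *\<^sub>R y)\<bar> \<le>
            1 * C * indicator (cball 0 1) y * bracket (x + r *\<^sub>R y) powr (-a)"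
        proof (cases "norm y \<le> 1")
          case True
          have "\<bar>y $ j * bump y\<bar> \<le> 1 * 1"
            unfolding abs_mult using True component_le_norm_cart[of y j] bump_nonneg[of y] bump_le_1[of y]
            by (intro mult_mono) auto
          moreover have "\<bar>w j (x + r *\<^sub>R y)\<bar> \<le> C * bracket (x + r *\<^sub>R y) powr (-a)"
            using w unfolding w_def by blast
          ultimately have "\<bar>y $ j * bump y\<bar> * \<bar>w j (x + r *\<^sub>R y)\<bar> \<le> 1 * (C * bracket (x + r *\<^sub>R y) powr (-a))"
            by (intro mult_mono) auto
          then show ?thesis using True by (simp add: abs_mult)
        qed (simp add: bump_eq_0)
      qed simp
      then have "(\<Sum>j\<in>(UNIV::3 set). \<bar>LINT y|lborel. (y $ j * bump y) * w j (x + r *\<^sub>R y)\<bar>) \<le>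
          (\<Sum>j\<in>(UNIV::3 set). 1 * C * K * (sqrt (bracket x) + r) powr (2 * e - 2 * a))"
        by (rule sum_mono)
      moreover have "\<bar>U' r\<bar> \<le> (\<Sum>j\<in>UNIV. \<bar>LINT y|lborel. (y $ j * bump y) * w j (x + r *\<^sub>R y)\<bar>)"
        unfolding U'[OF that] by (rule sum_abs)
      ultimately show ?thesis by (simp add: g_def)
    qed
    have inc: "\<bar>U (real n) - U 0\<bar> \<le> 3 * C * K / g * sqrt (bracket x) powr (- g)" for n
      using radial_increment_bound[OF d le, of 0 "real n"] \<open>0 < g\<close> bracket_pos[of x] \<open>0 \<le> C\<close> \<open>K \<ge> 0\<close>
      by simp
    have cu: "continuous_on UNIV (u i)" by (intro smooth_continuous_on sm)
    obtain M where M: "\<And>z. \<bar>u i z\<bar> \<le> M"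
    proof -
      have "\<forall>\<^sub>F z in at_infinity. \<bar>u i z\<bar> < 1"
        using tendstoD[OF lim[rule_format, of i], of 1] by simp
      then obtain R where R: "\<And>z. R \<le> norm z \<Longrightarrow> \<bar>u i z\<bar> < 1"
        by (auto simp: eventually_at_infinity)
      have "compact (u i ` cball 0 R)"
        by (intro compact_continuous_image continuous_on_subset[OF cu]) auto
      then obtain M where "\<And>z. z \<in> cball 0 R \<Longrightarrow> \<bar>u i z\<bar> \<le> M"
        by (metis (no_types, lifting) bounded_iff compact_imp_bounded image_eqI real_norm_def)
      then have "\<bar>u i z\<bar> \<le> max M 1" for z
        using R[of z] by (cases "norm z \<le> R") force+
      then show ?thesis using that by blast
    qed
    \<comment> \<open>For y other than 0 the points x + n y escape to infinity, where u_i vanishes;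
      boundedness of u_i gives the dominating function.\<close>
    have "(\<lambda>n. U (real n)) \<longlonglongrightarrow> (LINT y|(lborel :: (real^3) measure). (0::real))"
      unfolding U_def
    proof (rule Bochner_Integration.integral_dominated_convergence[where w = "\<lambda>y. bump y * M"])
      show "(\<lambda>y. bump y * u i (x + real n *\<^sub>R y)) \<in> borel_measurable lborel" for n
        using average_integrable[OF cu continuous_on_bump bump_eq_0] by (rule borel_measurable_integrable)
      show "AE y in lborel. norm (bump y * u i (x + real n *\<^sub>R y)) \<le> bump y * M" for n
        using M by (intro AE_I2) (simp add: abs_mult abs_of_nonneg[OF bump_nonneg] mult_left_mono[OF _ bump_nonneg])
      show "integrable lborel (\<lambda>y::real^3. bump y * M)"
        by (intro integrable_mult_left bounded_support_integrable[OF continuous_on_bump bump_eq_0])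
      show "AE y in lborel. (\<lambda>n. bump y * u i (x + real n *\<^sub>R y)) \<longlonglongrightarrow> 0"
        using AE_lborel_singleton[of 0]
      proof eventually_elim
        fix y :: "real^3" assume "y \<noteq> 0"
        have "filterlim (\<lambda>n. x + real n *\<^sub>R y) at_infinity sequentially"
        proof (rule tendsto_add_filterlim_at_infinity[OF tendsto_const])
          have "filterlim (\<lambda>n. real n * norm y) at_top sequentially"
            using \<open>y \<noteq> 0\<close> by (intro filterlim_at_top_mult_tendsto_pos[OF tendsto_const] filterlim_real_sequentially) simp
          then show "filterlim (\<lambda>n. real n *\<^sub>R y) at_infinity sequentially"
            by (intro filterlim_norm_at_top_imp_at_infinity) simp
        qed
        from filterlim_compose[OF lim[rule_format] this]
        show "(\<lambda>n. bump y * u i (x + real n *\<^sub>R y)) \<longlonglongrightarrow> 0"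
          by (intro tendsto_mult_right_zero)
      qed
    qed simp
    then have "(\<lambda>n. \<bar>U (real n) - U 0\<bar>) \<longlonglongrightarrow> \<bar>0 - U 0\<bar>"
      by (intro tendsto_intros) simp
    then have "\<bar>0 - U 0\<bar> \<le> 3 * C * K / g * sqrt (bracket x) powr (- g)"
      by (rule LIMSEQ_le_const2) (use inc in auto)
    moreover have "U 0 = B * u i x" by (simp add: U_def B_def)
    ultimately have "B * \<bar>u i x\<bar> \<le> 3 * C * K / g * sqrt (bracket x) powr (- g)"
      using \<open>0 < B\<close> by (simp add: abs_mult)
    then have "\<bar>u i x\<bar> \<le> 3 * C * K / g * sqrt (bracket x) powr (- g) / B"
      using \<open>0 < B\<close> by (subst pos_le_divide_eq) (simp_all only: mult.commute[of _ B])
    also have "sqrt (bracket x) powr (- g) = bracket x powr (1/2 + e - a)"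
      by (simp add: powr_bracket_eq g_def field_simps)
    finally show "\<bar>u i x\<bar> \<le> 3 * K / g / B * C * bracket x powr (1/2 + e - a)"
      by (simp add: mult_ac)
  qed
qed

text \<open>Unlike the velocity, H comes with no limit at infinity, and its gradient contains
  derivatives of w, for which no decay is known. In the radial derivative of an average these drop
  out, because the weighted derivatives are symmetric in i, j while w is skew. So averages about
  each centre converge at a rate, and a comparison of centres makes the limit independent of x. The
  hypothesis b <= a + 1/2 ensures that this comparison is no worse than the radial estimate.\<close>

lemma head_decay:
  fixes H :: "real^3 \<Rightarrow> real" and g :: "3 \<Rightarrow> real^3 \<Rightarrow> real" and w :: "3 \<Rightarrow> 3 \<Rightarrow> real^3 \<Rightarrow> real"
  assumes num: "0 < e" "a \<le> 3/2 + e" "b \<le> 3/2 + e" "1/2 + e < b" "b \<le> a + 1/2" "0 < a"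
    and "0 \<le> C" and smH: "smooth H" and cg: "\<And>i. continuous_on UNIV (g i)" and smw: "\<And>i j. smooth (w i j)"
    and anti: "\<And>i j x. w i j x = - w j i x"
    and eq: "\<And>i x. partial_derivative i H x = g i x - (\<Sum>j\<in>UNIV. partial_derivative j (w i j) x)"
    and gle: "\<And>i x. \<bar>g i x\<bar> \<le> C * bracket x powr (-b)"
    and wle: "\<And>i j x. \<bar>w i j x\<bar> \<le> C * bracket x powr (-a)"
  shows "\<exists>h K. \<forall>x. \<bar>H x - h\<bar> \<le> K * bracket x powr (1/2 + e - b)"
proof -
  obtain Ka where "Ka \<ge> 0" and Ka: "\<And>(x::real^3) r f M C. 0 < r \<Longrightarrow> 0 \<le> M \<Longrightarrow> 0 \<le> C \<Longrightarrow>
    continuous_on UNIV f \<Longrightarrow> (\<And>y. \<bar>f y\<bar> \<le> M * C * indicator (cball 0 1) y * bracket (x + r *\<^sub>R y) powr (-a)) \<Longrightarrow>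
    \<bar>LINT y|lborel. f y\<bar> \<le> M * C * Ka * (sqrt (bracket x) + r) powr (2 * e - 2 * a)"
    using average_bracket_bound[of a e] num by auto
  obtain Kb where "Kb \<ge> 0" and Kb: "\<And>(x::real^3) r f M C. 0 < r \<Longrightarrow> 0 \<le> M \<Longrightarrow> 0 \<le> C \<Longrightarrow>
    continuous_on UNIV f \<Longrightarrow> (\<And>y. \<bar>f y\<bar> \<le> M * C * indicator (cball 0 1) y * bracket (x + r *\<^sub>R y) powr (-b)) \<Longrightarrow>
    \<bar>LINT y|lborel. f y\<bar> \<le> M * C * Kb * (sqrt (bracket x) + r) powr (2 * e - 2 * b)"
    using average_bracket_bound[of b e] num by auto
  define \<gamma> where "\<gamma> = 2 * b - 2 * e - 1"
  have "0 < \<gamma>" using num by (simp add: \<gamma>_def)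
  define B where "B = (LINT y|lborel. bump (y::real^3))"
  have "0 < B" unfolding B_def by (rule bump_integral_pos)
  note cw = smooth_continuous_on[OF smw] and cpw = smooth_continuous_on[OF smooth_partial_derivative[OF smw]]
  define U where "U x r = (LINT y|lborel. bump y * H (x + r *\<^sub>R y))" for x r
  have bump_component: "\<bar>y $ j * bump y\<bar> \<le> 1" if "norm y \<le> 1" for y :: "real^3" and j
  proof -
    have "\<bar>y $ j\<bar> * \<bar>bump y\<bar> \<le> 1 * 1"
      using that component_le_norm_cart[of y j] bump_nonneg[of y] bump_le_1[of y]
      by (intro mult_mono) auto
    then show ?thesis by (simp add: abs_mult)
  qed
  have kernel: "\<bar>k y * h (x + r *\<^sub>R y)\<bar> \<le> M * C * indicator (cball 0 1) y * bracket (x + r *\<^sub>R y) powr (-c)"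
    if "\<And>y. norm y \<le> 1 \<Longrightarrow> \<bar>k y\<bar> \<le> M" "\<And>y. 1 < norm y \<Longrightarrow> k y = 0" "\<And>z. \<bar>h z\<bar> \<le> C * bracket z powr (-c)" "0 \<le> M"
    for k h :: "real^3 \<Rightarrow> real" and M c x r y
  proof (cases "norm y \<le> 1")
    case True
    have "\<bar>k y\<bar> * \<bar>h (x + r *\<^sub>R y)\<bar> \<le> M * (C * bracket (x + r *\<^sub>R y) powr (-c))"
      using that True by (intro mult_mono) auto
    then show ?thesis using True by (simp add: abs_mult)
  qed (use that in simp)
  have inc: "\<bar>U x R - U x S\<bar> \<le> 3 * C * Kb / \<gamma> * (sqrt (bracket x) + S) powr (- \<gamma>)"
    if "0 \<le> S" "S \<le> R" for x S R
  proof -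
    define U' where "U' r = (LINT y|lborel. bump y * (\<Sum>i\<in>UNIV. y $ i * partial_derivative i H (x + r *\<^sub>R y)))" for r
    have d: "(U x has_real_derivative U' r) (at r)" for r
      unfolding U_def[abs_def] U'_def
      by (rule average_has_derivative) (auto simp: smH bump_eq_0 intro: continuous_intros continuous_on_bump)
    have int: "integrable lborel (\<lambda>y. (y $ k * bump y) * h (x + r *\<^sub>R y))"
      if "continuous_on UNIV h" for k r and h :: "real^3 \<Rightarrow> real"
      by (intro average_integrable that continuous_intros continuous_on_bump) (simp add: bump_eq_0)
    have U': "U' r = (\<Sum>i\<in>UNIV. LINT y|lborel. (y $ i * bump y) * g i (x + r *\<^sub>R y))" if "0 < r" for r
    proof -
      define A where "A i j = (LINT y|lborel. (y $ i * bump y) * partial_derivative j (w i j) (x + r *\<^sub>R y))" for i j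
      have "U' r = (LINT y|lborel. (\<Sum>i\<in>UNIV. (y $ i * bump y) * g i (x + r *\<^sub>R y)) -
          (\<Sum>i\<in>UNIV. \<Sum>j\<in>UNIV. (y $ i * bump y) * partial_derivative j (w i j) (x + r *\<^sub>R y)))"
        unfolding U'_def
        by (intro Bochner_Integration.integral_cong)
          (auto simp: eq sum_distrib_left algebra_simps simp flip: sum_subtractf intro!: sum.cong)
      also have "\<dots> = (\<Sum>i\<in>UNIV. LINT y|lborel. (y $ i * bump y) * g i (x + r *\<^sub>R y)) -
          (\<Sum>i\<in>UNIV. \<Sum>j\<in>UNIV. A i j)"
        by (simp add: int cg cpw A_def)
      also have "(\<Sum>i\<in>UNIV. \<Sum>j\<in>UNIV. A i j) = 0"
      proof -
        have "A i j = - A j i" for i j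
        proof -
          have "w i j = (\<lambda>x. 0 - w j i x)" using anti[of i j] by auto
          then have "partial_derivative i (w i j) = (\<lambda>x. 0 - partial_derivative i (w j i) x)"
            by (simp only:) (intro has_partial_eqI has_partial_diff has_partial_const smooth_has_partial smw)
          then have "A j i = - (LINT y|lborel. (y $ j * bump y) * partial_derivative i (w i j) (x + r *\<^sub>R y))"
            by (simp add: A_def)
          also have "(LINT y|lborel. (y $ j * bump y) * partial_derivative i (w i j) (x + r *\<^sub>R y)) = A i j"
            unfolding A_def using that by (intro average_partial_symmetric smw) simp
          finally show ?thesis by simp
        qed
        then have "(\<Sum>i\<in>UNIV. \<Sum>j\<in>UNIV. A i j) = (\<Sum>i\<in>UNIV. \<Sum>j\<in>UNIV. - A j i)"
          by (intro sum.cong refl)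
        also have "\<dots> = - (\<Sum>j\<in>UNIV. \<Sum>i\<in>UNIV. A j i)"
          by (subst sum.swap) (simp add: sum_negf)
        finally show ?thesis by simp
      qed
      finally show ?thesis by simp
    qed
    have le: "\<bar>U' r\<bar> \<le> 3 * C * Kb * (sqrt (bracket x) + r) powr (- \<gamma> - 1)" if "0 < r" for r
    proof -
      have "\<bar>LINT y|lborel. (y $ i * bump y) * g i (x + r *\<^sub>R y)\<bar> \<le>
          1 * C * Kb * (sqrt (bracket x) + r) powr (2 * e - 2 * b)" for i
      proof (rule Kb[OF that _ \<open>0 \<le> C\<close>])
        show "continuous_on UNIV (\<lambda>y. (y $ i * bump y) * g i (x + r *\<^sub>R y))"
          by (intro continuous_intros continuous_on_bump continuous_on_compose2[OF cg]) auto
        show "\<bar>(y $ i * bump y) * g i (x + r *\<^sub>R y)\<bar> \<le>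
            1 * C * indicator (cball 0 1) y * bracket (x + r *\<^sub>R y) powr (-b)" for y
          by (rule kernel[where k = "\<lambda>y. y $ i * bump y"]) (use bump_component gle in \<open>auto simp: bump_eq_0\<close>)
      qed simp
      then have "(\<Sum>i\<in>(UNIV::3 set). \<bar>LINT y|lborel. (y $ i * bump y) * g i (x + r *\<^sub>R y)\<bar>) \<le>
          (\<Sum>i\<in>(UNIV::3 set). 1 * C * Kb * (sqrt (bracket x) + r) powr (2 * e - 2 * b))"
        by (rule sum_mono)
      moreover have "\<bar>U' r\<bar> \<le> (\<Sum>i\<in>UNIV. \<bar>LINT y|lborel. (y $ i * bump y) * g i (x + r *\<^sub>R y)\<bar>)"
        unfolding U'[OF that] by (rule sum_abs)
      ultimately show ?thesis by (simp add: \<gamma>_def)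
    qed
    show ?thesis
      by (rule radial_increment_bound[OF d le])
        (use that \<open>0 < \<gamma>\<close> \<open>0 \<le> C\<close> \<open>Kb \<ge> 0\<close> bracket_pos[of x] in auto)
  qed
  \<comment> \<open>A translation of the centre has no such cancellation; the derivative of w is
    moved onto the bump instead, which costs 1/r. The constant 18 is a bound 6 for the
    differentiated bump times three values of j.\<close>
  have shift: "\<bar>U x r - U 0 r\<bar> \<le> norm x * (3 * (C * Kb * r powr (2 * e - 2 * b) + 18 * C * Ka / r * r powr (2 * e - 2 * a)))"
    if "0 < r" for x r
  proof -
    define T where "T t = (LINT y|lborel. bump y * H (r *\<^sub>R y + t *\<^sub>R x))" for t
    define T' where "T' t = (LINT y|lborel. bump y * (\<Sum>i\<in>UNIV. x $ i * partial_derivative i H (r *\<^sub>R y + t *\<^sub>R x)))" for t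
    have d: "(T has_real_derivative T' t) (at t)" for t
      unfolding T_def[abs_def] T'_def
      by (rule average_has_derivative) (auto simp: smH bump_eq_0 intro: continuous_intros continuous_on_bump)
    have int: "integrable lborel (\<lambda>y. bump y * h (c + r *\<^sub>R y))"
      if "continuous_on UNIV h" for c and h :: "real^3 \<Rightarrow> real"
      by (intro average_integrable that continuous_on_bump bump_eq_0)
    define E where "E = C * Kb * r powr (2 * e - 2 * b) + 18 * C * Ka / r * r powr (2 * e - 2 * a)"
    have powr_le: "(sqrt (bracket c) + r) powr (2 * e - 2 * d) \<le> r powr (2 * e - 2 * d)" if "e \<le> d" for c :: "real^3" and d
      using that \<open>0 < r\<close> bracket_pos[of c] by (intro powr_mono2') auto
    have le: "\<bar>T' t\<bar> \<le> norm x * (3 * E)" for t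
    proof -
      let ?c = "t *\<^sub>R x"
      have T': "T' t = (\<Sum>i\<in>UNIV. x $ i * ((LINT y|lborel. bump y * g i (?c + r *\<^sub>R y)) -
          (\<Sum>j\<in>UNIV. LINT y|lborel. bump y * partial_derivative j (w i j) (?c + r *\<^sub>R y))))"
      proof -
        have "T' t = (LINT y|lborel. (\<Sum>i\<in>UNIV. x $ i * (bump y * g i (?c + r *\<^sub>R y) -
            (\<Sum>j\<in>UNIV. bump y * partial_derivative j (w i j) (?c + r *\<^sub>R y)))))"
          unfolding T'_def
          by (intro Bochner_Integration.integral_cong)
            (auto simp: eq sum_distrib_left right_diff_distrib add.commute mult_ac intro!: sum.cong)
        also have "\<dots> = (\<Sum>i\<in>UNIV. x $ i * ((LINT y|lborel. bump y * g i (?c + r *\<^sub>R y)) -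
          (\<Sum>j\<in>UNIV. LINT y|lborel. bump y * partial_derivative j (w i j) (?c + r *\<^sub>R y))))"
          by (simp add: int cg cpw)
        finally show ?thesis .
      qed
      have 1: "\<bar>LINT y|lborel. bump y * g i (?c + r *\<^sub>R y)\<bar> \<le> C * Kb * r powr (2 * e - 2 * b)" for i
      proof -
        have "\<bar>LINT y|lborel. bump y * g i (?c + r *\<^sub>R y)\<bar> \<le>
            1 * C * Kb * (sqrt (bracket ?c) + r) powr (2 * e - 2 * b)"
        proof (rule Kb[OF that _ \<open>0 \<le> C\<close>])
          show "continuous_on UNIV (\<lambda>y. bump y * g i (?c + r *\<^sub>R y))"
            by (intro continuous_intros continuous_on_bump continuous_on_compose2[OF cg]) auto
          show "\<bar>bump y * g i (?c + r *\<^sub>R y)\<bar> \<le>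
              1 * C * indicator (cball 0 1) y * bracket (?c + r *\<^sub>R y) powr (-b)" for y
            by (rule kernel[where k = bump]) (simp_all add: abs_of_nonneg[OF bump_nonneg] bump_le_1 bump_eq_0 gle)
        qed simp
        also have "\<dots> \<le> 1 * C * Kb * r powr (2 * e - 2 * b)"
          using num \<open>0 \<le> C\<close> \<open>Kb \<ge> 0\<close> by (intro mult_left_mono powr_le) auto
        finally show ?thesis by simp
      qed
      have 2: "\<bar>LINT y|lborel. bump y * partial_derivative j (w i j) (?c + r *\<^sub>R y)\<bar> \<le>
          6 * C * Ka / r * r powr (2 * e - 2 * a)" for i j
      proof -
        let ?k = "\<lambda>y::real^3. 6 * y $ j * (max 0 (2 - bracket y))\<^sup>2"
        have "\<bar>LINT y|lborel. ?k y * w i j (?c + r *\<^sub>R y)\<bar> \<le>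
            6 * C * Ka * (sqrt (bracket ?c) + r) powr (2 * e - 2 * a)"
        proof (rule Ka[OF that _ \<open>0 \<le> C\<close>])
          show "continuous_on UNIV (\<lambda>y. ?k y * w i j (?c + r *\<^sub>R y))"
            by (intro continuous_intros continuous_on_compose2[OF cw]) auto
          show "\<bar>?k y * w i j (?c + r *\<^sub>R y)\<bar> \<le>
              6 * C * indicator (cball 0 1) y * bracket (?c + r *\<^sub>R y) powr (-a)" for y
          proof (rule kernel)
            fix y :: "real^3" assume "norm y \<le> 1"
            have "(max 0 (2 - bracket y))\<^sup>2 \<le> 1\<^sup>2"
              using bracket_ge_1[of y] by (intro power_mono) auto
            then have "\<bar>y $ j\<bar> * (max 0 (2 - bracket y))\<^sup>2 \<le> 1 * 1"
              using \<open>norm y \<le> 1\<close> component_le_norm_cart[of y j] by (intro mult_mono) auto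
            then show "\<bar>?k y\<bar> \<le> 6" by (simp add: abs_mult)
          next
            fix y :: "real^3" assume "1 < norm y"
            from two_less_bracket[OF this] show "?k y = 0" by (simp add: max_absorb1)
          qed (simp_all add: wle)
        qed simp
        also have "\<dots> \<le> 6 * C * Ka * r powr (2 * e - 2 * a)"
          using num \<open>0 \<le> C\<close> \<open>Ka \<ge> 0\<close> by (intro mult_left_mono powr_le) auto
        finally have "r * \<bar>LINT y|lborel. bump y * partial_derivative j (w i j) (?c + r *\<^sub>R y)\<bar> \<le>
            6 * C * Ka * r powr (2 * e - 2 * a)"
          using that by (simp add: abs_mult flip: average_partial[OF smw])
        then show ?thesis using that by (simp add: field_simps)
      qed
      have "\<bar>T' t\<bar> \<le> (\<Sum>i\<in>(UNIV::3 set). norm x * E)"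
        unfolding T'
      proof (rule order_trans[OF sum_abs sum_mono])
        fix i :: 3
        have "\<bar>\<Sum>j\<in>UNIV. LINT y|lborel. bump y * partial_derivative j (w i j) (?c + r *\<^sub>R y)\<bar> \<le>
            (\<Sum>j\<in>(UNIV::3 set). 6 * C * Ka / r * r powr (2 * e - 2 * a))"
          by (rule order_trans[OF sum_abs sum_mono[OF 2]])
        also have "\<dots> = 18 * C * Ka / r * r powr (2 * e - 2 * a)" by simp
        finally have "\<bar>(LINT y|lborel. bump y * g i (?c + r *\<^sub>R y)) -
          (\<Sum>j\<in>UNIV. LINT y|lborel. bump y * partial_derivative j (w i j) (?c + r *\<^sub>R y))\<bar> \<le> E"
          using 1[of i] unfolding E_def by linarith
        then show "\<bar>x $ i * ((LINT y|lborel. bump y * g i (?c + r *\<^sub>R y)) -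
          (\<Sum>j\<in>UNIV. LINT y|lborel. bump y * partial_derivative j (w i j) (?c + r *\<^sub>R y)))\<bar> \<le> norm x * E"
          unfolding abs_mult by (intro mult_mono component_le_norm_cart) auto
      qed
      then show ?thesis by simp
    qed
    obtain z where "T 1 - T 0 = (1 - 0) * T' z"
      using MVT2[of 0 1 T T'] d by auto
    moreover have "T 1 = U x r" "T 0 = U 0 r"
      by (simp_all add: T_def U_def add.commute)
    ultimately show ?thesis using le[of z] by (simp add: E_def)
  qed
  define D where "D = 3 * C * Kb / \<gamma>"
  have "0 \<le> D" using \<open>0 \<le> C\<close> \<open>Kb \<ge> 0\<close> \<open>0 < \<gamma>\<close> by (simp add: D_def)
  have inc0: "\<bar>U 0 R - U 0 S\<bar> \<le> D * (1 + S) powr (- \<gamma>)" if "0 \<le> S" "S \<le> R" for S R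
    using inc[OF that, of 0] by (simp add: D_def bracket_def)
  \<comment> \<open>The constant h is found as the limit of averages about the origin, divided by
    the integral of the bump.\<close>
  have "Cauchy (\<lambda>n. U 0 (real n))"
  proof (rule metric_CauchyI)
    fix \<epsilon> :: real assume "0 < \<epsilon>"
    have "((\<lambda>t. (1 + t) powr (- \<gamma>)) \<longlongrightarrow> 0) at_top"
      using \<open>0 < \<gamma>\<close> by (intro tendsto_neg_powr filterlim_tendsto_add_at_top[OF tendsto_const] filterlim_ident) simp
    then have "((\<lambda>n. D * (1 + real n) powr (- \<gamma>)) \<longlongrightarrow> D * 0) sequentially"
      by (intro tendsto_mult tendsto_const) (rule filterlim_compose[OF _ filterlim_real_sequentially])
    from order_tendstoD(2)[OF this, of "\<epsilon> / 2"] \<open>0 < \<epsilon>\<close>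
    obtain N where N: "D * (1 + real N) powr (- \<gamma>) < \<epsilon> / 2"
      by (auto simp: eventually_sequentially)
    have "dist (U 0 (real m)) (U 0 (real n)) < \<epsilon>" if "N \<le> m" "N \<le> n" for m n
      using inc0[of "real N" "real m"] inc0[of "real N" "real n"] that N by (auto simp: dist_real_def)
    then show "\<exists>N. \<forall>m\<ge>N. \<forall>n\<ge>N. dist (U 0 (real m)) (U 0 (real n)) < \<epsilon>" by blast
  qed
  then obtain l where l: "(\<lambda>n. U 0 (real n)) \<longlonglongrightarrow> l"
    using Cauchy_convergent_iff convergent_def by blast
  have lim: "\<bar>l - U 0 S\<bar> \<le> D * (1 + S) powr (- \<gamma>)" if "0 \<le> S" for S
  proof (rule LIMSEQ_le_const2)
    show "(\<lambda>n. \<bar>U 0 (real n) - U 0 S\<bar>) \<longlonglongrightarrow> \<bar>l - U 0 S\<bar>"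
      by (intro tendsto_intros l)
    show "\<exists>N. \<forall>n\<ge>N. \<bar>U 0 (real n) - U 0 S\<bar> \<le> D * (1 + S) powr (- \<gamma>)"
      using inc0[OF that] real_nat_ceiling_ge[of S] by (meson of_nat_le_iff order_trans)
  qed
  define E where "E = 3 * C * Kb + 54 * C * Ka"
  \<comment> \<open>Three legs of the same size, with \<rho> = sqrt (bracket x): from radius 0 to
    \<rho> about x, from centre x to centre 0 at radius \<rho>, and from radius \<rho> to infinity
    about 0.\<close>
  have "\<bar>H x - l / B\<bar> \<le> (2 * D + E) / B * bracket x powr (1/2 + e - b)" for x
  proof -
    define \<rho> where "\<rho> = sqrt (bracket x)"
    have "1 \<le> \<rho>" using bracket_ge_1[of x] by (simp add: \<rho>_def)
    have "norm x \<le> \<rho>" by (simp add: \<rho>_def bracket_def real_le_rsqrt)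
    have 1: "\<bar>U x \<rho> - U x 0\<bar> \<le> D * \<rho> powr (- \<gamma>)"
      using inc[of 0 \<rho> x] \<open>1 \<le> \<rho>\<close> by (simp add: D_def \<rho>_def)
    have 2: "\<bar>l - U 0 \<rho>\<bar> \<le> D * \<rho> powr (- \<gamma>)"
    proof -
      have "(1 + \<rho>) powr (- \<gamma>) \<le> \<rho> powr (- \<gamma>)"
        using \<open>1 \<le> \<rho>\<close> \<open>0 < \<gamma>\<close> by (intro powr_mono2') auto
      then show ?thesis
        using lim[of \<rho>] \<open>1 \<le> \<rho>\<close> \<open>0 \<le> D\<close> by (auto intro: order_trans mult_left_mono)
    qed
    have 3: "\<bar>U x \<rho> - U 0 \<rho>\<bar> \<le> E * \<rho> powr (- \<gamma>)"
    proof -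
      have "\<rho> powr (2 * e - 2 * a) \<le> \<rho> powr (- \<gamma>)"
        using num \<open>1 \<le> \<rho>\<close> by (intro powr_mono) (auto simp: \<gamma>_def)
      then have a: "54 * C * Ka * \<rho> powr (2 * e - 2 * a) \<le> 54 * C * Ka * \<rho> powr (- \<gamma>)"
        using \<open>0 \<le> C\<close> \<open>Ka \<ge> 0\<close> by (intro mult_left_mono) auto
      have b: "\<rho> * \<rho> powr (2 * e - 2 * b) = \<rho> powr (- \<gamma>)"
        using \<open>1 \<le> \<rho>\<close> powr_add[of \<rho> 1 "2 * e - 2 * b"] by (simp add: \<gamma>_def algebra_simps)
      have "\<bar>U x \<rho> - U 0 \<rho>\<bar> \<le> norm x * (3 * (C * Kb * \<rho> powr (2 * e - 2 * b) + 18 * C * Ka / \<rho> * \<rho> powr (2 * e - 2 * a)))"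
        using \<open>1 \<le> \<rho>\<close> by (intro shift) simp
      also have "\<dots> \<le> \<rho> * (3 * (C * Kb * \<rho> powr (2 * e - 2 * b) + 18 * C * Ka / \<rho> * \<rho> powr (2 * e - 2 * a)))"
        using \<open>norm x \<le> \<rho>\<close> \<open>1 \<le> \<rho>\<close> \<open>0 \<le> C\<close> \<open>Ka \<ge> 0\<close> \<open>Kb \<ge> 0\<close> by (intro mult_right_mono) auto
      also have "\<dots> = 3 * C * Kb * (\<rho> * \<rho> powr (2 * e - 2 * b)) + 54 * C * Ka * \<rho> powr (2 * e - 2 * a)"
        using \<open>1 \<le> \<rho>\<close> by (simp add: field_simps)
      also have "\<dots> \<le> E * \<rho> powr (- \<gamma>)"
        using a unfolding b E_def by (simp add: algebra_simps)
      finally show ?thesis .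
    qed
    have "U x 0 = B * H x" by (simp add: U_def B_def)
    with 1 2 3 have "\<bar>B * H x - l\<bar> \<le> D * \<rho> powr (- \<gamma>) + D * \<rho> powr (- \<gamma>) + E * \<rho> powr (- \<gamma>)"
      by linarith
    then have le: "\<bar>B * H x - l\<bar> \<le> (2 * D + E) * \<rho> powr (- \<gamma>)"
      by (simp add: algebra_simps)
    have "B * (H x - l / B) = B * H x - l" using \<open>0 < B\<close> by (simp add: field_simps)
    then have "B * \<bar>H x - l / B\<bar> = \<bar>B * H x - l\<bar>"
      using \<open>0 < B\<close> by (metis abs_mult abs_of_pos)
    moreover have "\<rho> powr (- \<gamma>) = bracket x powr (1/2 + e - b)"
      by (simp add: \<rho>_def powr_bracket_eq \<gamma>_def field_simps)
    ultimately show ?thesis using le \<open>0 < B\<close> by (simp add: field_simps)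
  qed
  then show ?thesis by blast
qed

section \<open>The head equation\<close>

text \<open>\<open>Om\<close> stands for |curl v|^2 and \<open>g\<close> for v x curl v. The two
  expressions for the Laplacian of H have different uses: \<open>transport\<close> has the sign for
  the maximum principle and is stable under H -> F(H), while \<open>divergence_form\<close> involves
  only g, whose decay is known.\<close>

locale head_equation =
  fixes H :: "real^3 \<Rightarrow> real" and v g :: "3 \<Rightarrow> real^3 \<Rightarrow> real" and Om :: "real^3 \<Rightarrow> real"
  assumes smooth_H: "smooth H" and smooth_v: "\<And>i. smooth (v i)" and smooth_g: "\<And>i. smooth (g i)"
    and continuous_Om: "continuous_on UNIV Om" and Om_nonneg: "\<And>x. 0 \<le> Om x"
    and div_free: "\<And>x. (\<Sum>i\<in>UNIV. partial_derivative i (v i) x) = 0"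
    and transport: "\<And>x. (\<Sum>i\<in>UNIV. partial_derivative i (partial_derivative i H) x) =
      (\<Sum>i\<in>UNIV. v i x * partial_derivative i H x) + Om x"
    and divergence_form: "\<And>x. (\<Sum>i\<in>UNIV. partial_derivative i (partial_derivative i H) x) =
      (\<Sum>i\<in>UNIV. partial_derivative i (g i) x)"
begin

definition grad_sq :: "real^3 \<Rightarrow> real" where
  "grad_sq x = (\<Sum>i\<in>UNIV. (partial_derivative i H x)\<^sup>2)"

lemma grad_sq_nonneg: "0 \<le> grad_sq x"
  by (simp add: grad_sq_def sum_nonneg)

lemmas continuous_H = smooth_continuous_on[OF smooth_H]
  and continuous_dH = smooth_continuous_on[OF smooth_partial_derivative[OF smooth_H]]
  and continuous_ddH = smooth_continuous_on[OF smooth_partial_derivative[OF smooth_partial_derivative[OF smooth_H]]]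
  and continuous_v = smooth_continuous_on[OF smooth_v]
  and continuous_dv = smooth_continuous_on[OF smooth_partial_derivative[OF smooth_v]]
  and continuous_g = smooth_continuous_on[OF smooth_g]
  and continuous_dg = smooth_continuous_on[OF smooth_partial_derivative[OF smooth_g]]

lemma continuous_grad_sq: "continuous_on UNIV grad_sq"
  unfolding grad_sq_def[abs_def] by (intro continuous_intros continuous_dH)

lemma continuous_comp_H:
  assumes "\<And>x. (F has_real_derivative F' (H x)) (at (H x))"
  shows "continuous_on UNIV (\<lambda>x. F (H x))"
proof (rule continuous_at_imp_continuous_on, rule ballI)
  fix x
  have "isCont H x" using continuous_H by (simp add: continuous_on_eq_continuous_at)
  then show "isCont (\<lambda>x. F (H x)) x"
    by (rule isCont_o2) (rule DERIV_isCont[OF assms])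
qed

section \<open>Integral identities and the maximum principle for the head\<close>

lemma sum_partials_integral_eq_0:
  fixes X X' :: "3 \<Rightarrow> real^3 \<Rightarrow> real"
  assumes "\<And>i. has_partial i (X i) (X' i)" "\<And>i. continuous_on UNIV (X i)" "\<And>i. continuous_on UNIV (X' i)"
    and supp: "\<And>i x. R < norm x \<Longrightarrow> X i x = 0" and supp': "\<And>i x. R < norm x \<Longrightarrow> X' i x = 0"
  shows "(LINT x|lborel. (\<Sum>i\<in>UNIV. X' i x)) = 0"
proof -
  have "integrable lborel (X' i)" for i
    using assms by (intro bounded_support_integrable) auto
  moreover have "(LINT x|lborel. X' i x) = 0" for i
    using assms by (intro integral_partial_eq_0[of i "X i"]) auto
  ultimately show ?thesis by simp
qed

text \<open>The integrand is the divergence of \<phi> grad F(H) - F(H) grad \<phi> - \<phi> F(H) v,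
  simplified by \<open>transport\<close> and div v = 0. The alternative in \<open>supp\<close>
  serves two uses: \<phi> of compact support with general F, and \<phi> = 1 with F(H) vanishing far
  out.\<close>

lemma renormalized_identity:
  assumes F: "\<And>x. (F has_real_derivative F' (H x)) (at (H x))"
    and F': "\<And>x. (F' has_real_derivative F'' (H x)) (at (H x))"
    and cF'': "continuous_on UNIV (\<lambda>x. F'' (H x))"
    and \<phi>: "\<And>i. has_partial i \<phi> (\<phi>1 i)" "\<And>i. has_partial i (\<phi>1 i) (\<phi>2 i)"
    and c\<phi>: "continuous_on UNIV \<phi>" "\<And>i. continuous_on UNIV (\<phi>1 i)" "\<And>i. continuous_on UNIV (\<phi>2 i)"
    and supp: "\<And>x. R < norm x \<Longrightarrow> (\<phi> x = 0 \<and> (\<forall>i. \<phi>1 i x = 0 \<and> \<phi>2 i x = 0)) \<or>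
      (F (H x) = 0 \<and> F' (H x) = 0 \<and> F'' (H x) = 0)"
  shows "(LINT x|lborel. \<phi> x * F'' (H x) * grad_sq x + \<phi> x * F' (H x) * Om x -
    F (H x) * ((\<Sum>i\<in>UNIV. \<phi>2 i x) + (\<Sum>i\<in>UNIV. v i x * \<phi>1 i x))) = 0"
proof -
  let ?d = "\<lambda>i. partial_derivative i H" and ?dd = "\<lambda>i. partial_derivative i (partial_derivative i H)"
    and ?dv = "\<lambda>i. partial_derivative i (v i)"
  note cF = continuous_comp_H[of F, OF F] continuous_comp_H[of F', OF F'] cF''
  define X where "X i x = \<phi> x * (F' (H x) * ?d i x) - F (H x) * \<phi>1 i x - \<phi> x * (F (H x) * v i x)" for i x
  define X' where "X' i x = (\<phi>1 i x * (F' (H x) * ?d i x) +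
        \<phi> x * ((F'' (H x) * ?d i x) * ?d i x + F' (H x) * ?dd i x)) -
      ((F' (H x) * ?d i x) * \<phi>1 i x + F (H x) * \<phi>2 i x) -
      (\<phi>1 i x * (F (H x) * v i x) + \<phi> x * ((F' (H x) * ?d i x) * v i x + F (H x) * ?dv i x))" for i x
  have "(LINT x|lborel. (\<Sum>i\<in>UNIV. X' i x)) = 0"
  proof (rule sum_partials_integral_eq_0[where R = R])
    show "has_partial i (X i) (X' i)" for i
      unfolding X_def[abs_def] X'_def[abs_def]
      by (intro has_partial_diff has_partial_mult \<phi> has_partial_chain[OF smooth_has_partial[OF smooth_H] F]
          has_partial_chain[OF smooth_has_partial[OF smooth_H] F']
          smooth_has_partial smooth_v smooth_partial_derivative smooth_H)
    show "continuous_on UNIV (X i)" "continuous_on UNIV (X' i)" for i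
      unfolding X_def[abs_def] X'_def[abs_def]
      by (intro continuous_intros c\<phi> cF continuous_dH continuous_ddH continuous_v continuous_dv)+
    show "X i x = 0" "X' i x = 0" if "R < norm x" for i x
      using supp[OF that] by (auto simp: X_def X'_def)
  qed
  moreover have "(\<Sum>i\<in>UNIV. X' i x) = \<phi> x * F'' (H x) * grad_sq x + \<phi> x * F' (H x) * Om x -
    F (H x) * ((\<Sum>i\<in>UNIV. \<phi>2 i x) + (\<Sum>i\<in>UNIV. v i x * \<phi>1 i x))" for x
  proof -
    have "(\<Sum>i\<in>UNIV. X' i x) = (\<Sum>i\<in>UNIV. \<phi> x * F'' (H x) * (?d i x)\<^sup>2 + \<phi> x * F' (H x) * ?dd i x
       - F (H x) * \<phi>2 i x - F (H x) * (v i x * \<phi>1 i x) - \<phi> x * F' (H x) * (v i x * ?d i x)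
       - \<phi> x * F (H x) * ?dv i x)"
      by (intro sum.cong refl) (simp add: X'_def power2_eq_square algebra_simps)
    also have "\<dots> = \<phi> x * F'' (H x) * grad_sq x + \<phi> x * F' (H x) * (\<Sum>i\<in>UNIV. ?dd i x)
       - F (H x) * (\<Sum>i\<in>UNIV. \<phi>2 i x) - F (H x) * (\<Sum>i\<in>UNIV. v i x * \<phi>1 i x)
       - \<phi> x * F' (H x) * (\<Sum>i\<in>UNIV. v i x * ?d i x) - \<phi> x * F (H x) * (\<Sum>i\<in>UNIV. ?dv i x)"
      by (simp only: sum_subtractf sum.distrib sum_distrib_left grad_sq_def)
    also have "\<dots> = \<phi> x * F'' (H x) * grad_sq x + \<phi> x * F' (H x) * Om x -
        F (H x) * ((\<Sum>i\<in>UNIV. \<phi>2 i x) + (\<Sum>i\<in>UNIV. v i x * \<phi>1 i x))"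
      unfolding transport div_free by (simp add: algebra_simps)
    finally show ?thesis .
  qed
  ultimately show ?thesis by simp
qed

text \<open>The equation div (grad H - g) = 0 is tested with \<phi> H. Writing H grad H as the
  gradient of H^2/2 moves both derivatives onto \<phi>, so the errors made by the cutoff contain no
  gradient of H.\<close>

lemma divergence_form_identity:
  assumes \<phi>: "\<And>i. has_partial i \<phi> (\<phi>1 i)" "\<And>i. has_partial i (\<phi>1 i) (\<phi>2 i)"
    and c\<phi>: "continuous_on UNIV \<phi>" "\<And>i. continuous_on UNIV (\<phi>1 i)" "\<And>i. continuous_on UNIV (\<phi>2 i)"
    and supp: "\<And>x. R < norm x \<Longrightarrow> \<phi> x = 0 \<and> (\<forall>i. \<phi>1 i x = 0 \<and> \<phi>2 i x = 0)"
  shows "(LINT x|lborel. \<phi> x * grad_sq x - \<phi> x * (\<Sum>i\<in>UNIV. partial_derivative i H x * g i x)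
    - H x * (\<Sum>i\<in>UNIV. g i x * \<phi>1 i x) - (H x)\<^sup>2 / 2 * (\<Sum>i\<in>UNIV. \<phi>2 i x)) = 0"
proof -
  let ?d = "\<lambda>i. partial_derivative i H" and ?dd = "\<lambda>i. partial_derivative i (partial_derivative i H)"
    and ?dg = "\<lambda>i. partial_derivative i (g i)"
  define X where "X i x = (\<phi> x * H x) * (?d i x - g i x) - (1/2 * (H x * H x)) * \<phi>1 i x" for i x
  define X' where "X' i x = ((\<phi>1 i x * H x + \<phi> x * ?d i x) * (?d i x - g i x) + (\<phi> x * H x) * (?dd i x - ?dg i x))
    - ((0 * (H x * H x) + 1/2 * (?d i x * H x + H x * ?d i x)) * \<phi>1 i x + (1/2 * (H x * H x)) * \<phi>2 i x)" for i x
  have "(LINT x|lborel. (\<Sum>i\<in>UNIV. X' i x)) = 0"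
  proof (rule sum_partials_integral_eq_0[where R = R])
    show "has_partial i (X i) (X' i)" for i
      unfolding X_def[abs_def] X'_def[abs_def]
      by (intro has_partial_diff has_partial_mult has_partial_const \<phi>
          smooth_has_partial smooth_g smooth_partial_derivative smooth_H)
    show "continuous_on UNIV (X i)" "continuous_on UNIV (X' i)" for i
      unfolding X_def[abs_def] X'_def[abs_def]
      by (intro continuous_intros c\<phi> continuous_H continuous_dH continuous_ddH continuous_g continuous_dg)+
    show "X i x = 0" "X' i x = 0" if "R < norm x" for i x
      using supp[OF that] by (auto simp: X_def X'_def)
  qed
  moreover have "(\<Sum>i\<in>UNIV. X' i x) = \<phi> x * grad_sq x - \<phi> x * (\<Sum>i\<in>UNIV. ?d i x * g i x)
    - H x * (\<Sum>i\<in>UNIV. g i x * \<phi>1 i x) - (H x)\<^sup>2 / 2 * (\<Sum>i\<in>UNIV. \<phi>2 i x)" for x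
  proof -
    have "(\<Sum>i\<in>UNIV. X' i x) = (\<Sum>i\<in>UNIV. \<phi> x * (?d i x)\<^sup>2 - \<phi> x * (?d i x * g i x)
      - H x * (g i x * \<phi>1 i x) - (H x)\<^sup>2 / 2 * \<phi>2 i x + \<phi> x * H x * ?dd i x - \<phi> x * H x * ?dg i x)"
      by (intro sum.cong refl) (simp add: X'_def power2_eq_square algebra_simps)
    also have "\<dots> = \<phi> x * grad_sq x - \<phi> x * (\<Sum>i\<in>UNIV. ?d i x * g i x)
      - H x * (\<Sum>i\<in>UNIV. g i x * \<phi>1 i x) - (H x)\<^sup>2 / 2 * (\<Sum>i\<in>UNIV. \<phi>2 i x)
      + \<phi> x * H x * (\<Sum>i\<in>UNIV. ?dd i x) - \<phi> x * H x * (\<Sum>i\<in>UNIV. ?dg i x)"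
      by (simp only: sum_subtractf sum.distrib sum_distrib_left grad_sq_def)
    also have "\<dots> = \<phi> x * grad_sq x - \<phi> x * (\<Sum>i\<in>UNIV. ?d i x * g i x)
      - H x * (\<Sum>i\<in>UNIV. g i x * \<phi>1 i x) - (H x)\<^sup>2 / 2 * (\<Sum>i\<in>UNIV. \<phi>2 i x)"
      unfolding divergence_form by simp
    finally show ?thesis .
  qed
  ultimately show ?thesis by simp
qed

text \<open>The maximum principle in energy form: for \<phi> = 1 and F the cube of the positive part
  of H - \<epsilon>, the identity is a vanishing integral of nonnegative terms. So grad H = 0
  wherever H > \<epsilon>, the positive part is constant along lines, and far out it is 0.\<close>

lemma head_nonpos:
  assumes lim: "(H \<longlongrightarrow> 0) at_infinity"
  shows "H x \<le> 0"
proof -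
  have "H x \<le> \<epsilon>" if "0 < \<epsilon>" for \<epsilon>
  proof -
    let ?m = "\<lambda>t. max 0 (t - \<epsilon>)"
    have der: "((\<lambda>t. ?m t ^ (n + 2)) has_real_derivative real (n + 2) * ?m t ^ (n + 1)) (at t)" for n t
      using DERIV_pos_part_power[of n "t + - \<epsilon>"] DERIV_shift[of "\<lambda>t. max 0 t ^ (n + 2)" _ t "- \<epsilon>"]
      by simp
    from order_tendstoD(2)[OF lim, of \<epsilon>] that obtain R where R: "\<And>x. R \<le> norm x \<Longrightarrow> H x < \<epsilon>"
      by (auto simp: eventually_at_infinity)
    then have m0: "?m (H x) = 0" if "R < norm x" for x
      using that by (simp add: less_imp_le max_absorb1)
    have cm: "continuous_on UNIV (\<lambda>x. ?m (H x))"
      by (intro continuous_intros continuous_H)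
    have der3: "((\<lambda>t. ?m t ^ 3) has_real_derivative 3 * ?m t ^ 2) (at t)" for t
      using der[of 1 t] by (simp add: numeral_eq_Suc)
    have der2: "((\<lambda>t. ?m t ^ 2) has_real_derivative 2 * ?m t) (at t)" for t
      using der[of 0 t] by (simp add: numeral_eq_Suc)
    have "(LINT x|lborel. 1 * (6 * ?m (H x)) * grad_sq x + 1 * (3 * ?m (H x) ^ 2) * Om x -
        ?m (H x) ^ 3 * ((\<Sum>i\<in>(UNIV::3 set). 0) + (\<Sum>i\<in>UNIV. v i x * 0))) = 0"
    proof (rule renormalized_identity[where F = "\<lambda>t. ?m t ^ 3" and R = R])
      show "((\<lambda>t. 3 * ?m t ^ 2) has_real_derivative 6 * ?m (H x)) (at (H x))" for x
        using DERIV_cmult[OF der2[of "H x"], of 3] by simp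
      show "continuous_on UNIV (\<lambda>x. 6 * ?m (H x))" by (intro continuous_intros cm)
    qed (use der3 m0 in \<open>auto simp: has_partial_const\<close>)
    then have int: "(LINT x|lborel. 6 * ?m (H x) * grad_sq x + 3 * ?m (H x) ^ 2 * Om x) = 0"
      by simp
    have zero: "6 * ?m (H y) * grad_sq y + 3 * ?m (H y) ^ 2 * Om y = 0" for y
    proof (rule continuous_integral_eq_0[OF _ _ _ int])
      show "continuous_on UNIV (\<lambda>x. 6 * ?m (H x) * grad_sq x + 3 * ?m (H x) ^ 2 * Om x)"
        by (intro continuous_intros cm continuous_grad_sq continuous_Om)
      show "6 * ?m (H x) * grad_sq x + 3 * ?m (H x) ^ 2 * Om x = 0" if "R < norm x" for x
        using m0[OF that] by simp
    qed (simp add: grad_sq_nonneg Om_nonneg)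
    have zero': "?m (H y) * partial_derivative i H y = 0" for y i
    proof -
      have "0 \<le> 6 * ?m (H y) * grad_sq y" "0 \<le> 3 * ?m (H y) ^ 2 * Om y"
        by (simp_all add: grad_sq_nonneg Om_nonneg)
      then have "6 * ?m (H y) * grad_sq y = 0" using zero[of y] by linarith
      then have "?m (H y) = 0 \<or> grad_sq y = 0" by simp
      then show ?thesis
        by (auto simp: grad_sq_def sum_nonneg_eq_0_iff)
    qed
    have "has_partial 1 (\<lambda>x. ?m (H x) ^ 2) (\<lambda>x. 2 * ?m (H x) * partial_derivative 1 H x)"
      by (intro has_partial_chain smooth_has_partial smooth_H der2)
    then have hp: "has_partial 1 (\<lambda>x. ?m (H x) ^ 2) (\<lambda>x. 0)"
      using zero' by (simp add: mult.assoc)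
    \<comment> \<open>A step this long along the first axis ends at norm at least |R| + 1, outside
      the ball of radius R.\<close>
    let ?s = "\<bar>R\<bar> + norm x + 1"
    have "?m (H (x + ?s *\<^sub>R axis 1 1)) ^ 2 = ?m (H (x + 0 *\<^sub>R axis 1 1)) ^ 2"
      by (rule DERIV_isconst_all) (rule allI, rule has_partialD[OF hp])
    moreover have "R < norm (x + ?s *\<^sub>R axis 1 1)"
    proof -
      have "norm (?s *\<^sub>R axis 1 (1::real)) \<le> norm (x + ?s *\<^sub>R axis 1 1) + norm x"
        using norm_triangle_ineq4[of "x + ?s *\<^sub>R axis 1 1" x] by simp
      then show ?thesis by simp
    qed
    ultimately have "?m (H x) = 0" using m0 by simp
    then show ?thesis by (simp add: max_def split: if_splits)
  qed
  then show ?thesis by (rule field_le_epsilon[of "H x" 0, simplified])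
qed

end

section \<open>Weighted gradient bounds\<close>

lemma bracket_powr_mono: "a \<le> b \<Longrightarrow> bracket x powr a \<le> bracket x powr b"
  using bracket_ge_1[of x] by (intro powr_mono) auto

lemma norm_le_sqrt_bracket: "norm x \<le> bracket x powr (1/2)"
  using bracket_pos[of x] by (simp add: powr_half_sqrt bracket_def real_le_rsqrt)

text \<open>\<phi> is the power J^m cut off near J = N; \<phi>1 and \<phi>2 are its first and its
  pure second partials. The last two clauses say that, up to M, each derivative costs J^(-1/2), as
  for J^m itself; second partials enter only through the Laplacian.\<close>

definition power_cutoff :: "real \<Rightarrow> real \<Rightarrow> real \<Rightarrow> (real^3 \<Rightarrow> real) \<Rightarrow> (3 \<Rightarrow> real^3 \<Rightarrow> real) \<Rightarrow>
    (3 \<Rightarrow> real^3 \<Rightarrow> real) \<Rightarrow> bool" where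
  "power_cutoff m M N \<phi> \<phi>1 \<phi>2 \<longleftrightarrow>
    (\<forall>i. has_partial i \<phi> (\<phi>1 i)) \<and> (\<forall>i. has_partial i (\<phi>1 i) (\<phi>2 i)) \<and>
    continuous_on UNIV \<phi> \<and> (\<forall>i. continuous_on UNIV (\<phi>1 i)) \<and> (\<forall>i. continuous_on UNIV (\<phi>2 i)) \<and>
    (\<forall>x. 0 \<le> \<phi> x \<and> \<phi> x \<le> bracket x powr m) \<and>
    (\<forall>x. bracket x \<le> N / 2 \<longrightarrow> bracket x powr m \<le> 8 * \<phi> x) \<and>
    (\<forall>x. N < norm x \<longrightarrow> \<phi> x = 0 \<and> (\<forall>i. \<phi>1 i x = 0 \<and> \<phi>2 i x = 0)) \<and>
    (\<forall>i x. \<bar>\<phi>1 i x\<bar> \<le> M * bracket x powr (m - 1/2)) \<and>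
    (\<forall>x. \<bar>\<Sum>i\<in>UNIV. \<phi>2 i x\<bar> \<le> M * bracket x powr (m - 1))"

lemma power_cutoffD:
  assumes "power_cutoff m M N \<phi> \<phi>1 \<phi>2"
  shows "has_partial i \<phi> (\<phi>1 i)" "has_partial i (\<phi>1 i) (\<phi>2 i)"
    and "continuous_on UNIV \<phi>" "continuous_on UNIV (\<phi>1 i)" "continuous_on UNIV (\<phi>2 i)"
    and "0 \<le> \<phi> x" "\<phi> x \<le> bracket x powr m" "bracket x \<le> N / 2 \<Longrightarrow> bracket x powr m \<le> 8 * \<phi> x"
    and "N < norm x \<Longrightarrow> \<phi> x = 0 \<and> (\<forall>i. \<phi>1 i x = 0 \<and> \<phi>2 i x = 0)"
    and "\<bar>\<phi>1 i x\<bar> \<le> M * bracket x powr (m - 1/2)"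
    and "\<bar>\<Sum>i\<in>UNIV. \<phi>2 i x\<bar> \<le> M * bracket x powr (m - 1)"
  using assms unfolding power_cutoff_def by blast+

text \<open>The witness is J^m times the cube of the positive part of 1 - J/N. A derivative falling
  on the cutoff produces 1/N, which is at most 1/J on the support, so M can be chosen before N. The
  8 in the lower bound is (1/2)^(-3), from 1 - J/N >= 1/2.\<close>

lemma power_cutoff_exists:
  fixes m :: real
  shows "\<exists>M\<ge>0. \<forall>N\<ge>1. \<exists>\<phi> \<phi>1 \<phi>2.
    power_cutoff m M N \<phi> \<phi>1 \<phi>2"
proof -
  define K1 where "K1 = \<bar>m\<bar> + 3"
  define K2 where "K2 = \<bar>m\<bar> * \<bar>m - 1\<bar> + 6 * \<bar>m\<bar> + 6"
  \<comment> \<open>Large enough for the first partials, bounded with 2 * K1, and for the Laplacian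
    4 |x|^2 \<open>\<theta>2\<close> + 6 \<open>\<theta>1\<close> in dimension 3, bounded with 4 *
    K2 + 6 * K1.\<close>
  define M where "M = 8 * K1 + 4 * K2"
  have K: "0 \<le> K1" "0 \<le> K2" by (auto simp: K1_def K2_def)
  show ?thesis
  proof (intro exI[of _ M] conjI allI impI)
    show "0 \<le> M" using K by (simp add: M_def)
    fix N :: real assume "1 \<le> N"
    define c where "c t = max 0 (1 - t / N)" for t
    define \<theta> where "\<theta> t = t powr m * c t ^ 3" for t
    define \<theta>1 where "\<theta>1 t = m * t powr (m - 1) * c t ^ 3 - 3 / N * (t powr m * c t ^ 2)" for t
    define \<theta>2 where "\<theta>2 t = m * ((m - 1) * t powr (m - 2) * c t ^ 3 - 3 / N * (t powr (m - 1) * c t ^ 2))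
      - 3 / N * (m * t powr (m - 1) * c t ^ 2 - 2 / N * (t powr m * c t))" for t
    have dc: "((\<lambda>t. c t ^ (n + 2)) has_real_derivative real (n + 2) * c t ^ (n + 1) * (- (1 / N))) (at t)" for n t
    proof -
      have 1: "((\<lambda>t. 1 - t / N) has_real_derivative - (1 / N)) (at t)"
        using \<open>1 \<le> N\<close> by (auto intro!: derivative_eq_intros)
      show ?thesis
        unfolding c_def
        by (rule DERIV_chain2[where f = "\<lambda>s. max 0 s ^ (n + 2)" and g = "\<lambda>t. 1 - t / N", OF DERIV_pos_part_power 1])
    qed
    have dc3: "((\<lambda>t. c t ^ 3) has_real_derivative - (3 / N) * c t ^ 2) (at t)" for t
      using dc[of 1 t] by (simp add: numeral_eq_Suc)
    have dc2: "((\<lambda>t. c t ^ 2) has_real_derivative - (2 / N) * c t) (at t)" for t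
      using dc[of 0 t] by (simp add: numeral_eq_Suc)
    have dp: "((\<lambda>t. t powr s) has_real_derivative s * t powr (s - 1)) (at t)" if "0 < t" for s t :: real
      using that by (rule has_real_derivative_powr)
    have d1: "(\<theta> has_real_derivative \<theta>1 t) (at t)" if "0 < t" for t
      using DERIV_mult[OF dp[OF that, of m] dc3[of t]]
      unfolding \<theta>_def[abs_def] \<theta>1_def by (simp add: algebra_simps)
    have d2: "(\<theta>1 has_real_derivative \<theta>2 t) (at t)" if "0 < t" for t
      using DERIV_diff[OF DERIV_mult[OF DERIV_cmult[OF dp[OF that, of "m - 1"], of m] dc3[of t]]
          DERIV_cmult[OF DERIV_mult[OF dp[OF that, of m] dc2[of t]], of "3 / N"]]
      unfolding \<theta>1_def[abs_def] \<theta>2_def by (simp add: algebra_simps)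
    have c01: "0 \<le> c t" "c t \<le> 1" if "1 \<le> t" for t
      using that \<open>1 \<le> N\<close> by (auto simp: c_def)
    \<comment> \<open>Powers of t / N are harmless next to a factor \<open>c t\<close>, which
      vanishes as soon as t exceeds N.\<close>
    have cu: "(t / N) ^ j * c t ^ (k + 1) \<le> 1" "0 \<le> (t / N) ^ j * c t ^ (k + 1)" if "1 \<le> t" for t j k
    proof -
      have "t / N \<le> 1" if "c t \<noteq> 0" using that \<open>1 \<le> N\<close> by (auto simp: c_def max_def split: if_splits)
      then show "(t / N) ^ j * c t ^ (k + 1) \<le> 1"
        using c01[OF that] that \<open>1 \<le> N\<close>
        by (cases "c t = 0") (auto intro!: mult_le_one power_le_one)
      show "0 \<le> (t / N) ^ j * c t ^ (k + 1)" using c01[OF that] that \<open>1 \<le> N\<close> by simp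
    qed
    have b1: "\<bar>\<theta>1 t\<bar> \<le> K1 * t powr (m - 1)" if "1 \<le> t" for t
    proof -
      have "t powr m = t powr (m - 1) * t" using that by (simp add: powr_diff)
      then have "\<theta>1 t = t powr (m - 1) * (m * c t ^ 3 - 3 * ((t / N) ^ 1 * c t ^ (1 + 1)))"
        by (simp add: \<theta>1_def algebra_simps power2_eq_square)
      also have "\<bar>\<dots>\<bar> \<le> t powr (m - 1) * K1"
      proof -
        have "\<bar>m * c t ^ 3\<bar> \<le> \<bar>m\<bar> * 1"
          unfolding abs_mult using c01[OF that] by (intro mult_left_mono) (auto intro: power_le_one)
        then have "\<bar>m * c t ^ 3 - 3 * ((t / N) ^ 1 * c t ^ (1 + 1))\<bar> \<le> K1"
          using cu[OF that, of 1 1] unfolding K1_def by linarith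
        then show ?thesis by (simp add: abs_mult mult_left_mono)
      qed
      finally show ?thesis by (simp add: mult.commute)
    qed
    have b2: "\<bar>\<theta>2 t\<bar> \<le> K2 * t powr (m - 2)" if "1 \<le> t" for t
    proof -
      have "t powr m = t powr (m - 2) * t\<^sup>2" "t powr (m - 1) = t powr (m - 2) * t"
        using that by (simp_all add: powr_diff power2_eq_square powr_numeral)
      then have "\<theta>2 t = t powr (m - 2) * (m * (m - 1) * c t ^ 3 - 6 * m * ((t / N) ^ 1 * c t ^ (1 + 1)) +
          6 * ((t / N) ^ 2 * c t ^ (0 + 1)))"
        by (simp add: \<theta>2_def algebra_simps power2_eq_square)
      also have "\<bar>\<dots>\<bar> \<le> t powr (m - 2) * K2"
      proof -
        have 1: "\<bar>m * (m - 1) * c t ^ 3\<bar> \<le> \<bar>m\<bar> * \<bar>m - 1\<bar> * 1"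
          unfolding abs_mult using c01[OF that] by (intro mult_left_mono) (auto intro: power_le_one)
        have 2: "\<bar>6 * m * ((t / N) ^ 1 * c t ^ (1 + 1))\<bar> \<le> 6 * \<bar>m\<bar> * 1"
          unfolding abs_mult[of "6 * m"] using cu[OF that, of 1 1] by (intro mult_mono) (auto simp: abs_mult)
        have 3: "\<bar>6 * ((t / N) ^ 2 * c t ^ (0 + 1))\<bar> \<le> 6"
          using cu[OF that, of 2 0] by linarith
        from 1 2 3 have "\<bar>m * (m - 1) * c t ^ 3 - 6 * m * ((t / N) ^ 1 * c t ^ (1 + 1)) +
          6 * ((t / N) ^ 2 * c t ^ (0 + 1))\<bar> \<le> K2"
          unfolding K2_def by linarith
        then show ?thesis by (simp add: abs_mult mult_left_mono)
      qed
      finally show ?thesis by (simp add: mult.commute)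
    qed
    define \<phi> where "\<phi> x = \<theta> (bracket (x::real^3))" for x
    define \<phi>1 where "\<phi>1 i x = \<theta>1 (bracket x) * (2 * x $ i)" for i and x :: "real^3"
    define \<phi>2 where "\<phi>2 i x = (\<theta>2 (bracket x) * (2 * x $ i)) * (2 * x $ i) + \<theta>1 (bracket x) * 2" for i and x :: "real^3"
    have hp1: "has_partial i \<phi> (\<phi>1 i)" for i
      unfolding \<phi>_def[abs_def] \<phi>1_def[abs_def]
      by (intro has_partial_chain has_partial_bracket d1 bracket_pos)
    have hp2: "has_partial i (\<phi>1 i) (\<phi>2 i)" for i
    proof -
      have "has_partial i (\<phi>1 i) (\<lambda>x. (\<theta>2 (bracket x) * (2 * x $ i)) * (2 * x $ i) +
          \<theta>1 (bracket x) * (0 * x $ i + 2 * (if i = i then 1 else 0)))"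
        unfolding \<phi>1_def[abs_def]
        by (intro has_partial_mult has_partial_chain has_partial_bracket d2 bracket_pos has_partial_const has_partial_coord)
      then show ?thesis by (simp add: \<phi>2_def[abs_def])
    qed
    have cc: "continuous_on UNIV (\<lambda>x::real^3. c (bracket x))"
      unfolding c_def using \<open>1 \<le> N\<close> by (intro continuous_intros) auto
    have cp: "continuous_on UNIV (\<lambda>x::real^3. bracket x powr s)" for s
      by (intro continuous_intros) (simp add: bracket_pos[THEN less_imp_neq, symmetric])
    have ct: "continuous_on UNIV (\<lambda>x::real^3. \<theta> (bracket x))" "continuous_on UNIV (\<lambda>x::real^3. \<theta>1 (bracket x))"
      "continuous_on UNIV (\<lambda>x::real^3. \<theta>2 (bracket x))"
      unfolding \<theta>_def \<theta>1_def \<theta>2_def by (intro cc cp continuous_on_diff continuous_on_mult continuous_on_power continuous_on_const)+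
    \<comment> \<open>The cutoff ends at J = N; since N >= 1, |x| > N implies |x|^2 > N, so the ball
      of radius N contains the support.\<close>
    have c0: "c (bracket x) = 0" if "N < norm x" for x :: "real^3"
    proof -
      have "N \<le> norm x * norm x" using that \<open>1 \<le> N\<close> mult_mono[of 1 "norm x" N "norm x"] by simp
      then have "1 \<le> bracket x / N" using \<open>1 \<le> N\<close> by (simp add: bracket_def power2_eq_square field_simps)
      then show ?thesis by (simp add: c_def)
    qed
    show "\<exists>\<phi> \<phi>1 \<phi>2.
    power_cutoff m M N \<phi> \<phi>1 \<phi>2"
      unfolding power_cutoff_def
    proof (rule exI[of _ \<phi>], rule exI[of _ \<phi>1], rule exI[of _ \<phi>2], intro conjI allI impI hp1 hp2)
      show "continuous_on UNIV \<phi>"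
        unfolding \<phi>_def[abs_def] by (rule ct)
      show "continuous_on UNIV (\<phi>1 i)" "continuous_on UNIV (\<phi>2 i)" for i
        unfolding \<phi>1_def[abs_def] \<phi>2_def[abs_def]
        by (intro ct continuous_on_add continuous_on_mult continuous_on_const continuous_on_component continuous_on_id)+
      fix x :: "real^3"
      note c' = c01[OF bracket_ge_1[of x]]
      show "0 \<le> \<phi> x" using c' by (simp add: \<phi>_def \<theta>_def)
      have "c (bracket x) ^ 3 \<le> 1" using c' by (intro power_le_one)
      then show "\<phi> x \<le> bracket x powr m"
        unfolding \<phi>_def \<theta>_def by (intro mult_right_le_one_le) (use c' in auto)
      show "bracket x powr m \<le> 8 * \<phi> x" if "bracket x \<le> N / 2"
      proof -
        have "1 / 2 \<le> c (bracket x)" using that \<open>1 \<le> N\<close> by (simp add: c_def field_simps)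
        then have "(1 / 2) ^ 3 \<le> c (bracket x) ^ 3" by (intro power_mono) auto
        then have "bracket x powr m * 1 \<le> bracket x powr m * (8 * c (bracket x) ^ 3)"
          by (intro mult_left_mono) (auto simp: power3_eq_cube)
        then show ?thesis by (simp add: \<phi>_def \<theta>_def)
      qed
      show "\<phi> x = 0" if "N < norm x"
        using c0[OF that] by (simp add: \<phi>_def \<theta>_def)
      show "\<phi>1 i x = 0" "\<phi>2 i x = 0" if "N < norm x" for i
        using c0[OF that] by (simp_all add: \<phi>1_def \<phi>2_def \<theta>1_def \<theta>2_def)
      show "\<bar>\<phi>1 i x\<bar> \<le> M * bracket x powr (m - 1/2)" for i
      proof -
        have "\<bar>\<theta>1 (bracket x)\<bar> * \<bar>2 * x $ i\<bar> \<le> (K1 * bracket x powr (m - 1)) * (2 * bracket x powr (1/2))"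
          using b1[OF bracket_ge_1, of x] component_le_norm_cart[of x i] norm_le_sqrt_bracket[of x] K
          by (intro mult_mono) auto
        also have "\<dots> = 2 * K1 * bracket x powr (m - 1 + 1/2)"
          by (simp only: powr_add mult_ac)
        also have "\<dots> \<le> M * bracket x powr (m - 1/2)"
          using K by (intro mult_mono) (auto simp: M_def)
        finally show ?thesis by (simp add: \<phi>1_def abs_mult)
      qed
      show "\<bar>\<Sum>i\<in>UNIV. \<phi>2 i x\<bar> \<le> M * bracket x powr (m - 1)"
      proof -
        have "(\<Sum>i\<in>UNIV. \<phi>2 i x) = 4 * \<theta>2 (bracket x) * (\<Sum>i\<in>UNIV. (x $ i)\<^sup>2) + 6 * \<theta>1 (bracket x)"
          by (simp add: \<phi>2_def sum.distrib sum_distrib_left power2_eq_square mult_ac)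
        also have "(\<Sum>i\<in>UNIV. (x $ i)\<^sup>2) = (norm x)\<^sup>2"
          unfolding power2_norm_eq_inner inner_vec_def by (simp add: power2_eq_square)
        finally have eq: "(\<Sum>i\<in>UNIV. \<phi>2 i x) = 4 * \<theta>2 (bracket x) * (norm x)\<^sup>2 + 6 * \<theta>1 (bracket x)" .
        have "\<bar>\<theta>2 (bracket x)\<bar> * (norm x)\<^sup>2 \<le> (K2 * bracket x powr (m - 2)) * bracket x powr 1"
          using b2[OF bracket_ge_1, of x] K bracket_pos[of x] by (intro mult_mono) (auto simp: bracket_def)
        also have "\<dots> = K2 * bracket x powr (m - 2 + 1)"
          by (simp only: powr_add mult_ac)
        finally have 2: "\<bar>\<theta>2 (bracket x)\<bar> * (norm x)\<^sup>2 \<le> K2 * bracket x powr (m - 1)" by simp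
        have "\<bar>\<Sum>i\<in>UNIV. \<phi>2 i x\<bar> \<le> 4 * (\<bar>\<theta>2 (bracket x)\<bar> * (norm x)\<^sup>2) + 6 * \<bar>\<theta>1 (bracket x)\<bar>"
          unfolding eq by (rule order_trans[OF abs_triangle_ineq]) (simp add: abs_mult)
        also have "\<dots> \<le> 4 * (K2 * bracket x powr (m - 1)) + 6 * (K1 * bracket x powr (m - 1))"
          using 2 b1[OF bracket_ge_1, of x] by linarith
        also have "\<dots> = (4 * K2 + 6 * K1) * bracket x powr (m - 1)" by (simp add: algebra_simps)
        also have "\<dots> \<le> M * bracket x powr (m - 1)"
          using K by (intro mult_right_mono) (auto simp: M_def)
        finally show ?thesis .
      qed
    qed
  qed
qed

text \<open>With curl exponent 5/6 and loss 1/120: 13/40 = 5/6 - 1/2 - 1/120 for v, 139/120 = 13/40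
  + 5/6 for the product g, and 13/20 = 139/120 - 1/2 - 1/120 for H.\<close>

locale decaying_head = head_equation +
  fixes A :: real
  assumes A_nonneg: "0 \<le> A"
    and H_decay: "\<And>x. \<bar>H x\<bar> \<le> A * bracket x powr (-13/20)"
    and v_decay: "\<And>i x. \<bar>v i x\<bar> \<le> A * bracket x powr (-13/40)"
    and g_decay: "\<And>i x. \<bar>g i x\<bar> \<le> A * bracket x powr (-139/120)"
begin

lemma H_tendsto_0: "(H \<longlongrightarrow> 0) at_infinity"
proof (rule Lim_null_comparison)
  show "\<forall>\<^sub>F x in at_infinity. norm (H x) \<le> A * bracket x powr (-13/20)"
    using H_decay by (intro always_eventually) simp
  have "filterlim (\<lambda>x::real^3. bracket x) at_top at_infinity"
    unfolding bracket_def
    by (intro filterlim_tendsto_add_at_top[OF tendsto_const] filterlim_pow_at_top filterlim_norm_at_top) simp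
  then have "((\<lambda>x::real^3. bracket x powr (-13/20)) \<longlongrightarrow> 0) at_infinity"
    by (rule tendsto_neg_powr[rotated]) simp
  then show "((\<lambda>x::real^3. A * bracket x powr (-13/20)) \<longlongrightarrow> 0) at_infinity"
    by (intro tendsto_mult_right_zero)
qed

lemma H_le_0: "H x \<le> 0"
  by (rule head_nonpos[OF H_tendsto_0])

text \<open>An energy estimate from \<open>divergence_form_identity\<close>. With the weight J^(3/4)
  the errors |g|^2, H g . grad \<phi> and H^2 times the Laplacian of \<phi> decay with exponents
  47/30, 187/120 and 31/20. All are at least 31/20 > 3/2, hence integrable uniformly in N.\<close>

lemma weighted_gradient_bound:
  "\<exists>B. \<forall>N\<ge>1. \<exists>\<phi>. continuous_on UNIV \<phi> \<and> (\<forall>x. 0 \<le> \<phi> x) \<and>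
    (\<forall>x. bracket x \<le> N / 2 \<longrightarrow> bracket x powr (3/4) \<le> 8 * \<phi> x) \<and>
    (\<forall>x. N < norm x \<longrightarrow> \<phi> x = 0) \<and> (LINT x|lborel. \<phi> x * grad_sq x) \<le> B"
proof -
  obtain M where M: "0 \<le> M" and cut: "\<And>N. 1 \<le> N \<Longrightarrow> \<exists>\<phi> \<phi>1 \<phi>2. power_cutoff (3/4) M N \<phi> \<phi>1 \<phi>2"
    using power_cutoff_exists[of "3/4"] by blast
  define J where "J x = bracket (x::real^3) powr (-31/20)" for x
  have intJ: "integrable lborel J"
    using integrable_bracket_powr[of "31/20", where 'a = "real^3"] by (simp add: J_def[abs_def])
  define W where "W = 3/2 * A\<^sup>2 + 3 * A\<^sup>2 * M + A\<^sup>2 * M / 2"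
  show ?thesis
  proof (intro exI[of _ "2 * (W * (LINT x|lborel. J x))"] allI impI)
    fix N :: real assume "1 \<le> N"
    from cut[OF this] obtain \<phi> \<phi>1 \<phi>2 where pc: "power_cutoff (3/4) M N \<phi> \<phi>1 \<phi>2" by blast
    note \<phi> = power_cutoffD(1,2)[OF pc] and c\<phi> = power_cutoffD(3,4,5)[OF pc]
      and bd = power_cutoffD(6,7,8)[OF pc] and supp = power_cutoffD(9)[OF pc]
      and b1 = power_cutoffD(10)[OF pc] and b2 = power_cutoffD(11)[OF pc]
    define E where "E x = \<phi> x * grad_sq x - \<phi> x * (\<Sum>i\<in>UNIV. partial_derivative i H x * g i x)
      - H x * (\<Sum>i\<in>UNIV. g i x * \<phi>1 i x) - (H x)\<^sup>2 / 2 * (\<Sum>i\<in>UNIV. \<phi>2 i x)" for x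
    have "(LINT x|lborel. E x) = 0"
      unfolding E_def by (rule divergence_form_identity[OF \<phi> c\<phi> supp])
    have intE: "integrable lborel E"
    proof (rule bounded_support_integrable[of _ N])
      show "continuous_on UNIV E"
        unfolding E_def[abs_def]
        by (intro continuous_on_diff continuous_on_mult continuous_on_sum continuous_on_divide continuous_on_power
            continuous_on_const c\<phi> continuous_grad_sq continuous_dH continuous_g continuous_H) auto
    qed (use supp in \<open>simp add: E_def\<close>)
    have int\<phi>: "integrable lborel (\<lambda>x. \<phi> x * grad_sq x)"
      by (rule bounded_support_integrable[of _ N])
        (use supp in \<open>auto intro!: continuous_on_mult c\<phi> continuous_grad_sq\<close>)
    \<comment> \<open>Half of the gradient term is given up to Young's inequality for grad H . g;
      the other half survives.\<close>
    have pt: "\<phi> x * grad_sq x / 2 \<le> E x + W * J x" for x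
    proof -
      let ?b = "bracket x"
      have 1: "\<phi> x * (\<Sum>i\<in>UNIV. partial_derivative i H x * g i x) \<le> \<phi> x * grad_sq x / 2 + 3/2 * A\<^sup>2 * J x"
      proof -
        have "(\<Sum>i\<in>UNIV. partial_derivative i H x * g i x) \<le>
            (\<Sum>i\<in>(UNIV::3 set). (partial_derivative i H x)\<^sup>2 / 2 + A\<^sup>2 * ?b powr (-139/60) / 2)"
        proof (rule sum_mono)
          fix i :: 3
          have "(g i x)\<^sup>2 \<le> (A * ?b powr (-139/120))\<^sup>2"
            using power_mono[OF g_decay[of i x] abs_ge_zero, of 2] by simp
          also have "\<dots> = A\<^sup>2 * ?b powr (-139/60)"
            by (simp add: power_mult_distrib power2_eq_square flip: powr_add)
          finally have "(g i x)\<^sup>2 \<le> A\<^sup>2 * ?b powr (-139/60)" .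
          moreover have "partial_derivative i H x * g i x \<le> (partial_derivative i H x)\<^sup>2 / 2 + (g i x)\<^sup>2 / 2"
            using sum_squares_bound[of "partial_derivative i H x" "g i x"] by simp
          ultimately show "partial_derivative i H x * g i x \<le>
              (partial_derivative i H x)\<^sup>2 / 2 + A\<^sup>2 * ?b powr (-139/60) / 2" by linarith
        qed
        also have "\<dots> = grad_sq x / 2 + 3/2 * A\<^sup>2 * ?b powr (-139/60)"
          by (simp add: sum.distrib grad_sq_def sum_divide_distrib)
        finally have "\<phi> x * (\<Sum>i\<in>UNIV. partial_derivative i H x * g i x) \<le>
            \<phi> x * (grad_sq x / 2 + 3/2 * A\<^sup>2 * ?b powr (-139/60))"
          using bd(1) by (rule mult_left_mono)
        also have "\<dots> = \<phi> x * grad_sq x / 2 + 3/2 * A\<^sup>2 * (\<phi> x * ?b powr (-139/60))"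
          by (simp add: algebra_simps)
        finally have le: "\<phi> x * (\<Sum>i\<in>UNIV. partial_derivative i H x * g i x) \<le>
            \<phi> x * grad_sq x / 2 + 3/2 * A\<^sup>2 * (\<phi> x * ?b powr (-139/60))" .
        have "\<phi> x * ?b powr (-139/60) \<le> ?b powr (3/4) * ?b powr (-139/60)"
          using bd(2) by (rule mult_right_mono) simp
        also have "\<dots> \<le> J x"
          unfolding powr_add[symmetric] J_def by (rule bracket_powr_mono) simp
        finally have "3/2 * A\<^sup>2 * (\<phi> x * ?b powr (-139/60)) \<le> 3/2 * A\<^sup>2 * J x"
          by (rule mult_left_mono) simp
        with le show ?thesis by linarith
      qed
      have 2: "H x * (\<Sum>i\<in>UNIV. g i x * \<phi>1 i x) \<le> 3 * A\<^sup>2 * M * J x"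
      proof -
        have "\<bar>\<Sum>i\<in>UNIV. g i x * \<phi>1 i x\<bar> \<le>
            (\<Sum>i\<in>(UNIV::3 set). (A * ?b powr (-139/120)) * (M * ?b powr (3/4 - 1/2)))"
          by (rule order_trans[OF sum_abs sum_mono])
            (unfold abs_mult, intro mult_mono g_decay b1 mult_nonneg_nonneg A_nonneg, auto)
        then have "\<bar>H x\<bar> * \<bar>\<Sum>i\<in>UNIV. g i x * \<phi>1 i x\<bar> \<le>
            (A * ?b powr (-13/20)) * (3 * ((A * ?b powr (-139/120)) * (M * ?b powr (3/4 - 1/2))))"
          by (intro mult_mono H_decay) (auto simp: A_nonneg)
        also have "\<dots> = 3 * A\<^sup>2 * M * ?b powr (-13/20 + -139/120 + (3/4 - 1/2))"
          by (simp only: powr_add power2_eq_square mult_ac)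
        also have "\<dots> \<le> 3 * A\<^sup>2 * M * J x"
          unfolding J_def using M by (intro mult_left_mono bracket_powr_mono) auto
        finally show ?thesis unfolding abs_mult[symmetric] by linarith
      qed
      have 3: "(H x)\<^sup>2 / 2 * (\<Sum>i\<in>UNIV. \<phi>2 i x) \<le> A\<^sup>2 * M / 2 * J x"
      proof -
        have "(H x)\<^sup>2 \<le> (A * ?b powr (-13/20))\<^sup>2"
          using power_mono[OF H_decay[of x] abs_ge_zero, of 2] by simp
        then have "(H x)\<^sup>2 * \<bar>\<Sum>i\<in>UNIV. \<phi>2 i x\<bar> \<le> (A * ?b powr (-13/20))\<^sup>2 * (M * ?b powr (3/4 - 1))"
          by (intro mult_mono b2) auto
        also have "\<dots> = A\<^sup>2 * M * ?b powr (-13/20 + -13/20 + (3/4 - 1))"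
          by (simp only: powr_add power2_eq_square mult_ac)
        also have "\<dots> \<le> A\<^sup>2 * M * J x"
          unfolding J_def using M by (intro mult_left_mono bracket_powr_mono) auto
        finally have "(H x)\<^sup>2 * \<bar>\<Sum>i\<in>UNIV. \<phi>2 i x\<bar> \<le> A\<^sup>2 * M * J x" .
        moreover have "(H x)\<^sup>2 * (\<Sum>i\<in>UNIV. \<phi>2 i x) \<le> (H x)\<^sup>2 * \<bar>\<Sum>i\<in>UNIV. \<phi>2 i x\<bar>"
          by (intro mult_left_mono) auto
        ultimately show ?thesis by simp
      qed
      have "W * J x = 3/2 * A\<^sup>2 * J x + 3 * A\<^sup>2 * M * J x + A\<^sup>2 * M / 2 * J x"
        by (simp add: W_def algebra_simps)
      with 1 2 3 show ?thesis unfolding E_def by linarith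
    qed
    have "(LINT x|lborel. \<phi> x * grad_sq x / 2) \<le> (LINT x|lborel. E x + W * J x)"
      using int\<phi> intE intJ pt by (intro integral_mono) auto
    also have "\<dots> = W * (LINT x|lborel. J x)"
      using intE intJ \<open>(LINT x|lborel. E x) = 0\<close> by simp
    finally have le: "(LINT x|lborel. \<phi> x * grad_sq x) \<le> 2 * (W * (LINT x|lborel. J x))" by simp
    show "\<exists>\<phi>. continuous_on UNIV \<phi> \<and> (\<forall>x. 0 \<le> \<phi> x) \<and>
      (\<forall>x. bracket x \<le> N / 2 \<longrightarrow> bracket x powr (3/4) \<le> 8 * \<phi> x) \<and>
      (\<forall>x. N < norm x \<longrightarrow> \<phi> x = 0) \<and> (LINT x|lborel. \<phi> x * grad_sq x) \<le> 2 * (W * (LINT x|lborel. J x))"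
      using c\<phi>(1) bd supp le by (intro exI[of _ \<phi>]) auto
  qed
qed

text \<open>The renormalization by a square root produces Q^(-3/2) |grad Q|^2 with a good sign next
  to a nonnegative multiple of Om. The error is F(H), of exponent 13/40, times transport and
  Laplacian of the weight, of exponent 237/200 together; the sum 151/100 exceeds 3/2. The shift
  \<kappa> > 0 keeps F smooth where H = 0, and the bound is uniform in it.\<close>

lemma singular_gradient_bound:
  "\<exists>B. \<forall>N\<ge>1. \<exists>\<phi>. continuous_on UNIV \<phi> \<and> (\<forall>x. 0 \<le> \<phi> x) \<and>
    (\<forall>x. bracket x \<le> N / 2 \<longrightarrow> bracket x powr (-9/25) \<le> 8 * \<phi> x) \<and>
    (\<forall>x. N < norm x \<longrightarrow> \<phi> x = 0) \<and>
    (\<forall>\<kappa>>0. (LINT x|lborel. \<phi> x * (\<kappa> - H x) powr (-3/2) * grad_sq x) \<le> B)"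
proof -
  obtain M where M: "0 \<le> M" and cut: "\<And>N. 1 \<le> N \<Longrightarrow> \<exists>\<phi> \<phi>1 \<phi>2. power_cutoff (-9/25) M N \<phi> \<phi>1 \<phi>2"
    using power_cutoff_exists[of "-9/25"] by blast
  define J where "J x = bracket (x::real^3) powr (-151/100)" for x
  have intJ: "integrable lborel J"
    using integrable_bracket_powr[of "151/100", where 'a = "real^3"] by (simp add: J_def[abs_def])
  define W where "W = sqrt A * (M + 3 * A * M)"
  show ?thesis
  proof (intro exI[of _ "4 * (W * (LINT x|lborel. J x))"] allI impI)
    fix N :: real assume "1 \<le> N"
    from cut[OF this] obtain \<phi> \<phi>1 \<phi>2 where pc: "power_cutoff (-9/25) M N \<phi> \<phi>1 \<phi>2" by blast
    note \<phi> = power_cutoffD(1,2)[OF pc] and c\<phi> = power_cutoffD(3,4,5)[OF pc]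
      and bd = power_cutoffD(6,7,8)[OF pc] and supp = power_cutoffD(9)[OF pc]
      and b1 = power_cutoffD(10)[OF pc] and b2 = power_cutoffD(11)[OF pc]
    have bound: "(LINT x|lborel. \<phi> x * (\<kappa> - H x) powr (-3/2) * grad_sq x) \<le> 4 * (W * (LINT x|lborel. J x))"
      if "0 < \<kappa>" for \<kappa>
    proof -
      have pos: "0 < \<kappa> - H x" for x using that H_le_0[of x] by simp
      \<comment> \<open>The additive constant gives F(0) = 0. By subadditivity of the square root,
        |F(H)| <= sqrt (- H) then holds for every \<kappa>.\<close>
      let ?F = "\<lambda>t. \<kappa> powr (1/2) - (\<kappa> - t) powr (1/2)"
      let ?F1 = "\<lambda>t. 1/2 * (\<kappa> - t) powr (-1/2)" and ?F2 = "\<lambda>t. 1/4 * (\<kappa> - t) powr (-3/2)"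
      have cpw: "continuous_on UNIV (\<lambda>x. (\<kappa> - H x) powr s)" for s
        by (intro continuous_on_powr continuous_on_diff continuous_on_const continuous_H)
          (use pos in \<open>force simp: less_le\<close>)
      define E where "E x = \<phi> x * ?F2 (H x) * grad_sq x + \<phi> x * ?F1 (H x) * Om x -
        ?F (H x) * ((\<Sum>i\<in>UNIV. \<phi>2 i x) + (\<Sum>i\<in>UNIV. v i x * \<phi>1 i x))" for x
      have E0: "(LINT x|lborel. E x) = 0"
        unfolding E_def
      proof (rule renormalized_identity[where F = ?F and F' = ?F1 and F'' = ?F2, OF _ _ _ \<phi> c\<phi>])
        show "(?F has_real_derivative ?F1 (H x)) (at (H x))" for x
          using pos[of x] by (auto intro!: derivative_eq_intros)
        show "(?F1 has_real_derivative ?F2 (H x)) (at (H x))" for x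
          using pos[of x] by (auto intro!: derivative_eq_intros)
        show "continuous_on UNIV (\<lambda>x. ?F2 (H x))"
          by (intro continuous_on_mult continuous_on_const cpw)
      qed (use supp in blast)
      have intE: "integrable lborel E"
      proof (rule bounded_support_integrable[of _ N])
        show "continuous_on UNIV E"
          unfolding E_def[abs_def]
          by (intro continuous_on_diff continuous_on_add continuous_on_mult continuous_on_sum
              continuous_on_const cpw c\<phi> continuous_grad_sq continuous_Om continuous_v)
      qed (use supp in \<open>simp add: E_def\<close>)
      have int\<phi>: "integrable lborel (\<lambda>x. \<phi> x * ?F2 (H x) * grad_sq x)"
      proof (rule bounded_support_integrable[of _ N])
        show "continuous_on UNIV (\<lambda>x. \<phi> x * ?F2 (H x) * grad_sq x)"
          by (intro continuous_on_mult continuous_on_const cpw c\<phi> continuous_grad_sq)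
      qed (use supp in simp)
      have pt: "\<phi> x * ?F2 (H x) * grad_sq x \<le> E x + W * J x" for x
      proof -
        let ?b = "bracket x"
        have 1: "\<bar>?F (H x)\<bar> \<le> sqrt A * ?b powr (-13/40)"
        proof -
          have "sqrt (\<kappa> - H x) \<le> sqrt \<kappa> + sqrt (- H x)"
            using sqrt_add_le_add_sqrt[of \<kappa> "- H x"] that H_le_0[of x] by simp
          moreover have "sqrt \<kappa> \<le> sqrt (\<kappa> - H x)" using H_le_0[of x] by simp
          moreover have "sqrt (- H x) \<le> sqrt (A * ?b powr (-13/20))"
            using H_decay[of x] H_le_0[of x] by (intro real_sqrt_le_mono) linarith
          moreover have "sqrt (A * ?b powr (-13/20)) = sqrt A * ?b powr (-13/40)"
            by (simp add: real_sqrt_mult powr_half_sqrt[symmetric] powr_powr)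
          ultimately have "\<bar>sqrt \<kappa> - sqrt (\<kappa> - H x)\<bar> \<le> sqrt A * ?b powr (-13/40)"
            by linarith
          then show ?thesis
            using that pos[of x] by (simp add: powr_half_sqrt)
        qed
        have 2: "\<bar>(\<Sum>i\<in>UNIV. \<phi>2 i x) + (\<Sum>i\<in>UNIV. v i x * \<phi>1 i x)\<bar> \<le> (M + 3 * A * M) * ?b powr (-237/200)"
        proof -
          have "\<bar>\<Sum>i\<in>UNIV. v i x * \<phi>1 i x\<bar> \<le>
              (\<Sum>i\<in>(UNIV::3 set). (A * ?b powr (-13/40)) * (M * ?b powr (-9/25 - 1/2)))"
            by (rule order_trans[OF sum_abs sum_mono])
              (unfold abs_mult, intro mult_mono v_decay b1 mult_nonneg_nonneg A_nonneg, auto)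
          also have "\<dots> = 3 * A * M * ?b powr (-13/40 + (-9/25 - 1/2))"
            unfolding powr_add by simp
          also have "-13/40 + (-9/25 - 1/2) = (-237/200 :: real)" by simp
          finally have "\<bar>\<Sum>i\<in>UNIV. v i x * \<phi>1 i x\<bar> \<le> 3 * A * M * ?b powr (-237/200)" .
          moreover have "\<bar>\<Sum>i\<in>UNIV. \<phi>2 i x\<bar> \<le> M * ?b powr (-237/200)"
            by (rule order_trans[OF b2]) (intro mult_left_mono bracket_powr_mono M, simp)
          ultimately show ?thesis by (simp add: algebra_simps abs_le_iff)
        qed
        have "\<bar>?F (H x)\<bar> * \<bar>(\<Sum>i\<in>UNIV. \<phi>2 i x) + (\<Sum>i\<in>UNIV. v i x * \<phi>1 i x)\<bar> \<le>
            (sqrt A * ?b powr (-13/40)) * ((M + 3 * A * M) * ?b powr (-237/200))"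
          using 1 2 A_nonneg M by (intro mult_mono) auto
        also have "\<dots> = W * ?b powr (-13/40 + -237/200)"
          by (simp only: powr_add W_def mult_ac)
        also have "?b powr (-13/40 + -237/200) = J x" by (simp add: J_def)
        finally have "?F (H x) * ((\<Sum>i\<in>UNIV. \<phi>2 i x) + (\<Sum>i\<in>UNIV. v i x * \<phi>1 i x)) \<le> W * J x"
          unfolding abs_mult[symmetric] by linarith
        moreover have "0 \<le> \<phi> x * ?F1 (H x) * Om x"
          by (intro mult_nonneg_nonneg bd Om_nonneg) simp_all
        ultimately show ?thesis unfolding E_def by linarith
      qed
      have "(LINT x|lborel. \<phi> x * ?F2 (H x) * grad_sq x) \<le> (LINT x|lborel. E x + W * J x)"
        using int\<phi> intE intJ pt by (intro integral_mono) auto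
      also have "\<dots> = W * (LINT x|lborel. J x)"
        using intE intJ E0 by simp
      also have "(LINT x|lborel. \<phi> x * ?F2 (H x) * grad_sq x) =
          (LINT x|lborel. 1/4 * (\<phi> x * (\<kappa> - H x) powr (-3/2) * grad_sq x))"
        by (intro Bochner_Integration.integral_cong) auto
      finally show ?thesis by simp
    qed
    show "\<exists>\<phi>. continuous_on UNIV \<phi> \<and> (\<forall>x. 0 \<le> \<phi> x) \<and>
      (\<forall>x. bracket x \<le> N / 2 \<longrightarrow> bracket x powr (-9/25) \<le> 8 * \<phi> x) \<and>
      (\<forall>x. N < norm x \<longrightarrow> \<phi> x = 0) \<and>
      (\<forall>\<kappa>>0. (LINT x|lborel. \<phi> x * (\<kappa> - H x) powr (-3/2) * grad_sq x) \<le> 4 * (W * (LINT x|lborel. J x)))"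
      using c\<phi>(1) bd supp bound by (intro exI[of _ \<phi>]) auto
  qed
qed

end

section \<open>Vanishing of the vorticity\<close>

text \<open>A C^2 replacement of the positive part of q - \<epsilon>. It vanishes for q <=
  \<epsilon>, including q = 0, where the quotient has its default value. In terms of u = (q -
  \<epsilon>)/q the first derivative, for q > \<epsilon>, is the smoothstep polynomial 3 u^2 - 2
  u^3.\<close>

definition trunc :: "real \<Rightarrow> real \<Rightarrow> real" where
  "trunc \<epsilon> q = max 0 (q - \<epsilon>) ^ 3 / q\<^sup>2"

definition trunc' :: "real \<Rightarrow> real \<Rightarrow> real" where
  "trunc' \<epsilon> q = 3 * max 0 (q - \<epsilon>) ^ 2 / q\<^sup>2 - 2 * max 0 (q - \<epsilon>) ^ 3 / q ^ 3"

text \<open>With m = max 0 (q - \<epsilon>), differentiating \<open>trunc'\<close> and collecting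
  terms gives 6 m (q - m)^2 / q^4 without a case distinction. For q > \<epsilon> the square is
  \<epsilon>^2.\<close>

definition trunc'' :: "real \<Rightarrow> real \<Rightarrow> real" where
  "trunc'' \<epsilon> q = 6 * max 0 (q - \<epsilon>) * (q - max 0 (q - \<epsilon>))\<^sup>2 / q ^ 4"

lemma trunc_eq_0: "q \<le> \<epsilon> \<Longrightarrow> trunc \<epsilon> q = 0 \<and> trunc' \<epsilon> q = 0 \<and> trunc'' \<epsilon> q = 0"
  by (simp add: trunc_def trunc'_def trunc''_def max_absorb1)

lemma DERIV_trunc:
  assumes "0 < \<epsilon>"
  shows "(trunc \<epsilon> has_real_derivative trunc' \<epsilon> q) (at q)"
    and "(trunc' \<epsilon> has_real_derivative trunc'' \<epsilon> q) (at q)"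
proof -
  let ?m = "\<lambda>q. max 0 (q - \<epsilon>)"
  have "(trunc \<epsilon> has_real_derivative trunc' \<epsilon> q) (at q) \<and> (trunc' \<epsilon> has_real_derivative trunc'' \<epsilon> q) (at q)"
  proof (cases "q < \<epsilon>")
    case True
    then have ev: "\<forall>\<^sub>F s in nhds q. s < \<epsilon>"
      by (intro eventually_nhds_in_open[of "{..<\<epsilon>}", THEN eventually_mono]) auto
    have zero: "(f has_real_derivative 0) (at q)" if "\<And>s. s < \<epsilon> \<Longrightarrow> f s = 0" for f :: "real \<Rightarrow> real"
    proof -
      have "\<forall>\<^sub>F s in nhds q. f s = 0"
        using ev by eventually_elim (rule that)
      then have "(f has_real_derivative 0) (at q) \<longleftrightarrow> ((\<lambda>s. 0) has_real_derivative 0) (at q)"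
        by (intro DERIV_cong_ev refl)
      then show ?thesis by simp
    qed
    have "(trunc \<epsilon> has_real_derivative 0) (at q)" "(trunc' \<epsilon> has_real_derivative 0) (at q)"
      by (rule zero, simp add: trunc_eq_0)+
    then show ?thesis using trunc_eq_0[of q \<epsilon>] True by simp
  next
    case False
    then have "0 < q" using assms by simp
    have der: "((\<lambda>t. ?m t ^ (n + 2)) has_real_derivative real (n + 2) * ?m q ^ (n + 1)) (at q)" for n
      using DERIV_pos_part_power[of n "q + - \<epsilon>"] DERIV_shift[of "\<lambda>t. max 0 t ^ (n + 2)" _ q "- \<epsilon>"]
      by simp
    have m3: "((\<lambda>t. ?m t ^ 3) has_real_derivative 3 * ?m q ^ 2) (at q)"
      using der[of 1] by (simp add: numeral_eq_Suc)
    have m2: "((\<lambda>t. ?m t ^ 2) has_real_derivative 2 * ?m q) (at q)"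
      using der[of 0] by (simp add: numeral_eq_Suc)
    have p: "((\<lambda>t. t ^ n) has_real_derivative real n * q ^ (n - 1)) (at q)" for n
      using DERIV_pow[of n q] by simp
    have "((\<lambda>t. ?m t ^ 3 / t ^ 2) has_real_derivative
        (3 * ?m q ^ 2 * q ^ 2 - ?m q ^ 3 * (real 2 * q ^ (2 - 1))) / (q ^ 2 * q ^ 2)) (at q)"
      using \<open>0 < q\<close> by (intro DERIV_divide m3 p) simp
    moreover have "(3 * ?m q ^ 2 * q ^ 2 - ?m q ^ 3 * (real 2 * q ^ (2 - 1))) / (q ^ 2 * q ^ 2) = trunc' \<epsilon> q"
      using \<open>0 < q\<close> by (simp add: trunc'_def field_simps power2_eq_square power3_eq_cube)
    moreover have "((\<lambda>t. 3 * ?m t ^ 2 / t ^ 2 - 2 * ?m t ^ 3 / t ^ 3) has_real_derivative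
        ((3 * (2 * ?m q)) * q ^ 2 - (3 * ?m q ^ 2) * (real 2 * q ^ (2 - 1))) / (q ^ 2 * q ^ 2) -
        ((2 * (3 * ?m q ^ 2)) * q ^ 3 - (2 * ?m q ^ 3) * (real 3 * q ^ (3 - 1))) / (q ^ 3 * q ^ 3)) (at q)"
      using \<open>0 < q\<close> by (intro DERIV_diff DERIV_divide DERIV_cmult m2 m3 p) simp_all
    moreover have "((3 * (2 * ?m q)) * q ^ 2 - (3 * ?m q ^ 2) * (real 2 * q ^ (2 - 1))) / (q ^ 2 * q ^ 2) -
        ((2 * (3 * ?m q ^ 2)) * q ^ 3 - (2 * ?m q ^ 3) * (real 3 * q ^ (3 - 1))) / (q ^ 3 * q ^ 3) = trunc'' \<epsilon> q"
      using \<open>0 < q\<close> by (simp add: trunc''_def divide_simps) (simp add: algebra_simps eval_nat_numeral)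
    ultimately show ?thesis by (simp add: trunc_def[abs_def] trunc'_def[abs_def])
  qed
  then show "(trunc \<epsilon> has_real_derivative trunc' \<epsilon> q) (at q)"
    "(trunc' \<epsilon> has_real_derivative trunc'' \<epsilon> q) (at q)" by auto
qed

lemma continuous_on_trunc'':
  assumes "0 < \<epsilon>"
  shows "continuous_on UNIV (trunc'' \<epsilon>)"
proof -
  \<comment> \<open>The numerator vanishes for q <= \<epsilon>, so the denominator can be changed
    there to one without zeros.\<close>
  have "trunc'' \<epsilon> = (\<lambda>q. 6 * max 0 (q - \<epsilon>) * (q - max 0 (q - \<epsilon>))\<^sup>2 / max \<epsilon> q ^ 4)"
    by (auto simp: trunc''_def fun_eq_iff max_def)
  moreover have "continuous_on UNIV (\<lambda>q. 6 * max 0 (q - \<epsilon>) * (q - max 0 (q - \<epsilon>))\<^sup>2 / max \<epsilon> q ^ 4)"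
    using assms by (intro continuous_intros) (auto simp: max_def)
  ultimately show ?thesis by simp
qed

lemma trunc''_bounds:
  assumes "0 < \<epsilon>" "\<epsilon> < q"
  shows "0 \<le> trunc'' \<epsilon> q" and "trunc'' \<epsilon> q \<le> 6 * (\<epsilon>\<^sup>2 / q ^ 3)"
proof -
  have eq: "trunc'' \<epsilon> q = 6 * (\<epsilon>\<^sup>2 / q ^ 3) * ((q - \<epsilon>) / q)"
    using assms by (simp add: trunc''_def divide_simps eval_nat_numeral)
  have "0 \<le> (q - \<epsilon>) / q" "(q - \<epsilon>) / q \<le> 1" "0 \<le> 6 * (\<epsilon>\<^sup>2 / q ^ 3)"
    using assms by simp_all
  note * = this
  show "0 \<le> trunc'' \<epsilon> q"
    unfolding eq using mult_nonneg_nonneg[OF *(3,1)] .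
  show "trunc'' \<epsilon> q \<le> 6 * (\<epsilon>\<^sup>2 / q ^ 3)"
    unfolding eq using * by (intro mult_right_le_one_le)
qed

lemma trunc'_ge:
  assumes "0 < \<epsilon>"
  shows "0 \<le> trunc' \<epsilon> q" and "2 * \<epsilon> \<le> q \<Longrightarrow> 1/4 \<le> trunc' \<epsilon> q"
proof -
  have pos: "trunc' \<epsilon> q = u\<^sup>2 * (3 - 2 * u)" "0 \<le> u" "u \<le> 1"
    if "\<epsilon> < q" "u = (q - \<epsilon>) / q" for u
  proof -
    have "trunc' \<epsilon> q = 3 * u\<^sup>2 - 2 * u ^ 3"
      using that by (simp add: trunc'_def power_divide)
    then show "trunc' \<epsilon> q = u\<^sup>2 * (3 - 2 * u)"
      by (simp add: algebra_simps power2_eq_square power3_eq_cube)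
    show "0 \<le> u" "u \<le> 1" using assms that by simp_all
  qed
  show "0 \<le> trunc' \<epsilon> q"
  proof (cases "\<epsilon> < q")
    case True
    show ?thesis
      unfolding pos(1)[OF True refl]
      by (intro mult_nonneg_nonneg) (use pos(3)[OF True refl] in linarith | simp)+
  qed (simp add: trunc_eq_0)
  show "1/4 \<le> trunc' \<epsilon> q" if "2 * \<epsilon> \<le> q"
  proof -
    define u where "u = (q - \<epsilon>) / q"
    have "\<epsilon> < q" "1 / 2 \<le> u" using that assms by (simp_all add: u_def field_simps)
    note u = pos[OF \<open>\<epsilon> < q\<close> u_def]
    have "(1/2)\<^sup>2 * 1 \<le> u\<^sup>2 * (3 - 2 * u)"
      using u \<open>1/2 \<le> u\<close> by (intro mult_mono power_mono) auto
    then show ?thesis using u by (simp add: power2_eq_square)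
  qed
qed

text \<open>Interpolates between the two gradient bounds; the gain \<^term>\<open>\<epsilon> powr (1/100)\<close> is what
  makes the energy flux vanish in the limit.\<close>

lemma interpolation_bound:
  fixes \<epsilon> q J :: real
  assumes "0 < \<epsilon>" "\<epsilon> \<le> 1" "\<epsilon> < q" "1 \<le> J"
  shows "\<epsilon>\<^sup>2 / q ^ 3 \<le> \<epsilon> powr (1/100) * (J powr (3/4) + J powr (-9/25) * q powr (-3/2))"
proof (cases "1 \<le> q")
  case True
  have "\<epsilon>\<^sup>2 / q ^ 3 \<le> \<epsilon>\<^sup>2 / 1"
    using True assms by (intro divide_left_mono) (auto simp: one_le_power)
  also have "\<dots> = \<epsilon> powr 2" using assms by (simp add: powr_numeral)
  also have "\<dots> \<le> \<epsilon> powr (1/100)" using assms by (intro powr_mono') auto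
  also have "\<dots> = \<epsilon> powr (1/100) * 1" by simp
  also have "\<dots> \<le> \<epsilon> powr (1/100) * (J powr (3/4) + J powr (-9/25) * q powr (-3/2))"
    using assms by (intro mult_left_mono add_increasing2 ge_one_powr_ge_zero) auto
  finally show ?thesis .
next
  case False
  have "0 < q" "q < 1" using False assms by auto
  have "\<epsilon>\<^sup>2 / q ^ 3 = \<epsilon> powr 2 * q powr (-3)"
    using assms \<open>0 < q\<close> by (simp add: powr_numeral powr_minus divide_inverse)
  \<comment> \<open>All but 1/100 of the power of \<epsilon> is spent on \<epsilon> < q, which
    leaves q^(-101/100) to be bounded.\<close>
  also have "\<dots> = \<epsilon> powr (1/100) * \<epsilon> powr (199/100) * q powr (-3)"
    by (simp flip: powr_add)
  also have "\<dots> \<le> \<epsilon> powr (1/100) * q powr (199/100) * q powr (-3)"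
    using assms by (intro mult_right_mono mult_left_mono powr_mono2) auto
  also have "\<dots> = \<epsilon> powr (1/100) * q powr (-101/100)"
    by (simp add: mult.assoc flip: powr_add)
  finally have 1: "\<epsilon>\<^sup>2 / q ^ 3 \<le> \<epsilon> powr (1/100) * q powr (-101/100)" .
  have "q powr (-101/100) \<le> J powr (3/4) + J powr (-9/25) * q powr (-3/2)"
  proof (cases "q powr (-101/100) \<le> J powr (3/4)")
    case True
    then show ?thesis by (intro add_increasing2) auto
  next
    \<comment> \<open>Here J is at most q^(-101/75), hence J^(-9/25) is at least q^(303/625). As
      303/625 - 3/2 < -101/100 and q < 1, the singular term dominates.\<close>
    case False
    then have "(J powr (3/4)) powr (4/3) \<le> (q powr (-101/100)) powr (4/3)"
      by (intro powr_mono2) auto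
    then have "J \<le> q powr (-101/75)"
      using assms by (simp add: powr_powr)
    then have "(q powr (-101/75)) powr (-9/25) \<le> J powr (-9/25)"
      using assms by (intro powr_mono2') auto
    then have "q powr (303/625) * q powr (-3/2) \<le> J powr (-9/25) * q powr (-3/2)"
      by (intro mult_right_mono) (auto simp: powr_powr)
    moreover have "q powr (-101/100) \<le> q powr (303/625) * q powr (-3/2)"
      using \<open>0 < q\<close> \<open>q < 1\<close> unfolding powr_add[symmetric] by (intro powr_mono') auto
    ultimately show ?thesis by (intro add_increasing) auto
  qed
  then have "\<epsilon> powr (1/100) * q powr (-101/100) \<le>
      \<epsilon> powr (1/100) * (J powr (3/4) + J powr (-9/25) * q powr (-3/2))"
    by (intro mult_left_mono) auto
  with 1 show ?thesis by linarith
qed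

section \<open>Letting the truncation level tend to zero\<close>

context decaying_head
begin

lemma bracket_le_of_less:
  assumes "0 < \<epsilon>" "\<epsilon> < - H x"
  shows "bracket x \<le> (A / \<epsilon>) powr (20/13)"
proof -
  have "\<epsilon> < A * bracket x powr (-13/20)" using assms H_decay[of x] by linarith
  then have "bracket x powr (13/20) \<le> A / \<epsilon>"
    using assms bracket_pos[of x] by (simp add: powr_minus field_simps)
  then have "(bracket x powr (13/20)) powr (20/13) \<le> (A / \<epsilon>) powr (20/13)"
    by (intro powr_mono2) auto
  then show ?thesis using bracket_pos[of x] by (simp add: powr_powr)
qed

lemma Om_integral_bound:
  "\<exists>C. \<forall>\<epsilon>. 0 < \<epsilon> \<longrightarrow> \<epsilon> \<le> 1 \<longrightarrow> (LINT x|lborel. trunc' \<epsilon> (- H x) * Om x) \<le> C * \<epsilon> powr (1/100)"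
proof -
  obtain Ba where Ba: "\<And>N. 1 \<le> N \<Longrightarrow> \<exists>\<phi>. continuous_on UNIV \<phi> \<and> (\<forall>x. 0 \<le> \<phi> x) \<and>
    (\<forall>x. bracket x \<le> N / 2 \<longrightarrow> bracket x powr (3/4) \<le> 8 * \<phi> x) \<and>
    (\<forall>x. N < norm x \<longrightarrow> \<phi> x = 0) \<and> (LINT x|lborel. \<phi> x * grad_sq x) \<le> Ba"
    using weighted_gradient_bound by blast
  obtain Bb where Bb: "\<And>N. 1 \<le> N \<Longrightarrow> \<exists>\<phi>. continuous_on UNIV \<phi> \<and> (\<forall>x. 0 \<le> \<phi> x) \<and>
    (\<forall>x. bracket x \<le> N / 2 \<longrightarrow> bracket x powr (-9/25) \<le> 8 * \<phi> x) \<and>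
    (\<forall>x. N < norm x \<longrightarrow> \<phi> x = 0) \<and>
    (\<forall>\<kappa>>0. (LINT x|lborel. \<phi> x * (\<kappa> - H x) powr (-3/2) * grad_sq x) \<le> Bb)"
    using singular_gradient_bound by blast
  show ?thesis
  \<comment> \<open>48 = 6 * 8 and 192 = 6 * 8 * 4: 6 comes from \<open>trunc''_bounds\<close>, 8
    from the lower bounds of the cutoff weights, 4 from \<open>sq\<close>.\<close>
  proof (intro exI[of _ "48 * Ba + 192 * Bb"] allI impI)
    fix \<epsilon> :: real assume \<epsilon>: "0 < \<epsilon>" "\<epsilon> \<le> 1"
    \<comment> \<open>N depends on \<epsilon>: the set where - H > \<epsilon> must lie in the region
      J <= N / 2, where the cutoff weights dominate the full powers. The gradient bounds are uniform
      in N.\<close>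
    define N where "N = 2 * (1 + (A / \<epsilon>) powr (20/13))"
    have "1 \<le> N" by (simp add: N_def add_increasing2)
    have small: "bracket x \<le> N / 2" if "\<epsilon> < - H x" for x
      using bracket_le_of_less[OF \<epsilon>(1) that] by (simp add: N_def)
    have far: "- H x \<le> \<epsilon>" if "N < norm x" for x
    proof (rule ccontr)
      assume "\<not> - H x \<le> \<epsilon>"
      then have "(norm x)\<^sup>2 \<le> N / 2" using small[of x] by (simp add: bracket_def)
      moreover have "norm x * 1 \<le> norm x * norm x"
        using that \<open>1 \<le> N\<close> by (intro mult_left_mono) auto
      ultimately show False using that \<open>1 \<le> N\<close> by (simp add: power2_eq_square)
    qed
    obtain \<phi>a where a: "continuous_on UNIV \<phi>a" "\<And>x. 0 \<le> \<phi>a x"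
      "\<And>x. bracket x \<le> N / 2 \<Longrightarrow> bracket x powr (3/4) \<le> 8 * \<phi>a x"
      "\<And>x. N < norm x \<Longrightarrow> \<phi>a x = 0" "(LINT x|lborel. \<phi>a x * grad_sq x) \<le> Ba"
      using Ba[OF \<open>1 \<le> N\<close>] by blast
    obtain \<phi>b where b: "continuous_on UNIV \<phi>b" "\<And>x. 0 \<le> \<phi>b x"
      "\<And>x. bracket x \<le> N / 2 \<Longrightarrow> bracket x powr (-9/25) \<le> 8 * \<phi>b x"
      "\<And>x. N < norm x \<Longrightarrow> \<phi>b x = 0"
      "(LINT x|lborel. \<phi>b x * (\<epsilon> - H x) powr (-3/2) * grad_sq x) \<le> Bb"
      using Bb[OF \<open>1 \<le> N\<close>] \<epsilon>(1) by blast
    have pos: "0 < \<epsilon> - H x" for x using \<epsilon> H_le_0[of x] by simp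
    let ?t1 = "\<lambda>x. trunc' \<epsilon> (- H x)" and ?t2 = "\<lambda>x. trunc'' \<epsilon> (- H x)"
    note tr0 = trunc_eq_0[OF far]
    have d0: "((\<lambda>t. - trunc \<epsilon> (- t)) has_real_derivative trunc' \<epsilon> (- t)) (at t)" for t
      using DERIV_minus[OF DERIV_mirror[THEN iffD1, OF DERIV_trunc(1)[OF \<epsilon>(1), of "- t"]]] by simp
    have d1: "((\<lambda>t. trunc' \<epsilon> (- t)) has_real_derivative - trunc'' \<epsilon> (- t)) (at t)" for t
      using DERIV_mirror[THEN iffD1, OF DERIV_trunc(2)[OF \<epsilon>(1), of "- t"]] .
    have c2: "continuous_on UNIV ?t2"
      by (intro continuous_on_compose2[OF continuous_on_trunc''[OF \<epsilon>(1)]] continuous_on_minus continuous_H) auto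
    have c1: "continuous_on UNIV ?t1"
      by (rule continuous_comp_H[OF d1])
    \<comment> \<open>With \<phi> = 1 the truncation alone supplies compact support, so no cutoff
      error arises and the two integrals balance exactly.\<close>
    have "(LINT x|lborel. 1 * (- ?t2 x) * grad_sq x + 1 * ?t1 x * Om x -
        (- trunc \<epsilon> (- H x)) * ((\<Sum>i\<in>(UNIV::3 set). 0) + (\<Sum>i\<in>UNIV. v i x * 0))) = 0"
    proof (rule renormalized_identity[where F = "\<lambda>t. - trunc \<epsilon> (- t)" and F' = "\<lambda>t. trunc' \<epsilon> (- t)"
          and F'' = "\<lambda>t. - trunc'' \<epsilon> (- t)" and R = N])
      show "continuous_on UNIV (\<lambda>x. - ?t2 x)" by (intro continuous_on_minus c2)
    qed (use tr0 in \<open>auto simp: has_partial_const d0 d1\<close>)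
    then have "(LINT x|lborel. ?t1 x * Om x - ?t2 x * grad_sq x) = 0" by simp
    moreover have i1: "integrable lborel (\<lambda>x. ?t1 x * Om x)"
      by (rule bounded_support_integrable[of _ N]) (use tr0 in \<open>auto intro!: continuous_on_mult c1 continuous_Om\<close>)
    moreover have i2: "integrable lborel (\<lambda>x. ?t2 x * grad_sq x)"
      by (rule bounded_support_integrable[of _ N]) (use tr0 in \<open>auto intro!: continuous_on_mult c2 continuous_grad_sq\<close>)
    ultimately have eq: "(LINT x|lborel. ?t1 x * Om x) = (LINT x|lborel. ?t2 x * grad_sq x)" by simp
    have ia: "integrable lborel (\<lambda>x. \<phi>a x * grad_sq x)"
      by (rule bounded_support_integrable[of _ N]) (use a in \<open>auto intro!: continuous_on_mult continuous_grad_sq\<close>)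
    have ib: "integrable lborel (\<lambda>x. \<phi>b x * (\<epsilon> - H x) powr (-3/2) * grad_sq x)"
    proof (rule bounded_support_integrable[of _ N])
      show "continuous_on UNIV (\<lambda>x. \<phi>b x * (\<epsilon> - H x) powr (-3/2) * grad_sq x)"
        by (intro continuous_on_mult b continuous_grad_sq continuous_on_powr continuous_on_diff
            continuous_on_const continuous_H) (use pos in \<open>force simp: less_le\<close>)
    qed (use b in simp)
    let ?\<epsilon> = "\<epsilon> powr (1/100)"
    have pt: "?t2 x * grad_sq x \<le> 48 * ?\<epsilon> * (\<phi>a x * grad_sq x) +
        192 * ?\<epsilon> * (\<phi>b x * (\<epsilon> - H x) powr (-3/2) * grad_sq x)" for x
    proof (cases "\<epsilon> < - H x")
      case True
      let ?q = "- H x"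
      \<comment> \<open>The singular bound is used with \<kappa> = \<epsilon>: where \<epsilon> < -
        H, the shifted \<epsilon> - H is at most - 2 H, and 2^(3/2) <= 4.\<close>
      have sq: "?q powr (-3/2) \<le> 4 * (\<epsilon> - H x) powr (-3/2)"
      proof -
        have "q powr (-3/2) = 2 powr (3/2) * (2 * q) powr (-3/2)" for q :: real
        proof -
          have "2 powr (3/2) * (2 * q) powr (-3/2) = 2 powr (3/2) * (2 powr (-3/2) * q powr (-3/2))"
            by (simp only: powr_mult)
          also have "\<dots> = (2 powr (3/2) * 2 powr (-3/2)) * q powr (-3/2)"
            by (rule mult.assoc[symmetric])
          also have "2 powr (3/2) * 2 powr (-3/2) = (1::real)"
            by (simp flip: powr_add)
          finally show ?thesis by simp
        qed
        then have "?q powr (-3/2) = 2 powr (3/2) * (2 * ?q) powr (-3/2)" .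
        also have "\<dots> \<le> 2 powr 2 * (\<epsilon> - H x) powr (-3/2)"
          using True \<epsilon> pos[of x] by (intro mult_mono powr_mono powr_mono2') auto
        finally show ?thesis by simp
      qed
      have "?t2 x \<le> 6 * (\<epsilon>\<^sup>2 / ?q ^ 3)" using trunc''_bounds(2)[OF \<epsilon>(1) True] .
      also have "\<dots> \<le> 6 * (?\<epsilon> * (bracket x powr (3/4) + bracket x powr (-9/25) * ?q powr (-3/2)))"
        using interpolation_bound[OF \<epsilon> True bracket_ge_1[of x]] by simp
      also have "\<dots> \<le> 6 * (?\<epsilon> * (8 * \<phi>a x + (8 * \<phi>b x) * (4 * (\<epsilon> - H x) powr (-3/2))))"
        using a(3)[OF small[OF True]] b(3)[OF small[OF True]] sq b(2)[of x]
        by (intro mult_left_mono add_mono mult_mono) auto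
      finally have "?t2 x * grad_sq x \<le>
          6 * (?\<epsilon> * (8 * \<phi>a x + (8 * \<phi>b x) * (4 * (\<epsilon> - H x) powr (-3/2)))) * grad_sq x"
        using grad_sq_nonneg by (rule mult_right_mono)
      then show ?thesis by (simp add: algebra_simps)
    next
      case False
      then show ?thesis
        using trunc_eq_0[of "- H x" \<epsilon>] a(2)[of x] b(2)[of x] grad_sq_nonneg[of x] by simp
    qed
    have "(LINT x|lborel. ?t2 x * grad_sq x) \<le> (LINT x|lborel. 48 * ?\<epsilon> * (\<phi>a x * grad_sq x) +
        192 * ?\<epsilon> * (\<phi>b x * (\<epsilon> - H x) powr (-3/2) * grad_sq x))"
      using i2 ia ib pt by (intro integral_mono) auto
    also have "\<dots> = 48 * ?\<epsilon> * (LINT x|lborel. \<phi>a x * grad_sq x) +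
        192 * ?\<epsilon> * (LINT x|lborel. \<phi>b x * (\<epsilon> - H x) powr (-3/2) * grad_sq x)"
      using ia ib by simp
    also have "\<dots> \<le> 48 * ?\<epsilon> * Ba + 192 * ?\<epsilon> * Bb"
      using a(5) b(5) by (intro add_mono mult_left_mono) auto
    finally show "(LINT x|lborel. ?t1 x * Om x) \<le> (48 * Ba + 192 * Bb) * ?\<epsilon>"
      unfolding eq by (simp add: algebra_simps)
  qed
qed

lemma Om_eq_0_if_negative:
  assumes "H x < 0"
  shows "Om x = 0"
proof -
  define \<eta> where "\<eta> = - H x / 2"
  have "0 < \<eta>" "\<eta> < - H x" using assms by (simp_all add: \<eta>_def)
  \<comment> \<open>A continuous weight independent of \<epsilon>, positive at the given point. Once
    \<epsilon> < \<eta> / 2 it is at most 4 times \<open>trunc' \<epsilon> (- H x)\<close>, so its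
    integral against Om is squeezed to 0.\<close>
  define \<zeta> where "\<zeta> x = min 1 (max 0 (- H x - \<eta>))" for x
  have \<zeta>: "0 \<le> \<zeta> x" "\<zeta> x \<le> 1" "- H x \<le> \<eta> \<Longrightarrow> \<zeta> x = 0" for x
    by (auto simp: \<zeta>_def)
  obtain C where C: "\<And>\<epsilon>. 0 < \<epsilon> \<Longrightarrow> \<epsilon> \<le> 1 \<Longrightarrow>
      (LINT x|lborel. trunc' \<epsilon> (- H x) * Om x) \<le> C * \<epsilon> powr (1/100)"
    using Om_integral_bound by blast
  have far: "\<exists>R. \<forall>x. R < norm x \<longrightarrow> - H x < e" if "0 < e" for e
    using order_tendstoD(1)[OF H_tendsto_0, of "- e"] that
    unfolding eventually_at_infinity by (metis less_imp_le minus_less_iff neg_less_0_iff_less)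
  have cont: "continuous_on UNIV (\<lambda>x. \<zeta> x * Om x)"
    unfolding \<zeta>_def by (intro continuous_intros continuous_H continuous_Om)
  obtain R where R: "\<And>x. R < norm x \<Longrightarrow> - H x < \<eta>" using far[OF \<open>0 < \<eta>\<close>] by blast
  have supp: "\<zeta> x * Om x = 0" if "R < norm x" for x
    using R[OF that] \<zeta>(3)[of x] by simp
  have le: "(LINT x|lborel. \<zeta> x * Om x) \<le> 4 * (C * \<epsilon> powr (1/100))"
    if "0 < \<epsilon>" "\<epsilon> < min 1 (\<eta> / 2)" for \<epsilon>
  proof -
    obtain R' where R': "\<And>x. R' < norm x \<Longrightarrow> - H x < \<epsilon>" using far[OF \<open>0 < \<epsilon>\<close>] by blast
    have d1: "((\<lambda>t. trunc' \<epsilon> (- t)) has_real_derivative - trunc'' \<epsilon> (- t)) (at t)" for t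
      using DERIV_mirror[THEN iffD1, OF DERIV_trunc(2)[OF that(1), of "- t"]] .
    have "integrable lborel (\<lambda>x. trunc' \<epsilon> (- H x) * Om x)"
    proof (rule bounded_support_integrable)
      show "continuous_on UNIV (\<lambda>x. trunc' \<epsilon> (- H x) * Om x)"
        by (intro continuous_on_mult continuous_comp_H[OF d1] continuous_Om)
      show "trunc' \<epsilon> (- H x) * Om x = 0" if "R' < norm x" for x
        using trunc_eq_0[OF less_imp_le[OF R'[OF that]]] by simp
    qed
    then have int: "integrable lborel (\<lambda>x. 4 * (trunc' \<epsilon> (- H x) * Om x))" by simp
    have "\<zeta> x * Om x \<le> 4 * (trunc' \<epsilon> (- H x) * Om x)" for x
    proof -
      have "\<zeta> x \<le> 4 * trunc' \<epsilon> (- H x)"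
      proof (cases "- H x \<le> \<eta>")
        case True
        then show ?thesis using \<zeta>(3)[of x] trunc'_ge(1)[OF that(1)] by simp
      next
        case False
        then have "1/4 \<le> trunc' \<epsilon> (- H x)" using that by (intro trunc'_ge(2)) auto
        then show ?thesis using \<zeta>(2)[of x] by simp
      qed
      then have "\<zeta> x * Om x \<le> 4 * trunc' \<epsilon> (- H x) * Om x"
        using Om_nonneg by (rule mult_right_mono)
      then show ?thesis by simp
    qed
    then have "(LINT x|lborel. \<zeta> x * Om x) \<le> (LINT x|lborel. 4 * (trunc' \<epsilon> (- H x) * Om x))"
      using int bounded_support_integrable[OF cont supp] by (intro integral_mono) auto
    also have "\<dots> \<le> 4 * (C * \<epsilon> powr (1/100))" using C[of \<epsilon>] that by simp
    finally show ?thesis .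
  qed
  have "(LINT x|lborel. \<zeta> x * Om x) \<le> 0"
  proof (rule tendsto_lowerbound)
    have "((\<lambda>\<epsilon>::real. \<epsilon> powr (1/100)) \<longlongrightarrow> 0 powr (1/100)) (at_right 0)"
      by (intro tendsto_powr' tendsto_ident_at tendsto_const)
        (auto simp: eventually_at_right_less intro: eventually_mono[OF eventually_at_right_less])
    then have "((\<lambda>\<epsilon>. 4 * (C * \<epsilon> powr (1/100))) \<longlongrightarrow> 4 * (C * 0)) (at_right 0)"
      by (intro tendsto_mult tendsto_const) simp
    then show "((\<lambda>\<epsilon>. 4 * (C * \<epsilon> powr (1/100))) \<longlongrightarrow> 0) (at_right 0)" by simp
    have "\<forall>\<^sub>F \<epsilon> in at_right 0. \<epsilon> \<in> {0<..<min 1 (\<eta> / 2)}"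
      using \<open>0 < \<eta>\<close> by (intro eventually_at_right_real) simp
    then show "\<forall>\<^sub>F \<epsilon> in at_right 0. (LINT x|lborel. \<zeta> x * Om x) \<le> 4 * (C * \<epsilon> powr (1/100))"
      by eventually_elim (use le in simp)
  qed simp
  moreover have "0 \<le> (LINT x|lborel. \<zeta> x * Om x)"
    by (intro integral_nonneg_AE) (simp add: \<zeta>(1) Om_nonneg)
  ultimately have "\<zeta> x * Om x = 0"
    by (intro continuous_integral_eq_0[OF cont supp]) (simp_all add: \<zeta>(1) Om_nonneg)
  moreover have "\<zeta> x \<noteq> 0" using \<open>\<eta> < - H x\<close> by (simp add: \<zeta>_def)
  ultimately show ?thesis by simp
qed

text \<open>If Om were nonzero somewhere, H would vanish on the open set where it is nonzero, and
  with it all derivatives of H; \<open>transport\<close> then leaves Om = 0.\<close>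

lemma Om_eq_0: "Om x = 0"
proof (rule ccontr)
  assume "Om x \<noteq> 0"
  define U where "U = {y. Om y \<noteq> 0}"
  have "open U"
    unfolding U_def by (intro open_Collect_neq continuous_Om continuous_on_const)
  have "x \<in> U" using \<open>Om x \<noteq> 0\<close> by (simp add: U_def)
  have H0: "H y = 0" if "y \<in> U" for y
    using that Om_eq_0_if_negative[of y] H_le_0[of y] by (cases "H y < 0") (simp_all add: U_def)
  have d0: "partial_derivative i H y = 0" if "y \<in> U" for y i
    by (rule has_partial_zero_on_open[OF smooth_has_partial[OF smooth_H] \<open>open U\<close> that H0])
  have "partial_derivative i (partial_derivative i H) x = 0" for i
    by (rule has_partial_zero_on_open[OF smooth_has_partial[OF smooth_partial_derivative[OF smooth_H]]
          \<open>open U\<close> \<open>x \<in> U\<close> d0])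
  then show False using transport[of x] d0[OF \<open>x \<in> U\<close>] \<open>Om x \<noteq> 0\<close> by simp
qed

end

section \<open>The Navier--Stokes equations\<close>

text \<open>The limsup controls f only outside some ball; continuity on that ball supplies the rest.
  The factor 2 powr (s / 2) comes from bracket x <= 2 |x|^2 for |x| >= 1.\<close>

lemma Limsup_powr_norm_bound:
  fixes f :: "real^3 \<Rightarrow> 'b::real_normed_vector"
  assumes cont: "continuous_on UNIV f" and "0 \<le> s"
    and lim: "Limsup at_infinity (\<lambda>x. ereal (norm x powr s * norm (f x))) < \<infinity>"
  shows "\<exists>C\<ge>0. \<forall>x. norm (f x) \<le> C * bracket x powr (- (s / 2))"
proof -
  have "Limsup at_infinity (\<lambda>x. ereal (norm x powr s * norm (f x))) \<noteq> \<infinity>"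
    using lim by auto
  then obtain n :: nat where "Limsup at_infinity (\<lambda>x. ereal (norm x powr s * norm (f x))) < ereal (real n)"
    unfolding less_PInf_Ex_of_nat by (elim exE)
  from Limsup_lessD[OF this] obtain R where R: "\<And>x. R \<le> norm x \<Longrightarrow> norm x powr s * norm (f x) < real n"
    by (auto simp: eventually_at_infinity)
  define S where "S = max R 1"
  have "compact (f ` cball 0 S)"
    by (intro compact_continuous_image continuous_on_subset[OF cont]) auto
  then obtain M where "0 < M" and M: "\<And>x. x \<in> cball 0 S \<Longrightarrow> norm (f x) \<le> M"
    using compact_imp_bounded bounded_pos[of "f ` cball 0 S"] by blast
  then have "0 \<le> M" by simp
  define C where "C = 2 powr (s / 2) * real n + M * (1 + S\<^sup>2) powr (s / 2)"
  have "0 \<le> C" using \<open>0 \<le> M\<close> by (simp add: C_def)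
  have "norm (f x) \<le> C * bracket x powr (- (s / 2))" for x
  proof -
    have "bracket x powr (s / 2) * norm (f x) \<le> C"
    proof (cases "norm x \<le> S")
      case True
      then have "(norm x)\<^sup>2 \<le> S\<^sup>2" by (intro power_mono) auto
      then have "bracket x powr (s / 2) * norm (f x) \<le> (1 + S\<^sup>2) powr (s / 2) * M"
        using True M[of x] \<open>0 \<le> s\<close> bracket_pos[of x]
        by (intro mult_mono powr_mono2) (auto simp: bracket_def)
      also have "\<dots> \<le> C" by (simp add: C_def)
      finally show ?thesis .
    next
      case False
      then have x: "1 \<le> norm x" "R \<le> norm x" by (auto simp: S_def)
      then have "1 \<le> (norm x)\<^sup>2" by (simp add: one_le_power)
      then have "bracket x powr (s / 2) \<le> (2 * (norm x)\<^sup>2) powr (s / 2)"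
        using \<open>0 \<le> s\<close> bracket_pos[of x] by (intro powr_mono2) (auto simp: bracket_def)
      also have "\<dots> = 2 powr (s / 2) * ((norm x)\<^sup>2) powr (s / 2)"
        by (rule powr_mult)
      also have "((norm x)\<^sup>2) powr (s / 2) = norm x powr s"
      proof -
        have "(norm x)\<^sup>2 = norm x powr 2" using x by (simp add: powr_numeral)
        then show ?thesis by (simp add: powr_powr del: powr_numeral)
      qed
      finally have "bracket x powr (s / 2) * norm (f x) \<le> (2 powr (s / 2) * norm x powr s) * norm (f x)"
        by (intro mult_right_mono) auto
      also have "\<dots> \<le> 2 powr (s / 2) * real n"
        using R[OF x(2)] by (simp add: mult.assoc)
      also have "\<dots> \<le> C" using \<open>0 \<le> M\<close> by (simp add: C_def)
      finally show ?thesis .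
    qed
    then show ?thesis
      using bracket_pos[of x] by (simp add: powr_minus field_simps)
  qed
  with \<open>0 \<le> C\<close> show ?thesis by blast
qed

text \<open>The skew-symmetric part of the velocity gradient, which stands in for the curl.\<close>

definition vort :: "(real^3 \<Rightarrow> real^3) \<Rightarrow> 3 \<Rightarrow> 3 \<Rightarrow> real^3 \<Rightarrow> real" where
  "vort v i j x = partial_derivative i (\<lambda>y. v y $ j) x - partial_derivative j (\<lambda>y. v y $ i) x"

lemma vort_skew: "vort v i j x = - vort v j i x"
  by (simp add: vort_def)

lemma smooth_vort: "smooth v \<Longrightarrow> smooth (vort v i j)"
  unfolding vort_def[abs_def] by (intro smooth_diff smooth_partial_derivative smooth_component)

lemma abs_vort_le_curl: "\<bar>vort v i j x\<bar> \<le> norm (curl v x)"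
proof -
  have c: "curl v x $ 1 = vort v 2 3 x" "curl v x $ 2 = vort v 3 1 x" "curl v x $ 3 = vort v 1 2 x"
    by (simp_all add: curl_def vort_def)
  have "\<bar>vort v 2 3 x\<bar> \<le> norm (curl v x)" "\<bar>vort v 3 1 x\<bar> \<le> norm (curl v x)" "\<bar>vort v 1 2 x\<bar> \<le> norm (curl v x)"
    unfolding c[symmetric] by (rule component_le_norm_cart)+
  moreover have "vort v i i x = 0" for i by (simp add: vort_def)
  moreover have "\<bar>vort v 3 2 x\<bar> = \<bar>vort v 2 3 x\<bar>" "\<bar>vort v 1 3 x\<bar> = \<bar>vort v 3 1 x\<bar>" "\<bar>vort v 2 1 x\<bar> = \<bar>vort v 1 2 x\<bar>"
    using vort_skew[of v 3 2 x] vort_skew[of v 1 3 x] vort_skew[of v 2 1 x] by auto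
  ultimately show ?thesis
    using exhaust_3[of i] exhaust_3[of j] by (elim disjE) simp_all
qed

lemma continuous_on_curl:
  assumes "smooth v"
  shows "continuous_on UNIV (curl v)"
proof -
  have eq: "curl v = (\<lambda>x. \<chi> i::3. if i = 1 then vort v 2 3 x else if i = 2 then vort v 3 1 x else vort v 1 2 x)"
    by (auto simp: fun_eq_iff vec_eq_iff forall_3 curl_def vort_def)
  have "continuous_on UNIV (vort v i j)" for i j
    by (intro smooth_continuous_on smooth_vort assms)
  then have "continuous_on UNIV (\<lambda>x. if i = 1 then vort v 2 3 x else if i = 2 then vort v 3 1 x else vort v 1 2 x)"
    for i :: 3
    by (cases "i = 1"; cases "i = 2") simp_all
  then show ?thesis
    unfolding eq by (rule continuous_on_vec_lambda)
qed

lemma laplacian_component: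
  assumes "smooth (v :: real^3 \<Rightarrow> real^3)"
  shows "laplacian v x $ i = (\<Sum>j\<in>UNIV. partial_derivative j (partial_derivative j (\<lambda>y. v y $ i)) x)"
  using assms
  by (simp add: laplacian_def partial_derivative_component smooth_differentiable_on smooth_partial_derivative)

text \<open>The identity curl curl v = grad div v - Laplacian v in skew-matrix form; exchanging
  partials makes the divergence appear.\<close>

lemma laplacian_eq_div_vort:
  assumes sm: "smooth v" and div: "\<And>x. divergence v x = 0"
  shows "(\<Sum>j\<in>UNIV. partial_derivative j (vort v i j) x) =
    - (\<Sum>j\<in>UNIV. partial_derivative j (partial_derivative j (\<lambda>y. v y $ i)) x)"
proof -
  let ?u = "\<lambda>j y. v y $ j"
  have su: "smooth (?u j)" for j by (rule smooth_component[OF sm])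
  have "partial_derivative j (vort v i j) = (\<lambda>x. partial_derivative j (partial_derivative i (?u j)) x -
      partial_derivative j (partial_derivative j (?u i)) x)" for j
    unfolding vort_def[abs_def]
    by (intro has_partial_eqI has_partial_diff smooth_has_partial smooth_partial_derivative su)
  then have "(\<Sum>j\<in>UNIV. partial_derivative j (vort v i j) x) =
      (\<Sum>j\<in>UNIV. partial_derivative i (partial_derivative j (?u j)) x) -
      (\<Sum>j\<in>UNIV. partial_derivative j (partial_derivative j (?u i)) x)"
    by (simp add: sum_subtractf partial_derivative_commute[OF su, of _ i])
  moreover have "partial_derivative i (\<lambda>x. \<Sum>j\<in>UNIV. partial_derivative j (?u j) x) =
      (\<lambda>x. \<Sum>j\<in>UNIV. partial_derivative i (partial_derivative j (?u j)) x)"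
    by (intro has_partial_eqI has_partial_sum smooth_has_partial smooth_partial_derivative su)
  moreover have "(\<lambda>x. \<Sum>j\<in>UNIV. partial_derivative j (?u j) x) = (\<lambda>x. 0)"
    using div by (simp add: divergence_def fun_eq_iff)
  moreover have "partial_derivative i (\<lambda>x::real^3. 0) = (\<lambda>x. 0::real)"
    by (intro has_partial_eqI has_partial_const)
  ultimately show ?thesis by (simp add: fun_eq_iff)
qed

lemma sum_skew_eq_0:
  fixes a :: "'i::finite \<Rightarrow> 'i \<Rightarrow> real"
  assumes "\<And>i j. a i j = - a j i"
  shows "(\<Sum>i\<in>UNIV. \<Sum>j\<in>UNIV. a i j) = 0"
proof -
  have "(\<Sum>i\<in>UNIV. \<Sum>j\<in>UNIV. a i j) = (\<Sum>i\<in>UNIV. \<Sum>j\<in>UNIV. - a j i)"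
    by (intro sum.cong refl assms)
  also have "\<dots> = - (\<Sum>i\<in>UNIV. \<Sum>j\<in>UNIV. a i j)"
    by (subst sum.swap) (simp add: sum_negf)
  finally show ?thesis by simp
qed

text \<open>Here g is v x curl v and the sum of the partial_j w_ij is the i-th component of curl
  curl v. The sum of squares counts each component of the curl twice, hence the 1/2. The constant h
  is left free because its value emerges only from the decay estimate for h = 0.\<close>

lemma head_equation_vort:
  fixes v :: "real^3 \<Rightarrow> real^3" and p :: "real^3 \<Rightarrow> real" and h :: real
  assumes sm: "smooth v" and smp: "smooth p"
    and NS: "\<And>x. - laplacian v x + advection v v x + gradient p x = 0"
    and div: "\<And>x. divergence v x = 0"
  defines "H \<equiv> \<lambda>x. 1/2 * (\<Sum>j\<in>UNIV. v x $ j * v x $ j) + p x - h"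
    and "g \<equiv> \<lambda>i x. \<Sum>j\<in>UNIV. v x $ j * vort v i j x"
  shows "partial_derivative i H x = g i x - (\<Sum>j\<in>UNIV. partial_derivative j (vort v i j) x)"
    and "head_equation H (\<lambda>i x. v x $ i) g (\<lambda>x. 1/2 * (\<Sum>i\<in>UNIV. \<Sum>j\<in>UNIV. (vort v i j x)\<^sup>2))"
proof -
  let ?u = "\<lambda>j y. v y $ j" and ?w = "vort v"
  have su: "smooth (?u j)" for j by (rule smooth_component[OF sm])
  note sw = smooth_vort[OF sm]
  note smooth_intros = smooth_add smooth_diff smooth_mult smooth_sum smooth_const su sw smp
  note hp = has_partial_eqI has_partial_diff has_partial_add has_partial_mult has_partial_sum
    has_partial_const smooth_has_partial
  have sH: "smooth H" unfolding H_def by (intro smooth_intros)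
  have sg: "smooth (g i)" for i unfolding g_def by (intro smooth_intros)
  have dH: "partial_derivative i H x = (\<Sum>j\<in>UNIV. v x $ j * partial_derivative i (?u j) x) + partial_derivative i p x" for i x
  proof -
    have "partial_derivative i H = (\<lambda>x. (0 * (\<Sum>j\<in>UNIV. v x $ j * v x $ j) +
        1/2 * (\<Sum>j\<in>UNIV. partial_derivative i (?u j) x * v x $ j + v x $ j * partial_derivative i (?u j) x)) +
        partial_derivative i p x - 0)"
      unfolding H_def by (intro hp su smp)
    then show ?thesis by (simp add: sum_distrib_left mult.commute)
  qed
  show eq: "partial_derivative i H x = g i x - (\<Sum>j\<in>UNIV. partial_derivative j (?w i j) x)" for i x
  proof -
    have "(- laplacian v x + advection v v x + gradient p x) $ i = 0" using NS[of x] by simp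
    then have "partial_derivative i p x = laplacian v x $ i - (\<Sum>j\<in>UNIV. v x $ j * partial_derivative j (?u i) x)"
      by (simp add: advection_def gradient_def partial_derivative_component[OF smooth_differentiable_on[OF sm]])
    then show ?thesis
      unfolding dH laplacian_eq_div_vort[OF sm div] laplacian_component[OF sm]
      by (simp add: g_def vort_def right_diff_distrib sum_subtractf)
  qed
  define D where "D x = (\<Sum>i\<in>UNIV. partial_derivative i (partial_derivative i H) x)" for x
  have D: "D x = (\<Sum>i\<in>UNIV. partial_derivative i (g i) x)" for x
  proof -
    have pH: "partial_derivative i H = (\<lambda>x. g i x - (\<Sum>j\<in>UNIV. partial_derivative j (?w i j) x))" for i
      using eq by blast
    have "partial_derivative i (partial_derivative i H) = (\<lambda>x. partial_derivative i (g i) x -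
        (\<Sum>j\<in>UNIV. partial_derivative i (partial_derivative j (?w i j)) x))" for i
      unfolding pH by (intro hp sg smooth_partial_derivative sw)
    then have "D x = (\<Sum>i\<in>UNIV. partial_derivative i (g i) x) -
        (\<Sum>i\<in>UNIV. \<Sum>j\<in>UNIV. partial_derivative i (partial_derivative j (?w i j)) x)"
      by (simp add: D_def sum_subtractf)
    also have "(\<Sum>i\<in>UNIV. \<Sum>j\<in>UNIV. partial_derivative i (partial_derivative j (?w i j)) x) = 0"
    proof (rule sum_skew_eq_0)
      fix i j
      have neg: "partial_derivative k (\<lambda>x. 0 - f x) = (\<lambda>x. 0 - partial_derivative k f x)"
        if "smooth f" for k :: 3 and f :: "real^3 \<Rightarrow> real"
        using that by (intro hp)
      have "?w i j = (\<lambda>x. 0 - ?w j i x)" using vort_skew[of v i j] by (auto simp: fun_eq_iff)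
      then have "partial_derivative i (partial_derivative j (?w i j)) =
          (\<lambda>x. 0 - partial_derivative i (partial_derivative j (?w j i)) x)"
        by (simp only: neg sw smooth_partial_derivative)
      then show "partial_derivative i (partial_derivative j (?w i j)) x =
          - partial_derivative j (partial_derivative i (?w j i)) x"
        by (simp add: partial_derivative_commute[OF sw, of i j])
    qed
    finally show ?thesis by simp
  qed
  have T: "D x = (\<Sum>i\<in>UNIV. v x $ i * partial_derivative i H x) + 1/2 * (\<Sum>i\<in>UNIV. \<Sum>j\<in>UNIV. (?w i j x)\<^sup>2)" for x
  proof -
    have "partial_derivative i (g i) = (\<lambda>x. \<Sum>j\<in>UNIV. partial_derivative i (?u j) x * ?w i j x +
        v x $ j * partial_derivative i (?w i j) x)" for i
      unfolding g_def by (intro hp su sw)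
    then have "D x = (\<Sum>i\<in>UNIV. \<Sum>j\<in>UNIV. partial_derivative i (?u j) x * ?w i j x) +
        (\<Sum>i\<in>UNIV. \<Sum>j\<in>UNIV. v x $ j * partial_derivative i (?w i j) x)"
      by (simp add: D sum.distrib)
    moreover have "(\<Sum>i\<in>UNIV. \<Sum>j\<in>UNIV. partial_derivative i (?u j) x * ?w i j x) =
        1/2 * (\<Sum>i\<in>UNIV. \<Sum>j\<in>UNIV. (?w i j x)\<^sup>2)"
    proof -
      \<comment> \<open>Each summand is (partial_i u_j + partial_j u_i) w_ij, symmetric times
        skew.\<close>
      have "(\<Sum>i\<in>UNIV. \<Sum>j\<in>UNIV. 2 * (partial_derivative i (?u j) x * ?w i j x) - (?w i j x)\<^sup>2) = 0"
        by (rule sum_skew_eq_0) (simp add: vort_def power2_eq_square algebra_simps)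
      then have "2 * (\<Sum>i\<in>UNIV. \<Sum>j\<in>UNIV. partial_derivative i (?u j) x * ?w i j x) =
          (\<Sum>i\<in>UNIV. \<Sum>j\<in>UNIV. (?w i j x)\<^sup>2)"
        by (simp add: sum_subtractf flip: sum_distrib_left)
      then show ?thesis by linarith
    qed
    moreover have "(\<Sum>i\<in>UNIV. \<Sum>j\<in>UNIV. v x $ j * partial_derivative i (?w i j) x) =
        (\<Sum>i\<in>UNIV. v x $ i * partial_derivative i H x)"
    proof -
      have neg: "partial_derivative i (?w i j) x = - partial_derivative i (?w j i) x" for i j
      proof -
        have "?w i j = (\<lambda>x. 0 - ?w j i x)" using vort_skew[of v i j] by (auto simp: fun_eq_iff)
        moreover have "partial_derivative i (\<lambda>x. 0 - ?w j i x) = (\<lambda>x. 0 - partial_derivative i (?w j i) x)"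
          by (intro hp sw)
        ultimately show ?thesis by simp
      qed
      \<comment> \<open>v x curl v is orthogonal to v, so pairing the gradient formula
        \<open>eq\<close> with v leaves only the second-order term.\<close>
      have g0: "(\<Sum>j\<in>UNIV. v x $ j * g j x) = 0"
      proof -
        have "(\<Sum>j\<in>UNIV. \<Sum>k\<in>UNIV. v x $ j * (v x $ k * ?w j k x)) = 0"
          by (rule sum_skew_eq_0) (simp add: vort_def algebra_simps)
        then show ?thesis by (simp add: g_def sum_distrib_left)
      qed
      have "(\<Sum>i\<in>UNIV. \<Sum>j\<in>UNIV. v x $ j * partial_derivative i (?w i j) x) =
          (\<Sum>j\<in>UNIV. \<Sum>i\<in>UNIV. v x $ j * partial_derivative i (?w i j) x)"
        by (rule sum.swap)
      also have "\<dots> = (\<Sum>j\<in>UNIV. v x $ j * (- (\<Sum>i\<in>UNIV. partial_derivative i (?w j i) x)))"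
        by (intro sum.cong refl) (simp add: neg[of _ _] sum_distrib_left sum_negf)
      also have "\<dots> = (\<Sum>j\<in>UNIV. v x $ j * (partial_derivative j H x - g j x))"
        by (simp add: eq)
      also have "\<dots> = (\<Sum>j\<in>UNIV. v x $ j * partial_derivative j H x)"
        using g0 by (simp add: right_diff_distrib sum_subtractf)
      finally show ?thesis .
    qed
    ultimately show ?thesis by simp
  qed
  show "head_equation H (\<lambda>i x. v x $ i) g (\<lambda>x. 1/2 * (\<Sum>i\<in>UNIV. \<Sum>j\<in>UNIV. (?w i j x)\<^sup>2))"
  proof
    show "continuous_on UNIV (\<lambda>x. 1/2 * (\<Sum>i\<in>UNIV. \<Sum>j\<in>UNIV. (?w i j x)\<^sup>2))"
      by (intro continuous_intros smooth_continuous_on sw)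
    show "0 \<le> 1/2 * (\<Sum>i\<in>UNIV. \<Sum>j\<in>UNIV. (?w i j x)\<^sup>2)" for x
      by (intro mult_nonneg_nonneg sum_nonneg) auto
    show "(\<Sum>i\<in>UNIV. partial_derivative i (?u i) x) = 0" for x
      using div[of x] by (simp add: divergence_def)
  qed (use sH su sg D T in \<open>simp_all add: D_def\<close>)
qed

theorem corollary1p2:
  fixes v :: "real^3 \<Rightarrow> real^3" and p :: "real^3 \<Rightarrow> real"
  assumes "smooth v" and "smooth p"
    and "\<And>x. - laplacian v x + advection v v x + gradient p x = 0"
    and "\<And>x. divergence v x = 0"
    and "(v \<longlongrightarrow> 0) at_infinity"
    and "Limsup at_infinity (\<lambda>x. ereal (norm x powr (5/3) * norm (curl v x))) < \<infinity>"
  shows "\<forall>x. v x = 0"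
proof -
  let ?u = "\<lambda>j y. v y $ j" and ?w = "vort v"
  let ?g = "\<lambda>i x. \<Sum>j\<in>UNIV. v x $ j * ?w i j x"
  let ?H = "\<lambda>h x. 1/2 * (\<Sum>j\<in>UNIV. v x $ j * v x $ j) + p x - h"
  note head = head_equation_vort[OF assms(1-4)]
  have su: "smooth (?u j)" for j by (rule smooth_component[OF assms(1)])
  note sw = smooth_vort[OF assms(1)]
  have lim: "(?u j \<longlongrightarrow> 0) at_infinity" for j
    using tendsto_vec_nth[OF assms(5), of j] by simp
  obtain C where "0 \<le> C" and C: "\<And>x. norm (curl v x) \<le> C * bracket x powr (-5/6)"
    using Limsup_powr_norm_bound[OF continuous_on_curl[OF assms(1)] _ assms(6)] by auto
  have wle: "\<bar>?w i j x\<bar> \<le> C * bracket x powr (-5/6)" for i j x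
    using abs_vort_le_curl C by (rule order_trans)
  obtain K where "0 \<le> K" and K: "\<And>(u :: 3 \<Rightarrow> real^3 \<Rightarrow> real) C x i. 0 \<le> C \<Longrightarrow> (\<And>i. smooth (u i)) \<Longrightarrow>
    (\<And>x. (\<Sum>j\<in>UNIV. partial_derivative j (u j) x) = 0) \<Longrightarrow> (\<And>i. (u i \<longlongrightarrow> 0) at_infinity) \<Longrightarrow>
    (\<And>i j x. \<bar>partial_derivative j (u i) x - partial_derivative i (u j) x\<bar> \<le> C * bracket x powr (-(5/6))) \<Longrightarrow>
    \<bar>u i x\<bar> \<le> K * C * bracket x powr (1/2 + 1/120 - 5/6)"
    using velocity_decay[of "1/120" "5/6"] by (auto 4 3)
  have div: "(\<Sum>j\<in>UNIV. partial_derivative j (?u j) x) = 0" for x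
    using assms(4)[of x] by (simp add: divergence_def)
  \<comment> \<open>The bound B is kept general: it is C while the decay is being established and 0
    once the curl is known to vanish.\<close>
  have vle: "\<bar>v x $ i\<bar> \<le> K * B * bracket x powr (-13/40)"
    if "0 \<le> B" "\<And>i j x. \<bar>?w i j x\<bar> \<le> B * bracket x powr (-5/6)" for B x i
    using K[of B ?u i x, OF that(1) su div lim] that(2) by (simp add: vort_def)
  define A where "A = C + K * C + 3 * (K * C * C)"
  have A: "0 \<le> A" "C \<le> A" "K * C \<le> A" "3 * (K * C * C) \<le> A"
    using \<open>0 \<le> C\<close> \<open>0 \<le> K\<close> by (simp_all add: A_def)
  have gle: "\<bar>?g i x\<bar> \<le> A * bracket x powr (-139/120)" for i x
  proof -
    have "\<bar>?g i x\<bar> \<le> (\<Sum>j\<in>(UNIV::3 set). (K * C * bracket x powr (-13/40)) * (C * bracket x powr (-5/6)))"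
      by (rule order_trans[OF sum_abs sum_mono])
        (unfold abs_mult, intro mult_mono vle wle \<open>0 \<le> C\<close>, use \<open>0 \<le> C\<close> \<open>0 \<le> K\<close> in auto)
    also have "\<dots> = 3 * (K * C * C) * bracket x powr (-13/40 + -5/6)"
      unfolding powr_add by simp
    also have "\<dots> \<le> A * bracket x powr (-139/120)"
      using A by (intro mult_mono) auto
    finally show ?thesis .
  qed
  have wle': "\<bar>?w i j x\<bar> \<le> A * bracket x powr (-5/6)" for i j x
    using A(2) by (intro order_trans[OF wle mult_right_mono]) simp_all
  \<comment> \<open>The pressure is determined up to a constant only. The estimate for h = 0 finds
    the limit of the head, and the equation is then interpreted again with that limit
    subtracted.\<close>
  have "\<exists>h K. \<forall>x. \<bar>?H 0 x - h\<bar> \<le> K * bracket x powr (1/2 + 1/120 - 139/120)"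
  proof (rule head_decay[where a = "5/6" and C = A and g = ?g and w = ?w])
    interpret head_equation "?H 0" ?u ?g "\<lambda>x. 1/2 * (\<Sum>i\<in>UNIV. \<Sum>j\<in>UNIV. (?w i j x)\<^sup>2)"
      by (rule head(2))
    show "smooth (?H 0)" by (rule smooth_H)
    show "continuous_on UNIV (?g i)" for i by (rule continuous_g)
    show "?w i j x = - ?w j i x" for i j x by (rule vort_skew)
    show "partial_derivative i (?H 0) x = ?g i x - (\<Sum>j\<in>UNIV. partial_derivative j (?w i j) x)" for i x
      by (rule head(1))
    show "\<bar>?g i x\<bar> \<le> A * bracket x powr (-(139/120))" for i x
      using gle by simp
    show "\<bar>?w i j x\<bar> \<le> A * bracket x powr (-(5/6))" for i j x
      using wle' by simp
  qed (simp_all add: A(1) sw)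
  then obtain h B where B: "\<And>x. \<bar>?H 0 x - h\<bar> \<le> B * bracket x powr (-13/20)"
    by auto
  define A' where "A' = max A B"
  have mono: "y \<le> A' * bracket x powr s" if "y \<le> a * bracket x powr s" "a \<le> A'"
    for y s a and x :: "real^3"
    using that(2) by (intro order_trans[OF that(1) mult_right_mono]) simp_all
  interpret head_equation "?H h" ?u ?g "\<lambda>x. 1/2 * (\<Sum>i\<in>UNIV. \<Sum>j\<in>UNIV. (?w i j x)\<^sup>2)"
    by (rule head(2))
  interpret decaying_head "?H h" ?u ?g "\<lambda>x. 1/2 * (\<Sum>i\<in>UNIV. \<Sum>j\<in>UNIV. (?w i j x)\<^sup>2)" A'
  proof
    show "0 \<le> A'" using A by (simp add: A'_def)
    show "\<bar>?H h x\<bar> \<le> A' * bracket x powr (-13/20)" for x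
      by (rule mono[of _ B]) (use B[of x] in \<open>simp_all add: A'_def\<close>)
    show "\<bar>v x $ i\<bar> \<le> A' * bracket x powr (-13/40)" for i x
      using A(3) by (intro mono[OF vle[OF \<open>0 \<le> C\<close> wle]]) (simp add: A'_def)
    show "\<bar>?g i x\<bar> \<le> A' * bracket x powr (-139/120)" for i x
      by (rule mono[OF gle]) (simp add: A'_def)
  qed
  have w0: "?w i j x = 0" for i j x
  proof -
    have "(\<Sum>i\<in>UNIV. \<Sum>j\<in>UNIV. (?w i j x)\<^sup>2) = 0" using Om_eq_0[of x] by simp
    then have "\<forall>i. (\<Sum>j\<in>UNIV. (?w i j x)\<^sup>2) = 0"
      by (subst (asm) sum_nonneg_eq_0_iff) (auto intro: sum_nonneg)
    then show ?thesis by (subst (asm) sum_nonneg_eq_0_iff) auto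
  qed
  have "v x $ i = 0" for x i
    using vle[of 0 x i] w0 by simp
  then show ?thesis by (simp add: vec_eq_iff)
qed

end
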